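(* For every $(\alpha,\beta,\gamma)\in R$ there exists a weighting $w$ of $H_9$ such that $(H_9,w)\in\mathbf{Tri}(\alpha,\beta,\gamma)$ and $t(H_9,w)=T_{\min}(\alpha,\beta,\gamma)$.
   Context: A tripartite graph is a graph $G=(V,E)$ with a fixed partition $V=A\dot\cup B\dot\cup C$ into three nonempty independent sets (vertex classes). A weighted tripartite graph $(G,w)$ is a tripartite graph with $w:V\to[0,1]$ such that $\sum_{a\in A}w(a)=\sum_{b\in B}w(b)=\sum_{c\in C}w(c)=1$. Its edge densities are $\alpha(G,w)=\sum_{bc\in E,\,b\in B,c\in C}w(b)w(c)$, $\beta(G,w)=\sum_{ac\in E,\,a\in A,c\in C}w(a)w(c)$, $\gamma(G,w)=\sum_{ab\in E,\,a\in A,b\in B}w(a)w(b)$. A triangle is a triple $a\in A,b\in B,c\in C$ with $ab,ac,bc\in E$; the triangle density is $t(G,w)=\sum_{\text{triangles }abc}w(a)w(b)w(c)$. $\mathbf{Tri}(\alpha,\beta,\gamma)$ is the set of weighted tripartite graphs with edge densities $\alpha,\beta,\gamma$, and $T_{\min}(\alpha,\beta,\gamma)=\min_{(G,w)\in\mathbf{Tri}(\alpha,\beta,\gamma)}t(G,w)$ (this minimum exists). Let $R=\{(\alpha,\beta,\gamma)\in[0,1]^3:\alpha\beta+\gamma>1,\ \alpha\gamma+\beta>1,\ \beta\gamma+\alpha>1\}$. $H_9$ is the tripartite graph with classes $A=\{a_1,a_2,a_3\}$, $B=\{b_1,b_2,b_3\}$, $C=\{c_1,c_2,c_3\}$ obtained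 from the complete tripartite graph $K_{3,3,3}$ on these classes by deleting the nine edges of the $9$-cycle $a_2b_1a_3c_3a_1c_2b_2c_1b_3a_2$, i.e. deleting $a_2b_1,a_3b_1,a_3c_3,a_1c_3,a_1c_2,b_2c_2,b_2c_1,b_3c_1,a_2b_3$. *)

theory Defs
  imports Complex_Main
begin

record 'v trigraph =
  clsA :: "'v set"
  clsB :: "'v set"
  clsC :: "'v set"
  edges :: "'v set set"

definition verts :: "'v trigraph \<Rightarrow> 'v set" where
  "verts G = clsA G \<union> clsB G \<union> clsC G"

definition independent :: "'v trigraph \<Rightarrow> 'v set \<Rightarrow> bool" where
  "independent G S \<longleftrightarrow> (\<forall>x\<in>S. \<forall>y\<in>S. {x, y} \<notin> edges G)"

definition tripartite :: "'v trigraph \<Rightarrow> bool" where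
  "tripartite G \<longleftrightarrow>
     finite (verts G) \<and>
     edges G \<subseteq> {{x, y} | x y. x \<in> verts G \<and> y \<in> verts G \<and> x \<noteq> y} \<and>
     clsA G \<noteq> {} \<and> clsB G \<noteq> {} \<and> clsC G \<noteq> {} \<and>
     clsA G \<inter> clsB G = {} \<and> clsA G \<inter> clsC G = {} \<and> clsB G \<inter> clsC G = {} \<and>
     independent G (clsA G) \<and> independent G (clsB G) \<and> independent G (clsC G)"

definition weighting :: "'v trigraph \<Rightarrow> ('v \<Rightarrow> real) \<Rightarrow> bool" where
  "weighting G w \<longleftrightarrow>
     (\<forall>v\<in>verts G. w v \<in> {0..1}) \<and>
     (\<Sum>a\<in>clsA G. w a) = 1 \<and> (\<Sum>b\<in>clsB G. w b) = 1 \<and> (\<Sum>c\<in>clsC G. w c) = 1"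

definition edge_density_alpha :: "'v trigraph \<Rightarrow> ('v \<Rightarrow> real) \<Rightarrow> real" where
  "edge_density_alpha G w =
     (\<Sum>(b, c) \<in> {(b, c). b \<in> clsB G \<and> c \<in> clsC G \<and> {b, c} \<in> edges G}. w b * w c)"

definition edge_density_beta :: "'v trigraph \<Rightarrow> ('v \<Rightarrow> real) \<Rightarrow> real" where
  "edge_density_beta G w =
     (\<Sum>(a, c) \<in> {(a, c). a \<in> clsA G \<and> c \<in> clsC G \<and> {a, c} \<in> edges G}. w a * w c)"

definition edge_density_gamma :: "'v trigraph \<Rightarrow> ('v \<Rightarrow> real) \<Rightarrow> real" where
  "edge_density_gamma G w =
     (\<Sum>(a, b) \<in> {(a, b). a \<in> clsA G \<and> b \<in> clsB G \<and> {a, b} \<in> edges G}. w a * w b)"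

definition triangles :: "'v trigraph \<Rightarrow> ('v \<times> 'v \<times> 'v) set" where
  "triangles G = {(a, b, c). a \<in> clsA G \<and> b \<in> clsB G \<and> c \<in> clsC G \<and>
     {a, b} \<in> edges G \<and> {a, c} \<in> edges G \<and> {b, c} \<in> edges G}"

definition triangle_density :: "'v trigraph \<Rightarrow> ('v \<Rightarrow> real) \<Rightarrow> real" where
  "triangle_density G w = (\<Sum>(a, b, c) \<in> triangles G. w a * w b * w c)"

definition Tri :: "real \<Rightarrow> real \<Rightarrow> real \<Rightarrow> ('v trigraph \<times> ('v \<Rightarrow> real)) set" where
  "Tri \<alpha> \<beta> \<gamma> = {(G, w). tripartite G \<and> weighting G w \<and>
     edge_density_alpha G w = \<alpha> \<and> edge_density_beta G w = \<beta> \<and> edge_density_gamma G w = \<gamma>}"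

text \<open>
  Every finite graph is isomorphic to one with vertices in \<open>nat\<close>, so it suffices to range over
  those (see \<open>T_min_le\<close> below for graphs over an arbitrary type). The infimum is over densities
  bounded below by 0; a member of \<open>Tri \<alpha> \<beta> \<gamma>\<close> whose triangle density equals it is a minimiser,
  and whenever the minimum exists the infimum is that minimum (see \<open>T_min_eq_iff\<close>).
\<close>
definition T_min :: "real \<Rightarrow> real \<Rightarrow> real \<Rightarrow> real" where
  "T_min \<alpha> \<beta> \<gamma> =
     (INF (G, w) \<in> (Tri \<alpha> \<beta> \<gamma> :: (nat trigraph \<times> (nat \<Rightarrow> real)) set). triangle_density G w)"

definition R :: "(real \<times> real \<times> real) set" where
  "R = {(\<alpha>, \<beta>, \<gamma>). \<alpha> \<in> {0..1} \<and> \<beta> \<in> {0..1} \<and> \<gamma> \<in> {0..1} \<and>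
     \<alpha> * \<beta> + \<gamma> > 1 \<and> \<alpha> * \<gamma> + \<beta> > 1 \<and> \<beta> * \<gamma> + \<alpha> > 1}"

definition complete_tripartite :: "'v set \<Rightarrow> 'v set \<Rightarrow> 'v set \<Rightarrow> 'v trigraph" where
  "complete_tripartite A B C = \<lparr>clsA = A, clsB = B, clsC = C,
     edges = {{x, y} | x y. x \<in> A \<and> y \<in> B \<or> x \<in> A \<and> y \<in> C \<or> x \<in> B \<and> y \<in> C}\<rparr>"

definition delete_edges :: "'v trigraph \<Rightarrow> 'v set set \<Rightarrow> 'v trigraph" where
  "delete_edges G D = G\<lparr>edges := edges G - D\<rparr>"

text \<open>The vertices \<open>a\<^sub>i\<close>, \<open>b\<^sub>i\<close>, \<open>c\<^sub>i\<close> are encoded as \<open>i\<close>, \<open>3 + i\<close>, \<open>6 + i\<close> for \<open>i = 1, 2, 3\<close>.\<close>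
definition H9 :: "nat trigraph" where
  "H9 = (let a1 = 1; a2 = 2; a3 = 3; b1 = 4; b2 = 5; b3 = 6; c1 = 7; c2 = 8; c3 = 9 in
     delete_edges (complete_tripartite {a1, a2, a3} {b1, b2, b3} {c1, c2, c3})
       {{a2, b1}, {b1, a3}, {a3, c3}, {c3, a1}, {a1, c2}, {c2, b2}, {b2, c1}, {c1, b3}, {b3, a2}})"

lemma tripartite_complete_delete:
  assumes "finite A" "finite B" "finite C" "A \<noteq> {}" "B \<noteq> {}" "C \<noteq> {}"
    and disj: "A \<inter> B = {}" "A \<inter> C = {}" "B \<inter> C = {}"
  shows "tripartite (delete_edges (complete_tripartite A B C) D)"
proof -
  let ?G = "delete_edges (complete_tripartite A B C) D"
  have cls: "clsA ?G = A" "clsB ?G = B" "clsC ?G = C"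
    by (simp_all add: delete_edges_def complete_tripartite_def)
  have E: "edges ?G \<subseteq> {{x, y} | x y. x \<in> A \<and> y \<in> B \<or> x \<in> A \<and> y \<in> C \<or> x \<in> B \<and> y \<in> C}"
    by (auto simp: delete_edges_def complete_tripartite_def)
  have "independent ?G S" if "S = A \<or> S = B \<or> S = C" for S
    unfolding independent_def
  proof (intro ballI notI)
    fix x y assume xy: "x \<in> S" "y \<in> S" and "{x, y} \<in> edges ?G"
    with E obtain u v where uv: "{x, y} = {u, v}"
      "u \<in> A \<and> v \<in> B \<or> u \<in> A \<and> v \<in> C \<or> u \<in> B \<and> v \<in> C" by auto
    then have "u \<in> S" "v \<in> S" using xy by (auto simp: doubleton_eq_iff)
    with uv(2) that disj show False by blast
  qed
  moreover have "edges ?G \<subseteq> {{x, y} | x y. x \<in> verts ?G \<and> y \<in> verts ?G \<and> x \<noteq> y}"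
  proof
    fix e assume "e \<in> edges ?G"
    with E obtain u v where uv: "e = {u, v}"
      "u \<in> A \<and> v \<in> B \<or> u \<in> A \<and> v \<in> C \<or> u \<in> B \<and> v \<in> C" by auto
    then have "u \<in> verts ?G" "v \<in> verts ?G" unfolding verts_def cls by auto
    moreover have "u \<noteq> v" using uv(2) disj by blast
    ultimately show "e \<in> {{x, y} | x y. x \<in> verts ?G \<and> y \<in> verts ?G \<and> x \<noteq> y}"
      using uv(1) by blast
  qed
  ultimately show ?thesis
    using assms unfolding tripartite_def verts_def cls by simp
qed

lemma tripartite_H9: "tripartite H9"
  unfolding H9_def Let_def by (rule tripartite_complete_delete) auto

lemma triangle_density_nonneg:
  assumes "weighting G w"
  shows "triangle_density G w \<ge> 0"
  using assms unfolding triangle_density_def weighting_def triangles_def verts_def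
  by (intro sum_nonneg) auto

lemma Tri_transfer:
  fixes G :: "'v trigraph" and f :: "'v \<Rightarrow> 'u"
  assumes G: "(G, w) \<in> Tri \<alpha> \<beta> \<gamma>" and f: "inj_on f (verts G)"
  obtains G' :: "'u trigraph" and w' where
    "(G', w') \<in> Tri \<alpha> \<beta> \<gamma>" "triangle_density G' w' = triangle_density G w"
proof -
  define V where "V = verts G"
  define g where "g = inv_into V f"
  define G' where "G' = \<lparr>clsA = f ` clsA G, clsB = f ` clsB G, clsC = f ` clsC G,
    edges = (`) f ` edges G\<rparr>"
  define w' where "w' = w \<circ> g"
  have gf: "g (f x) = x" if "x \<in> V" for x
    using f that unfolding g_def V_def by simp
  have sub: "clsA G \<subseteq> V" "clsB G \<subseteq> V" "clsC G \<subseteq> V"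
    unfolding V_def verts_def by auto
  have V': "verts G' = f ` V" unfolding V_def verts_def G'_def by auto
  have inj: "inj_on f V" using f V_def by simp
  have trip: "tripartite G" and wt: "weighting G w"
    using G unfolding Tri_def by auto
  have eV: "e \<subseteq> V" if "e \<in> edges G" for e
    using trip that unfolding tripartite_def V_def by blast
  have edge: "{f x, f y} \<in> edges G' \<longleftrightarrow> {x, y} \<in> edges G" if "x \<in> V" "y \<in> V" for x y
  proof
    assume "{f x, f y} \<in> edges G'"
    then obtain e where e: "e \<in> edges G" "f ` {x, y} = f ` e"
      unfolding G'_def by auto
    then have "{x, y} = e"
      using inj_on_image_eq_iff[OF inj, of "{x, y}" e] eV that by auto
    then show "{x, y} \<in> edges G" using e by simp
  next
    assume "{x, y} \<in> edges G"
    then have "f ` {x, y} \<in> (`) f ` edges G" by (rule imageI)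
    then have "f ` {x, y} \<in> edges G'" unfolding G'_def by simp
    then show "{f x, f y} \<in> edges G'" by simp
  qed
  have disj: "f ` S \<inter> f ` T = {}" if "S \<inter> T = {}" "S \<subseteq> V" "T \<subseteq> V" for S T
    using inj_on_image_Int[OF inj that(2,3)] that by simp
  have indep: "independent G' (f ` S)" if "independent G S" "S \<subseteq> V" for S
    unfolding independent_def
  proof (intro ballI)
    fix x' y' assume "x' \<in> f ` S" "y' \<in> f ` S"
    then obtain x y where "x' = f x" "y' = f y" "x \<in> S" "y \<in> S" by blast
    then show "{x', y'} \<notin> edges G'"
      using edge[of x y] that unfolding independent_def by auto
  qed
  have edges': "edges G' \<subseteq> {{x, y} | x y. x \<in> verts G' \<and> y \<in> verts G' \<and> x \<noteq> y}"
  proof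
    fix e' assume "e' \<in> edges G'"
    then obtain e where e: "e \<in> edges G" "e' = f ` e" unfolding G'_def by auto
    then obtain x y where xy: "e = {x, y}" "x \<in> V" "y \<in> V" "x \<noteq> y"
      using trip unfolding tripartite_def V_def by blast
    then have "f x \<noteq> f y" using inj by (auto dest: inj_onD)
    then show "e' \<in> {{x, y} | x y. x \<in> verts G' \<and> y \<in> verts G' \<and> x \<noteq> y}"
      using e xy V' by auto
  qed
  have sumc: "(\<Sum>x\<in>f ` S. w' x) = (\<Sum>x\<in>S. w x)" if "S \<subseteq> V" for S
  proof -
    have "(\<Sum>x\<in>f ` S. w' x) = (\<Sum>x\<in>S. w' (f x))"
      using inj_on_subset[OF inj that] by (simp add: sum.reindex)
    also have "\<dots> = (\<Sum>x\<in>S. w x)"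
      using that gf by (intro sum.cong) (auto simp: w'_def)
    finally show ?thesis .
  qed
  have cls: "clsA G' = f ` clsA G" "clsB G' = f ` clsB G" "clsC G' = f ` clsC G"
    unfolding G'_def by auto
  have trip': "tripartite G'"
    unfolding tripartite_def cls
    by (intro conjI edges' disj indep sub)
      (use trip in \<open>simp_all add: tripartite_def V' V_def\<close>)
  have wt': "weighting G' w'"
    using wt gf unfolding weighting_def cls V' sumc[OF sub(1)] sumc[OF sub(2)] sumc[OF sub(3)]
    by (auto simp: w'_def V_def)
  have dens: "(\<Sum>(x, y) \<in> {(x, y). x \<in> f ` S \<and> y \<in> f ` T \<and> {x, y} \<in> edges G'}. w' x * w' y)
      = (\<Sum>(x, y) \<in> {(x, y). x \<in> S \<and> y \<in> T \<and> {x, y} \<in> edges G}. w x * w y)"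
    if "S \<subseteq> V" "T \<subseteq> V" for S T
    by (rule sum.reindex_bij_witness[where i = "map_prod f f" and j = "map_prod g g"])
      (use that gf edge in \<open>auto simp: w'_def subset_iff\<close>)
  have "(G', w') \<in> Tri \<alpha> \<beta> \<gamma>"
    using G trip' wt' dens sub
    unfolding Tri_def edge_density_alpha_def edge_density_beta_def edge_density_gamma_def
    by (auto simp: cls)
  moreover have "triangle_density G' w' = triangle_density G w"
    unfolding triangle_density_def triangles_def cls
    by (rule sum.reindex_bij_witness
        [where i = "map_prod f (map_prod f f)" and j = "map_prod g (map_prod g g)"])
      (use sub gf edge in \<open>auto simp: w'_def subset_iff\<close>)
  ultimately show ?thesis by (rule that)
qed

lemma T_min_le:
  fixes G :: "'v trigraph"
  assumes "(G, w) \<in> Tri \<alpha> \<beta> \<gamma>"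
  shows "T_min \<alpha> \<beta> \<gamma> \<le> triangle_density G w"
proof -
  have "finite (verts G)" using assms unfolding Tri_def tripartite_def by auto
  then obtain f :: "'v \<Rightarrow> nat" where "inj_on f (verts G)"
    using finite_imp_inj_to_nat_seg by blast
  then obtain G' :: "nat trigraph" and w' where
    *: "(G', w') \<in> Tri \<alpha> \<beta> \<gamma>" "triangle_density G' w' = triangle_density G w"
    using Tri_transfer[OF assms] by blast
  have "bdd_below ((\<lambda>(G, w). triangle_density G w) `
      (Tri \<alpha> \<beta> \<gamma> :: (nat trigraph \<times> (nat \<Rightarrow> real)) set))"
    by (rule bdd_belowI[of _ 0]) (auto simp: Tri_def intro: triangle_density_nonneg)
  from cINF_lower[OF this *(1)] *(2) show ?thesis unfolding T_min_def by simp
qed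

lemma T_min_eq_iff:
  fixes G :: "nat trigraph"
  assumes "(G, w) \<in> Tri \<alpha> \<beta> \<gamma>"
  shows "triangle_density G w = T_min \<alpha> \<beta> \<gamma> \<longleftrightarrow>
    (\<forall>(G', w') \<in> (Tri \<alpha> \<beta> \<gamma> :: (nat trigraph \<times> (nat \<Rightarrow> real)) set).
       triangle_density G w \<le> triangle_density G' w')"
proof
  assume "triangle_density G w = T_min \<alpha> \<beta> \<gamma>"
  then show "\<forall>(G', w') \<in> (Tri \<alpha> \<beta> \<gamma> :: (nat trigraph \<times> (nat \<Rightarrow> real)) set).
      triangle_density G w \<le> triangle_density G' w'"
    using T_min_le by fastforce
next
  assume "\<forall>(G', w') \<in> (Tri \<alpha> \<beta> \<gamma> :: (nat trigraph \<times> (nat \<Rightarrow> real)) set).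
      triangle_density G w \<le> triangle_density G' w'"
  then have "triangle_density G w \<le> T_min \<alpha> \<beta> \<gamma>"
    unfolding T_min_def using assms by (intro cINF_greatest) auto
  then show "triangle_density G w = T_min \<alpha> \<beta> \<gamma>"
    using T_min_le[OF assms] by simp
qed

end

theory Submission
  imports Defs "HOL-Analysis.Analysis"
begin

text \<open>
  For fixed densities every class can be cut down to three vertices, because the triangle density
  is linear in the weights of one class and only three linear constraints involve them. Write
  \<open>\<xi> a\<close> for the weight of the vertices of \<open>C\<close> not adjacent to \<open>a\<close> and \<open>y b\<close> for the weight of those
  adjacent to \<open>b\<close>. The common neighbourhood of \<open>a\<close> and \<open>b\<close> in \<open>C\<close> weighs at least \<open>max 0 (y b - \<xi> a)\<close>,
  with equality if the neighbourhoods of \<open>A\<close> are final and those of \<open>B\<close> initial segments of \<open>C\<close>.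
  Choosing the edges between \<open>A\<close> and \<open>B\<close> greedily by this weight, all three bipartite graphs become
  staircases with at most three steps.

  If two rows or columns of a staircase agree, two vertices merge into one with fractional
  adjacencies, and some class has only two vertices. Then an elementary estimate gives the lower
  bound \<open>h7_min \<alpha> \<beta> \<gamma>\<close>, and the larger of this and \<open>\<alpha> + \<beta> + \<gamma> - 2\<close> is attained by \<open>H9\<close>. If all
  rows and columns differ, the graph is \<open>H9\<close> or has no triangles; the latter is impossible on \<open>R\<close>.
  Finally, the weightings of \<open>H9\<close> with given densities form a compact set.
\<close>

section \<open>Reducing the support of a weighting\<close>

text \<open>No formula for the minimum over weightings of \<open>H9\<close> is found or used. A
  staircase configuration either is a weighting of \<open>H9\<close> or is beaten by one, so it
  suffices to compare, and compactness supplies the minimiser. The constants come from the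
  two-by-two situation: with two vertices left in B and in C the density is a sum
  \<open>\<beta> * B + \<gamma> * C - 2 * (1 - \<alpha>)\<close> with
  \<open>B * C = 1 - \<alpha>\<close>, and the inequality of arithmetic and geometric means gives
  \<open>h7_value\<close>. Equality there can force a negative weight on \<open>a3\<close>; that
  weight is nonnegative exactly while the density is at least
  \<open>\<alpha> + \<beta> + \<gamma> - 2\<close>, which bounds every triangle density from below
  by counting missing edges. Hence the maximum of the two bounds is the attainable one. The obstacle
  in the reduction is that changing one class disturbs the two bipartite graphs at it. While A and B
  are rearranged, C is therefore represented only by the numbers \<open>\<xi>\<close> and
  \<open>y\<close>, and it is rebuilt at the end as an interval. Merging twins in C makes
  adjacencies fractional, so the estimates for two vertices allow any value between 0 and 1.\<close>

lemma move_until_weight_vanishes: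
  fixes p \<delta> :: "'a \<Rightarrow> real" and c :: real
  assumes "finite S" "\<forall>s\<in>S. 0 \<le> p s" "(\<Sum>s\<in>S. \<delta> s) = 0" "\<exists>s\<in>S. \<delta> s \<noteq> 0"
  shows "\<exists>\<theta>. (\<forall>s\<in>S. 0 \<le> p s + \<theta> * \<delta> s) \<and> (\<exists>s\<in>S. p s + \<theta> * \<delta> s = 0) \<and> \<theta> * c \<le> 0"
proof -
  \<comment> \<open>The sign chooses the direction along \<open>\<delta>\<close> in which the
    objective with slope \<open>c\<close> does not grow. \<open>N\<close> collects the weights that
    shrink; it is nonempty because \<open>\<delta>\<close> sums to 0, and the smallest ratio
    \<open>q\<close> tells which of them vanishes first.\<close>
  define \<sigma> :: real where "\<sigma> = (if c \<le> 0 then 1 else -1)"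
  define N where "N = {s\<in>S. \<sigma> * \<delta> s < 0}"
  have "N \<noteq> {}"
  proof
    assume "N = {}"
    then have "\<And>s. s \<in> S \<Longrightarrow> 0 \<le> \<sigma> * \<delta> s" unfolding N_def by force
    moreover have "(\<Sum>s\<in>S. \<sigma> * \<delta> s) = 0" using assms(3) by (simp flip: sum_distrib_left)
    ultimately have "\<forall>s\<in>S. \<sigma> * \<delta> s = 0" using sum_nonneg_eq_0_iff[OF assms(1), of "\<lambda>s. \<sigma> * \<delta> s"] by blast
    then show False using assms(4) by (auto simp: \<sigma>_def split: if_splits)
  qed
  have finN: "finite N" using assms(1) unfolding N_def by simp
  define q where "q s = p s / (- (\<sigma> * \<delta> s))" for s
  define \<theta>0 where "\<theta>0 = Min (q ` N)"
  have qN: "q s \<ge> 0" if "s \<in> N" for s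
    using that assms(2) unfolding q_def N_def by (auto intro!: divide_nonneg_nonneg simp: divide_nonneg_neg)
  have \<theta>0: "\<theta>0 \<ge> 0" "\<theta>0 \<in> q ` N"
    using \<open>N \<noteq> {}\<close> finN qN unfolding \<theta>0_def by (auto intro: Min_in)
  have "0 \<le> p s + (\<sigma> * \<theta>0) * \<delta> s" if "s \<in> S" for s
  proof (cases "s \<in> N")
    case True
    then have "\<theta>0 \<le> q s" using finN unfolding \<theta>0_def by simp
    moreover have "- (\<sigma> * \<delta> s) > 0" using True unfolding N_def by simp
    ultimately have "\<theta>0 * (- (\<sigma> * \<delta> s)) \<le> p s" unfolding q_def by (simp only: pos_le_divide_eq)
    then show ?thesis by (simp add: algebra_simps)
  next
    case False
    then have "0 \<le> \<sigma> * \<delta> s" using that unfolding N_def by simp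
    then have "0 \<le> \<theta>0 * (\<sigma> * \<delta> s)" using \<theta>0(1) by (rule mult_nonneg_nonneg[rotated])
    then show ?thesis using assms(2) that by (simp add: algebra_simps)
  qed
  moreover obtain s where s: "s \<in> N" "\<theta>0 = q s" using \<theta>0 by auto
  then have "p s + (\<sigma> * \<theta>0) * \<delta> s = 0" unfolding q_def N_def by (auto simp: field_simps)
  moreover have "(\<sigma> * \<theta>0) * c \<le> 0" using \<theta>0 unfolding \<sigma>_def by (auto simp: mult_nonneg_nonpos mult_nonneg_nonneg)
  ultimately show ?thesis using s unfolding N_def by blast
qed

text \<open>More than three vectors \<open>(1, \<phi> s, \<psi> s)\<close> in three-dimensional
  space are linearly dependent. Since \<open>dependent\<close> speaks of a set of vectors, two
  indices with the same vector are treated apart.\<close>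

lemma affine_dependence_4:
  fixes \<phi> \<psi> :: "'a \<Rightarrow> real"
  assumes "finite S" "card S > 3"
  shows "\<exists>\<delta>. (\<exists>s\<in>S. \<delta> s \<noteq> 0) \<and> (\<Sum>s\<in>S. \<delta> s) = 0 \<and> (\<Sum>s\<in>S. \<delta> s * \<phi> s) = 0 \<and> (\<Sum>s\<in>S. \<delta> s * \<psi> s) = 0"
proof -
  define vec :: "'a \<Rightarrow> real \<times> real \<times> real" where "vec s = (1, \<phi> s, \<psi> s)" for s
  show ?thesis
  proof (cases "inj_on vec S")
    case True
    then have "card (vec ` S) > DIM(real \<times> real \<times> real)" using assms by (simp add: card_image)
    then have "dependent (vec ` S)" using dependent_biggerset[of "vec ` S"] assms(1) by auto
    then obtain u where u: "\<exists>v\<in>vec ` S. u v \<noteq> 0" "(\<Sum>v\<in>vec ` S. u v *\<^sub>R v) = 0"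
      using dependent_finite[of "vec ` S"] assms(1) by auto
    have "(\<Sum>s\<in>S. u (vec s) *\<^sub>R vec s) = 0" using u(2) True by (simp add: sum.reindex)
    then have "(\<Sum>s\<in>S. u (vec s)) = 0 \<and> (\<Sum>s\<in>S. u (vec s) * \<phi> s) = 0 \<and> (\<Sum>s\<in>S. u (vec s) * \<psi> s) = 0"
      by (simp add: vec_def prod_eq_iff fst_sum snd_sum)
    then show ?thesis using u(1) by (intro exI[of _ "u \<circ> vec"]) auto
  next
    case False
    then obtain s s' where s: "s \<in> S" "s' \<in> S" "s \<noteq> s'" "vec s = vec s'" unfolding inj_on_def by auto
    define \<delta> :: "'a \<Rightarrow> real" where "\<delta> x = (if x = s then 1 else 0) - (if x = s' then 1 else 0)" for x
    have "(\<Sum>x\<in>S. \<delta> x * \<zeta> x) = \<zeta> s - \<zeta> s'" for \<zeta> :: "'a \<Rightarrow> real"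
      using s assms(1) by (simp add: \<delta>_def left_diff_distrib sum_subtractf if_distrib[of "\<lambda>x. x * _"] cong: if_cong)
    from this[of "\<lambda>_. 1"] this[of \<phi>] this[of \<psi>] s
    have "(\<Sum>x\<in>S. \<delta> x) = 0" "(\<Sum>x\<in>S. \<delta> x * \<phi> x) = 0" "(\<Sum>x\<in>S. \<delta> x * \<psi> x) = 0"
      by (auto simp: vec_def)
    moreover have "\<delta> s \<noteq> 0" using s by (simp add: \<delta>_def)
    ultimately show ?thesis using s(1) by blast
  qed
qed

text \<open>This is the existence of a basic optimal solution in linear programming: with three
  equality constraints, any support of four or more points admits a direction that keeps the
  constraints and can be followed, without raising \<open>\<tau>\<close>, until a point drops
  out.\<close>

lemma reduce_support:
  fixes p \<phi> \<psi> \<tau> :: "'a \<Rightarrow> real"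
  assumes "finite S" "\<forall>s\<in>S. 0 \<le> p s"
  shows "\<exists>T q. T \<subseteq> S \<and> card T \<le> 3 \<and> (\<forall>s\<in>T. 0 \<le> q s) \<and> (\<Sum>s\<in>T. q s) = (\<Sum>s\<in>S. p s) \<and>
    (\<Sum>s\<in>T. q s * \<phi> s) = (\<Sum>s\<in>S. p s * \<phi> s) \<and> (\<Sum>s\<in>T. q s * \<psi> s) = (\<Sum>s\<in>S. p s * \<psi> s) \<and>
    (\<Sum>s\<in>T. q s * \<tau> s) \<le> (\<Sum>s\<in>S. p s * \<tau> s)"
  using assms
proof (induction "card S" arbitrary: S p rule: less_induct)
  case less
  show ?case
  proof (cases "card S \<le> 3")
    case True
    then show ?thesis using less.prems by (intro exI[of _ S] exI[of _ p]) auto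
  next
    case False
    then obtain \<delta> where \<delta>: "\<exists>s\<in>S. \<delta> s \<noteq> 0" "(\<Sum>s\<in>S. \<delta> s) = 0" "(\<Sum>s\<in>S. \<delta> s * \<phi> s) = 0" "(\<Sum>s\<in>S. \<delta> s * \<psi> s) = 0"
      using affine_dependence_4[of S \<phi> \<psi>] less.prems(1) by auto
    obtain \<theta> s0 where \<theta>: "\<forall>s\<in>S. 0 \<le> p s + \<theta> * \<delta> s" and s0: "s0 \<in> S" "p s0 + \<theta> * \<delta> s0 = 0"
      and le: "\<theta> * (\<Sum>s\<in>S. \<delta> s * \<tau> s) \<le> 0"
      using move_until_weight_vanishes[OF less.prems \<delta>(2,1), where c = "\<Sum>s\<in>S. \<delta> s * \<tau> s"]
      by (elim exE conjE bexE) (rule that)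
    define p' where "p' s = p s + \<theta> * \<delta> s" for s
    have sum': "(\<Sum>s\<in>S - {s0}. p' s * \<zeta> s) = (\<Sum>s\<in>S. p s * \<zeta> s) + \<theta> * (\<Sum>s\<in>S. \<delta> s * \<zeta> s)" for \<zeta> :: "'a \<Rightarrow> real"
    proof -
      have "(\<Sum>s\<in>S. p' s * \<zeta> s) = p' s0 * \<zeta> s0 + (\<Sum>s\<in>S - {s0}. p' s * \<zeta> s)"
        using less.prems(1) s0(1) by (rule sum.remove)
      moreover have "(\<Sum>s\<in>S. p' s * \<zeta> s) = (\<Sum>s\<in>S. p s * \<zeta> s) + \<theta> * (\<Sum>s\<in>S. \<delta> s * \<zeta> s)"
        by (simp add: p'_def distrib_right sum.distrib sum_distrib_left mult.assoc)
      ultimately show ?thesis using s0(2) by (simp add: p'_def)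
    qed
    have "card (S - {s0}) < card S" using less.prems(1) s0(1) by (meson card_Diff1_less)
    have p'0: "\<forall>s\<in>S - {s0}. 0 \<le> p' s" using \<theta> by (simp add: p'_def)
    obtain T q where
      T: "T \<subseteq> S - {s0}" "card T \<le> 3" "\<forall>s\<in>T. 0 \<le> q s" "(\<Sum>s\<in>T. q s) = (\<Sum>s\<in>S - {s0}. p' s)"
        "(\<Sum>s\<in>T. q s * \<phi> s) = (\<Sum>s\<in>S - {s0}. p' s * \<phi> s)"
        "(\<Sum>s\<in>T. q s * \<psi> s) = (\<Sum>s\<in>S - {s0}. p' s * \<psi> s)"
        "(\<Sum>s\<in>T. q s * \<tau> s) \<le> (\<Sum>s\<in>S - {s0}. p' s * \<tau> s)"
      using less.hyps[OF \<open>card (S - {s0}) < card S\<close> finite_Diff[OF less.prems(1)] p'0]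
      by (elim exE conjE) (rule that)
    then show ?thesis
      using sum'[of "\<lambda>_. 1"] sum'[of \<phi>] sum'[of \<psi>] sum'[of \<tau>] \<delta> le
      by (intro exI[of _ T] exI[of _ q]) auto
  qed
qed

text \<open>In the applications \<open>\<phi>\<close> and \<open>\<psi>\<close> encode the two edge
  densities at the class being reduced and \<open>\<tau>\<close> its contribution to the triangle
  density; \<open>key\<close> fixes the order that later yields staircases.\<close>

lemma caratheodory_3:
  fixes p \<phi> \<psi> \<tau> key :: "'a \<Rightarrow> real"
  assumes "finite S" "\<forall>s\<in>S. 0 \<le> p s" "(\<Sum>s\<in>S. p s) = 1"
  obtains s :: "nat \<Rightarrow> 'a" and q :: "nat \<Rightarrow> real" where
    "\<And>i. s i \<in> S" "\<And>i j. i \<le> j \<Longrightarrow> key (s i) \<le> key (s j)" "\<And>i. 0 \<le> q i" "(\<Sum>i<3. q i) = 1"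
    "(\<Sum>i<3. q i * \<phi> (s i)) = (\<Sum>x\<in>S. p x * \<phi> x)" "(\<Sum>i<3. q i * \<psi> (s i)) = (\<Sum>x\<in>S. p x * \<psi> x)"
    "(\<Sum>i<3. q i * \<tau> (s i)) \<le> (\<Sum>x\<in>S. p x * \<tau> x)"
proof -
  obtain T r where T: "T \<subseteq> S" "card T \<le> 3" "\<forall>s\<in>T. 0 \<le> r s" "(\<Sum>s\<in>T. r s) = (\<Sum>s\<in>S. p s)"
    "(\<Sum>s\<in>T. r s * \<phi> s) = (\<Sum>s\<in>S. p s * \<phi> s)" "(\<Sum>s\<in>T. r s * \<psi> s) = (\<Sum>s\<in>S. p s * \<psi> s)"
    "(\<Sum>s\<in>T. r s * \<tau> s) \<le> (\<Sum>s\<in>S. p s * \<tau> s)"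
    using reduce_support[OF assms(1,2), where \<phi> = \<phi> and \<psi> = \<psi> and \<tau> = \<tau>] by (elim exE conjE) (rule that)
  have finT: "finite T" using T(1) assms(1) finite_subset by blast
  obtain ys where ys: "set ys = T" "distinct ys" using finite_distinct_list[OF finT] by blast
  define xs where "xs = sort_key key ys"
  have xs: "set xs = T" "distinct xs" "sorted (map key xs)" unfolding xs_def using ys by auto
  have len: "length xs = card T" using xs distinct_card by fastforce
  have "T \<noteq> {}" using T(4) assms(3) by auto
  then have pos: "length xs > 0" using xs(1) by auto
  \<comment> \<open>If fewer than three points survive, the last one is repeated with weight 0. Thus
    \<open>s\<close> is defined and monotone on all of \<open>nat\<close>.\<close>
  define s where "s i = xs ! min i (length xs - 1)" for i
  define q where "q i = (if i < length xs then r (xs ! i) else 0)" for i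
  have sT: "s i \<in> T" for i unfolding s_def xs(1)[symmetric] using pos by (intro nth_mem) linarith
  have sum: "(\<Sum>i<3. q i * \<zeta> (s i)) = (\<Sum>x\<in>T. r x * \<zeta> x)" for \<zeta> :: "'a \<Rightarrow> real"
  proof -
    have "(\<Sum>i<3. q i * \<zeta> (s i)) = (\<Sum>i<length xs. q i * \<zeta> (s i))"
      using len T(2) by (intro sum.mono_neutral_right) (auto simp: q_def)
    also have "\<dots> = (\<Sum>i<length xs. r (xs ! i) * \<zeta> (xs ! i))"
      by (intro sum.cong) (auto simp: q_def s_def min_def)
    also have "\<dots> = (\<Sum>x\<in>T. r x * \<zeta> x)"
      by (rule sum.reindex_bij_betw[OF bij_betw_nth]) (use xs in auto)
    finally show ?thesis .
  qed
  show thesis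
  proof (rule that[of s q])
    show "s i \<in> S" for i using sT T(1) by blast
    show "key (s i) \<le> key (s j)" if "i \<le> j" for i j
    proof -
      have b: "min i (length xs - 1) < length xs" "min j (length xs - 1) < length xs" using pos by linarith+
      have "map key xs ! min i (length xs - 1) \<le> map key xs ! min j (length xs - 1)"
        using b that by (intro sorted_nth_mono[OF xs(3)]) auto
      then show ?thesis using b by (simp add: s_def)
    qed
    show "0 \<le> q i" for i using T(3) xs(1) by (auto simp: q_def)
    show "(\<Sum>i<3. q i) = 1" using sum[of "\<lambda>_. 1"] T(4) assms(3) by simp
  qed (use sum[of \<phi>] sum[of \<psi>] sum[of \<tau>] T in simp_all)
qed

section \<open>Greedy distribution of edges\<close>

text \<open>A fractional knapsack: \<open>m e\<close> is the capacity of a cell, \<open>P e\<close>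
  its price, \<open>f e\<close> the filled fraction. Filling the cheapest cells first does not raise
  the cost and leaves at most one cell partly filled. Prices are monotone in both coordinates, so
  the filled region is a staircase. The induction removes a most expensive cell.\<close>

lemma threshold_fill:
  fixes m P f :: "nat \<times> nat \<Rightarrow> real"
  assumes "finite E" "\<And>e. e \<in> E \<Longrightarrow> 0 \<le> m e" "\<And>e. e \<in> E \<Longrightarrow> 0 \<le> f e \<and> f e \<le> 1"
    and "\<And>i j i' j'. (i, j) \<in> E \<Longrightarrow> (i', j') \<in> E \<Longrightarrow> i \<le> i' \<Longrightarrow> j' \<le> j \<Longrightarrow> P (i', j') \<le> P (i, j)"
  shows "\<exists>f'. (\<forall>e\<in>E. 0 \<le> f' e \<and> f' e \<le> 1) \<and> (\<Sum>e\<in>E. m e * f' e) = (\<Sum>e\<in>E. m e * f e) \<and>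
    (\<Sum>e\<in>E. m e * f' e * P e) \<le> (\<Sum>e\<in>E. m e * f e * P e) \<and>
    (\<forall>i j i' j'. (i, j) \<in> E \<longrightarrow> (i', j') \<in> E \<longrightarrow> i \<le> i' \<longrightarrow> j' \<le> j \<longrightarrow> f' (i, j) \<le> f' (i', j')) \<and>
    (\<exists>e0. \<forall>e\<in>E. e \<noteq> e0 \<longrightarrow> f' e = 0 \<or> f' e = 1)"
  using assms
proof (induction "card E" arbitrary: E f)
  case 0
  then show ?case by auto
next
  case (Suc n)
  define M where "M = {e\<in>E. P e = Max (P ` E)}"
  have "E \<noteq> {}" using Suc.hyps(2) by auto
  then have "Max (P ` E) \<in> P ` E" using Suc.prems(1) by simp
  then obtain e1 where "e1 \<in> E" "Max (P ` E) = P e1" by blast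
  then have "e1 \<in> M" unfolding M_def by simp
  then have "M \<noteq> {}" by blast
  have finM: "finite M" using Suc.prems(1) unfolding M_def by simp
  \<comment> \<open>Ties among the most expensive cells are broken by the largest column minus row.
    Then no other cell lies weakly above and to the right of \<open>e\<close>
    (\<open>extreme\<close>), so giving \<open>e\<close> the lowest filling cannot violate
    monotonicity.\<close>
  define d :: "nat \<times> nat \<Rightarrow> real" where "d e = real (snd e) - real (fst e)" for e
  obtain e where e: "e \<in> M" "\<And>e'. e' \<in> M \<Longrightarrow> d e' \<le> d e"
  proof -
    have "Max (d ` M) \<in> d ` M" using finM \<open>M \<noteq> {}\<close> by simp
    then obtain e where "e \<in> M" "Max (d ` M) = d e" by auto
    moreover have "d e' \<le> Max (d ` M)" if "e' \<in> M" for e' using that finM by simp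
    ultimately show thesis using that[of e] by simp
  qed
  have eE: "e \<in> E" and Pmax: "\<And>e'. e' \<in> E \<Longrightarrow> P e' \<le> P e"
    using e(1) Suc.prems(1) unfolding M_def by auto
  define E' where "E' = E - {e}"
  have fin': "finite E'" and card': "n = card E'" and eE': "e \<notin> E'" and EE': "E = insert e E'"
    using Suc.prems(1) Suc.hyps(2) eE unfolding E'_def by auto
  have split: "(\<Sum>x\<in>E. \<zeta> x) = \<zeta> e + (\<Sum>x\<in>E'. \<zeta> x)" for \<zeta> :: "nat \<times> nat \<Rightarrow> real"
    unfolding EE' using fin' eE' by simp
  have extreme: "(i, j) = e" if "(i, j) \<in> E" "i \<le> fst e" "snd e \<le> j" for i j
  proof -
    have "P e \<le> P (i, j)" using Suc.prems(4)[of i j "fst e" "snd e"] that eE by simp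
    then have "(i, j) \<in> M" using that Pmax[of "(i, j)"] e(1) unfolding M_def by auto
    from e(2)[OF this] that show ?thesis unfolding d_def by (cases e) auto
  qed
  define room where "room = (\<Sum>x\<in>E'. m x * (1 - f x))"
  have m': "0 \<le> m x" "0 \<le> f x" "f x \<le> 1" if "x \<in> E'" for x using that Suc.prems(2,3) unfolding E'_def by auto
  have room0: "room \<ge> 0" unfolding room_def using m' by (intro sum_nonneg mult_nonneg_nonneg) auto
  have roomP: "(\<Sum>x\<in>E'. m x * (1 - f x) * P x) \<le> room * P e"
    unfolding room_def sum_distrib_right using m' Pmax EE'
    by (intro sum_mono mult_left_mono mult_nonneg_nonneg) auto
  have me: "0 \<le> m e" "0 \<le> f e" "f e \<le> 1" using Suc.prems(2,3) eE by auto
  show ?case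
  proof (cases "m e * f e \<le> room")
    case True
    \<comment> \<open>The content of \<open>e\<close> is spread over the other cells in proportion
      to their free room, which makes \<open>e\<close> empty. If there is no room, then
      \<open>e\<close> holds nothing and division by zero gives the right value 0.\<close>
    define \<theta> where "\<theta> = m e * f e / room"
    have \<theta>: "0 \<le> \<theta>" "\<theta> \<le> 1" "\<theta> * room = m e * f e"
    proof -
      have mf: "0 \<le> m e * f e" using me by simp
      then show "0 \<le> \<theta>" using room0 by (simp add: \<theta>_def)
      show "\<theta> \<le> 1" using True room0 by (auto simp: \<theta>_def divide_le_eq_1)
      show "\<theta> * room = m e * f e" using True mf by (cases "room = 0") (auto simp: \<theta>_def)
    qed
    define f1 where "f1 x = f x + \<theta> * (1 - f x)" for x
    have "0 \<le> f1 x \<and> f1 x \<le> 1" if "x \<in> E'" for x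
    proof -
      have "\<theta> * (1 - f x) \<le> 1 * (1 - f x)" using m'[OF that] \<theta> by (intro mult_right_mono) auto
      moreover have "0 \<le> \<theta> * (1 - f x)" using m'[OF that] \<theta> by (intro mult_nonneg_nonneg) auto
      ultimately show ?thesis using m'[OF that] by (simp add: f1_def)
    qed
    note f1 = this
    have P': "P (i', j') \<le> P (i, j)" if "(i, j) \<in> E'" "(i', j') \<in> E'" "i \<le> i'" "j' \<le> j" for i j i' j'
      using Suc.prems(4)[of i j i' j'] that EE' by simp
    obtain f2 where f2: "\<forall>e\<in>E'. 0 \<le> f2 e \<and> f2 e \<le> 1"
      "(\<Sum>e\<in>E'. m e * f2 e) = (\<Sum>e\<in>E'. m e * f1 e)" "(\<Sum>e\<in>E'. m e * f2 e * P e) \<le> (\<Sum>e\<in>E'. m e * f1 e * P e)"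
      "\<forall>i j i' j'. (i, j) \<in> E' \<longrightarrow> (i', j') \<in> E' \<longrightarrow> i \<le> i' \<longrightarrow> j' \<le> j \<longrightarrow> f2 (i, j) \<le> f2 (i', j')"
      "\<exists>e0. \<forall>e\<in>E'. e \<noteq> e0 \<longrightarrow> f2 e = 0 \<or> f2 e = 1"
      proof -
      have "\<exists>f'. (\<forall>e\<in>E'. 0 \<le> f' e \<and> f' e \<le> 1) \<and> (\<Sum>e\<in>E'. m e * f' e) = (\<Sum>e\<in>E'. m e * f1 e) \<and>
        (\<Sum>e\<in>E'. m e * f' e * P e) \<le> (\<Sum>e\<in>E'. m e * f1 e * P e) \<and>
        (\<forall>i j i' j'. (i, j) \<in> E' \<longrightarrow> (i', j') \<in> E' \<longrightarrow> i \<le> i' \<longrightarrow> j' \<le> j \<longrightarrow> f' (i, j) \<le> f' (i', j')) \<and>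
        (\<exists>e0. \<forall>e\<in>E'. e \<noteq> e0 \<longrightarrow> f' e = 0 \<or> f' e = 1)"
        using m'(1) f1 P' by (intro Suc.hyps(1) card' fin') blast+
      then show thesis by (elim exE conjE[of _ "_ \<and> _"] conjE) (rule that, assumption+, rule exI, assumption)
    qed
    define f3 where "f3 = f2(e := 0)"
    have f3E': "f3 x = f2 x" if "x \<in> E'" for x using that eE' by (auto simp: f3_def)
    have "(\<Sum>x\<in>E'. m x * f1 x * \<zeta> x) = (\<Sum>x\<in>E'. m x * f x * \<zeta> x) + \<theta> * (\<Sum>x\<in>E'. m x * (1 - f x) * \<zeta> x)" for \<zeta> :: "nat \<times> nat \<Rightarrow> real"
      unfolding f1_def sum_distrib_left sum.distrib[symmetric] by (intro sum.cong) (auto simp: algebra_simps)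
    note f1_sum = this
    have "\<theta> * (room * P e) = m e * f e * P e" using \<theta>(3) by (simp flip: mult.assoc)
    then have s2: "(\<Sum>x\<in>E'. m x * f1 x * P x) \<le> (\<Sum>x\<in>E'. m x * f x * P x) + m e * f e * P e"
      using f1_sum[of P] mult_left_mono[OF roomP \<theta>(1)] by linarith
    have s1: "(\<Sum>x\<in>E'. m x * f1 x) = (\<Sum>x\<in>E'. m x * f x) + m e * f e"
      using f1_sum[of "\<lambda>_. 1"] \<theta>(3) by (simp add: room_def)
    have t1: "(\<Sum>x\<in>E'. m x * f3 x) = (\<Sum>x\<in>E'. m x * f2 x)" "(\<Sum>x\<in>E'. m x * f3 x * P x) = (\<Sum>x\<in>E'. m x * f2 x * P x)"
      using f3E' by auto
    show ?thesis
    proof (intro exI[of _ f3] conjI)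
      show "\<forall>x\<in>E. 0 \<le> f3 x \<and> f3 x \<le> 1" using f2(1) f3E' EE' by (auto simp: f3_def)
      show "(\<Sum>x\<in>E. m x * f3 x) = (\<Sum>x\<in>E. m x * f x)" using s1 f2(2) t1 unfolding split by (simp add: f3_def)
      show "(\<Sum>x\<in>E. m x * f3 x * P x) \<le> (\<Sum>x\<in>E. m x * f x * P x)" using s2 f2(3) t1 unfolding split by (simp add: f3_def)
      show "\<forall>i j i' j'. (i, j) \<in> E \<longrightarrow> (i', j') \<in> E \<longrightarrow> i \<le> i' \<longrightarrow> j' \<le> j \<longrightarrow> f3 (i, j) \<le> f3 (i', j')"
      proof (intro allI impI)
        fix i j i' j' assume a: "(i, j) \<in> E" "(i', j') \<in> E" "i \<le> i'" "j' \<le> j"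
        show "f3 (i, j) \<le> f3 (i', j')"
        proof (cases "(i, j) = e")
          case True
          then show ?thesis using f2(1) f3E' EE' a(2) by (auto simp: f3_def)
        next
          case False
          then have "(i', j') \<noteq> e" using extreme[of i j] a by auto
          with False a have "(i, j) \<in> E'" "(i', j') \<in> E'" using EE' by auto
          then show ?thesis using f2(4) a f3E' by auto
        qed
      qed
      show "\<exists>e0. \<forall>x\<in>E. x \<noteq> e0 \<longrightarrow> f3 x = 0 \<or> f3 x = 1" using f2(5) EE' by (auto simp: f3_def)
    qed
  next
    case False
    then have "m e \<noteq> 0" using room0 by auto
    then have mpos: "m e > 0" using me by simp
    \<comment> \<open>All other cells become full, and \<open>e\<close> keeps what does not fit: it
      is the only cell that may stay fractional.\<close>
    define f3 where "f3 = (\<lambda>_. 1)(e := (m e * f e - room) / m e)"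
    have f3e: "m e * f3 e = m e * f e - room" using mpos by (simp add: f3_def)
    have f31: "f3 x = 1" if "x \<in> E'" for x using that eE' by (auto simp: f3_def)
    have e01: "0 \<le> f3 e" "f3 e \<le> 1"
    proof -
      show "0 \<le> f3 e" using mpos False by (simp add: f3_def)
      have "m e * f e \<le> m e * 1" using me by (intro mult_left_mono) auto
      then have "m e * f3 e \<le> m e * 1" using f3e room0 by linarith
      then show "f3 e \<le> 1" using mpos by (simp only: mult_le_cancel_left_pos)
    qed
    have "(\<Sum>x\<in>E'. m x * f3 x * \<zeta> x) = (\<Sum>x\<in>E'. m x * f x * \<zeta> x) + (\<Sum>x\<in>E'. m x * (1 - f x) * \<zeta> x)" for \<zeta> :: "nat \<times> nat \<Rightarrow> real"
      unfolding sum.distrib[symmetric] by (intro sum.cong) (auto simp: algebra_simps f31)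
    from this[of P] this[of "\<lambda>_. 1"]
    have s1: "(\<Sum>x\<in>E'. m x * f3 x) = (\<Sum>x\<in>E'. m x * f x) + room"
      and s2: "(\<Sum>x\<in>E'. m x * f3 x * P x) \<le> (\<Sum>x\<in>E'. m x * f x * P x) + room * P e"
      using roomP by (auto simp: room_def)
    show ?thesis
    proof (intro exI[of _ f3] conjI)
      show "\<forall>x\<in>E. 0 \<le> f3 x \<and> f3 x \<le> 1" using e01 f31 EE' by auto
      show "(\<Sum>x\<in>E. m x * f3 x) = (\<Sum>x\<in>E. m x * f x)" using s1 f3e unfolding split by simp
      have "m e * f3 e * P e = m e * f e * P e - room * P e" using f3e by (simp add: left_diff_distrib)
      then show "(\<Sum>x\<in>E. m x * f3 x * P x) \<le> (\<Sum>x\<in>E. m x * f x * P x)" using s2 unfolding split by simp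
      show "\<forall>i j i' j'. (i, j) \<in> E \<longrightarrow> (i', j') \<in> E \<longrightarrow> i \<le> i' \<longrightarrow> j' \<le> j \<longrightarrow> f3 (i, j) \<le> f3 (i', j')"
      proof (intro allI impI)
        fix i j i' j' assume a: "(i, j) \<in> E" "(i', j') \<in> E" "i \<le> i'" "j' \<le> j"
        show "f3 (i, j) \<le> f3 (i', j')"
        proof (cases "(i', j') = e")
          case True
          then show ?thesis using extreme[of i j] a by auto
        next
          case False
          then have "f3 (i', j') = 1" using f31 a EE' by auto
          then show ?thesis using e01 f31 EE' a(1) by auto
        qed
      qed
      show "\<exists>e0. \<forall>x\<in>E. x \<noteq> e0 \<longrightarrow> f3 x = 0 \<or> f3 x = 1" using f31 EE' by auto
    qed
  qed
qed

section \<open>Intervals cut at finitely many points\<close>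

text \<open>A point \<open>c\<close> of \<open>Q\<close> stands for the half-open interval from its
  predecessor in \<open>Q\<close> up to \<open>c\<close>, weighted by its length. Only points
  \<open>c > 0\<close> are used; as \<open>0 \<in> Q\<close>, they have a predecessor.\<close>

definition breakpoint_weight :: "real set \<Rightarrow> real \<Rightarrow> real" where
  "breakpoint_weight Q c = c - Max {q\<in>Q. q < c}"

text \<open>The gaps telescope; the induction passes from \<open>x\<close> to its predecessor in
  \<open>Q\<close>.\<close>

lemma sum_breakpoint_weight:
  assumes "finite Q" "0 \<in> Q" "\<And>q. q \<in> Q \<Longrightarrow> 0 \<le> q" "x \<in> Q"
  shows "(\<Sum>c\<in>{c\<in>Q. 0 < c \<and> c \<le> x}. breakpoint_weight Q c) = x"
  using assms(4)
proof (induction "card {q\<in>Q. q < x}" arbitrary: x rule: less_induct)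
  case less
  show ?case
  proof (cases "x = 0")
    case True
    then have empty: "{c\<in>Q. 0 < c \<and> c \<le> x} = {}" by auto
    show ?thesis unfolding empty using True by simp
  next
    case False
    then have "x > 0" using assms(3)[OF less.prems] by simp
    define L where "L = {q\<in>Q. q < x}"
    have L: "finite L" "L \<noteq> {}" using assms(1,2) \<open>x > 0\<close> unfolding L_def by auto
    define y where "y = Max L"
    have y: "y \<in> L" "\<And>q. q \<in> L \<Longrightarrow> q \<le> y" using L unfolding y_def by auto
    have eq: "{c\<in>Q. 0 < c \<and> c \<le> x} = insert x {c\<in>Q. 0 < c \<and> c \<le> y}"
    proof (intro equalityI subsetI)
      fix c assume c: "c \<in> {c\<in>Q. 0 < c \<and> c \<le> x}"
      show "c \<in> insert x {c\<in>Q. 0 < c \<and> c \<le> y}"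
      proof (cases "c = x")
        case False
        then have "c \<in> L" using c unfolding L_def by simp
        then show ?thesis using y(2) c by simp
      qed simp
    next
      fix c assume "c \<in> insert x {c\<in>Q. 0 < c \<and> c \<le> y}"
      moreover have "y < x" using y(1) unfolding L_def by simp
      ultimately show "c \<in> {c\<in>Q. 0 < c \<and> c \<le> x}" using less.prems \<open>x > 0\<close> by auto
    qed
    have "{q\<in>Q. q < y} \<subset> L" using y(1) unfolding L_def by auto
    then have "card {q\<in>Q. q < y} < card {q\<in>Q. q < x}" using L(1) unfolding L_def by (simp add: psubset_card_mono)
    from less.hyps[OF this] have IH: "(\<Sum>c\<in>{c\<in>Q. 0 < c \<and> c \<le> y}. breakpoint_weight Q c) = y"
      using y(1) unfolding L_def by auto
    have "x \<notin> {c\<in>Q. 0 < c \<and> c \<le> y}" using y(1) unfolding L_def by auto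
    then have "(\<Sum>c\<in>{c\<in>Q. 0 < c \<and> c \<le> x}. breakpoint_weight Q c) = breakpoint_weight Q x + y"
      unfolding eq using assms(1) IH by simp
    then show ?thesis unfolding breakpoint_weight_def y_def L_def by simp
  qed
qed

lemma breakpoint_weight_nonneg:
  assumes "finite Q" "0 \<in> Q" "0 < c"
  shows "0 \<le> breakpoint_weight Q c"
proof -
  have "Max {q\<in>Q. q < c} \<in> {q\<in>Q. q < c}" using assms by (intro Max_in) auto
  then show ?thesis unfolding breakpoint_weight_def by auto
qed

lemma sum_breakpoint_weight_between:
  assumes "finite Q" "0 \<in> Q" "\<And>q. q \<in> Q \<Longrightarrow> 0 \<le> q" "x \<in> Q" "y \<in> Q"
  shows "(\<Sum>c\<in>{c\<in>Q. 0 < c}. breakpoint_weight Q c * (of_bool (x < c) * of_bool (c \<le> y))) = max 0 (y - x)"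
proof -
  have "(\<Sum>c\<in>{c\<in>Q. 0 < c}. breakpoint_weight Q c * (of_bool (x < c) * of_bool (c \<le> y)))
      = (\<Sum>c\<in>{c\<in>Q. 0 < c \<and> x < c \<and> c \<le> y}. breakpoint_weight Q c)"
    using assms(1) by (intro sum.mono_neutral_cong_right) auto
  also have "\<dots> = max 0 (y - x)"
  proof (cases "x \<le> y")
    case True
    have "{c\<in>Q. 0 < c \<and> c \<le> y} = {c\<in>Q. 0 < c \<and> c \<le> x} \<union> {c\<in>Q. 0 < c \<and> x < c \<and> c \<le> y}"
      using True by auto
    then have "(\<Sum>c\<in>{c\<in>Q. 0 < c \<and> c \<le> y}. breakpoint_weight Q c) = (\<Sum>c\<in>{c\<in>Q. 0 < c \<and> c \<le> x}. breakpoint_weight Q c)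
        + (\<Sum>c\<in>{c\<in>Q. 0 < c \<and> x < c \<and> c \<le> y}. breakpoint_weight Q c)"
      using sum.union_disjoint[of "{c\<in>Q. 0 < c \<and> c \<le> x}" "{c\<in>Q. 0 < c \<and> x < c \<and> c \<le> y}" "breakpoint_weight Q"] assms(1)
      by fastforce
    then show ?thesis using sum_breakpoint_weight[OF assms(1-3)] assms(4,5) True by simp
  next
    case False
    then have empty: "{c\<in>Q. 0 < c \<and> x < c \<and> c \<le> y} = {}" by auto
    show ?thesis unfolding empty using False by simp
  qed
  finally show ?thesis .
qed

section \<open>Classes with two vertices\<close>

text \<open>
  \<open>h7_value \<alpha> \<beta> \<gamma>\<close> is the least triangle density of a weighting of \<open>H9\<close> in which \<open>b\<^sub>3\<close> and \<open>c\<^sub>2\<close>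
  have weight 0, as long as the optimal weight of \<open>a\<^sub>3\<close> is not negative (see \<open>h9_attains\<close>).
\<close>
definition h7_value :: "real \<Rightarrow> real \<Rightarrow> real \<Rightarrow> real" where
  "h7_value x y z = 2 * sqrt (y * z * (1 - x)) - 2 * (1 - x)"

text \<open>The three values correspond to the class that keeps all three vertices: A, B and C in
  this order.\<close>

definition h7_min :: "real \<Rightarrow> real \<Rightarrow> real \<Rightarrow> real" where
  "h7_min \<alpha> \<beta> \<gamma> = min (h7_value \<alpha> \<beta> \<gamma>) (min (h7_value \<beta> \<gamma> \<alpha>) (h7_value \<gamma> \<alpha> \<beta>))"

lemma h7_value_commute: "h7_value x z y = h7_value x y z"
  by (simp add: h7_value_def mult.commute)

lemma h7_min_rotate: "h7_min \<beta> \<gamma> \<alpha> = h7_min \<alpha> \<beta> \<gamma>"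
  by (simp add: h7_min_def min.commute min.left_commute)

lemma two_sqrt_le_add:
  fixes a b p q c :: real
  assumes "0 \<le> a" "0 \<le> b" "0 \<le> p" "0 \<le> q" "0 \<le> c" "c \<le> p * q"
  shows "2 * sqrt (a * b * c) \<le> p * a + q * b"
proof -
  have "2 * sqrt (a * b * c) \<le> 2 * sqrt ((p * a) * (q * b))"
    using assms by (simp add: mult.commute mult.left_commute mult_left_mono)
  also have "\<dots> \<le> p * a + q * b"
    using arith_geo_mean_sqrt[of "p * a" "q * b"] assms by simp
  finally show ?thesis .
qed

text \<open>Let C have two vertices, of weights \<open>r\<close> and \<open>s\<close>. Here
  \<open>u\<close> and \<open>v\<close> are the weights of the parts of A and B joined to both of
  them, \<open>u1\<close> of the part of A joined only to the first and \<open>v1\<close> of the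
  part of B joined only to the second; \<open>1 - \<gamma>\<close> is the weight of the missing
  pairs between A and B. The right side is the triangle density if missing pairs cover all of
  \<open>u * v\<close> and the rest of them destroys triangles at rate \<open>s\<close>. For fixed
  \<open>u\<close>, \<open>s\<close> and densities it is affine in \<open>v\<close>, and the sign of
  the slope decides in which direction to push \<open>v\<close>.\<close>

lemma two_point_fill_bound:
  fixes u u1 v v1 r s \<alpha> \<beta> \<gamma> :: real
  assumes nn: "0 \<le> u" "0 \<le> u1" "u + u1 \<le> 1" "0 \<le> v" "0 \<le> v1" "v + v1 \<le> 1" "0 \<le> r" "0 \<le> s" "r + s = 1"
    and \<beta>: "\<beta> = u + r * u1" and \<alpha>: "\<alpha> = v + s * v1" and \<gamma>: "\<gamma> \<le> 1" "0 \<le> \<gamma>" "u * v \<le> 1 - \<gamma>"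
  shows "min (h7_value \<beta> \<gamma> \<alpha>) (h7_value \<gamma> \<alpha> \<beta>) \<le> u * \<alpha> + v * \<beta> - 2 * (u * v) - s * ((1 - \<gamma>) - u * v)"
proof -
  have r: "r = 1 - s" and s1: "s \<le> 1" using nn by auto
  have ru1: "0 \<le> r * u1" "r * u1 \<le> r * (1 - u)" using nn by (auto intro!: mult_left_mono)
  have sv1: "0 \<le> s * v1" "s * v1 \<le> s * (1 - v)" using nn by (auto intro!: mult_left_mono)
  have "r * (1 - u) \<le> 1 * (1 - u)" using nn by (intro mult_right_mono) auto
  then have \<beta>1: "\<beta> \<le> 1" "0 \<le> \<beta>" "u \<le> \<beta>" using ru1 nn \<beta> by auto
  have \<alpha>0: "0 \<le> \<alpha>" using sv1 nn \<alpha> by auto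
  show ?thesis
  proof (cases "u > 1/2")
    case True
    \<comment> \<open>The slope in \<open>v\<close> is at most 0, so \<open>v\<close> may be raised
      to \<open>q\<close>, where \<open>u * v\<close> equals the whole deficit
      \<open>1 - \<gamma>\<close>. Since the expression is only estimated, \<open>q\<close> may
      exceed 1.\<close>
    define q where "q = (1 - \<gamma>) / u"
    have q: "u * q = 1 - \<gamma>" "0 \<le> q" "v \<le> q" using True \<gamma> by (auto simp: q_def field_simps)
    have "h7_value \<gamma> \<alpha> \<beta> \<le> u * \<alpha> + q * \<beta> - 2 * (1 - \<gamma>)"
      unfolding h7_value_def using two_sqrt_le_add[of \<alpha> \<beta> u q "1 - \<gamma>"] \<alpha>0 \<beta>1 nn q \<gamma> by simp
    moreover have "\<beta> - 2 * u + s * u \<le> 0"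
    proof -
      have "\<beta> - 2 * u + s * u \<le> u + (1 - s) * (1 - u) - 2 * u + s * u" using ru1 \<beta> r by simp
      also have "\<dots> = (1 - s) * (1 - 2 * u)" by (simp add: algebra_simps)
      also have "\<dots> \<le> 0" using s1 True by (intro mult_nonneg_nonpos) auto
      finally show ?thesis .
    qed
    then have "0 \<le> (v - q) * (\<beta> - 2 * u + s * u)" using q by (intro mult_nonpos_nonpos) auto
    then have "u * \<alpha> + q * \<beta> - 2 * (u * q) - s * ((1 - \<gamma>) - u * q) \<le> u * \<alpha> + v * \<beta> - 2 * (u * v) - s * ((1 - \<gamma>) - u * v)"
      by (simp add: algebra_simps)
    then have "u * \<alpha> + q * \<beta> - 2 * (1 - \<gamma>) \<le> u * \<alpha> + v * \<beta> - 2 * (u * v) - s * ((1 - \<gamma>) - u * v)"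
      using q(1) by simp
    ultimately show ?thesis by simp
  next
    case False
    \<comment> \<open>\<open>W\<close> is the largest \<open>s\<close> compatible with
      \<open>u\<close> and \<open>\<beta>\<close>, reached when \<open>u + u1 = 1\<close>. After
      raising \<open>s\<close> to \<open>W\<close> the slope in \<open>v\<close> is
      \<open>(1 - W) * (1 - 2 * u)\<close>, which is nonnegative, so \<open>v\<close> may be lowered
      to the least value that the density \<open>\<alpha>\<close> permits.\<close>
    define W where "W = (1 - \<beta>) / (1 - u)"
    have W: "W * (1 - u) = 1 - \<beta>" "0 \<le> W" "W \<le> 1" using False \<beta>1 by (auto simp: W_def field_simps)
    have "s * (1 - u) \<le> W * (1 - u)" using ru1(2) W(1) \<beta> r by (simp add: algebra_simps)
    then have sW: "s \<le> W" using False by (simp add: mult_le_cancel_right)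
    have "\<alpha> \<le> v + s * (1 - v)" using sv1 \<alpha> by simp
    also have "\<dots> \<le> v + W * (1 - v)" using sW nn by (intro add_left_mono mult_right_mono) auto
    finally have "\<alpha> - W \<le> v * (1 - W)" by (simp add: algebra_simps)
    then have "(\<alpha> - W) * (1 - 2 * u) \<le> v * (1 - W) * (1 - 2 * u)" using False by (intro mult_right_mono) auto
    then have 1: "\<alpha> * (1 - u) + W * \<gamma> - 2 * (W * (1 - u)) \<le> u * \<alpha> - W * (1 - \<gamma>) + v * ((1 - W) * (1 - 2 * u))"
      by (simp add: algebra_simps)
    have "(1 - W) * (1 - 2 * u) = (1 - W * (1 - u)) - 2 * u + W * u" by (simp add: algebra_simps)
    also have "\<dots> = \<beta> - 2 * u + W * u" unfolding W(1) by simp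
    finally have "v * ((1 - W) * (1 - 2 * u)) = v * (\<beta> - 2 * u + W * u)" by simp
    then have 2: "u * \<alpha> - W * (1 - \<gamma>) + v * ((1 - W) * (1 - 2 * u)) = u * \<alpha> + v * \<beta> - 2 * (u * v) - W * ((1 - \<gamma>) - u * v)"
      by (simp add: algebra_simps)
    have "s * ((1 - \<gamma>) - u * v) \<le> W * ((1 - \<gamma>) - u * v)" using sW \<gamma> by (intro mult_right_mono) auto
    moreover have "h7_value \<beta> \<gamma> \<alpha> \<le> \<alpha> * (1 - u) + W * \<gamma> - 2 * (W * (1 - u))"
      unfolding h7_value_def using two_sqrt_le_add[of \<gamma> \<alpha> W "1 - u" "1 - \<beta>"] \<alpha>0 \<beta>1 False W \<gamma>(2)
      by (simp add: mult.commute)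
    ultimately show ?thesis using 1 2 by simp
  qed
qed

text \<open>Now all missing pairs fit into the part where each destroys its full weight. With
  \<open>P\<close>, \<open>Q\<close>, \<open>G\<close> as in the proof,
  \<open>2 * (Q * P) - P * P\<close> increases in \<open>P\<close> up to \<open>Q\<close>, so
  \<open>P\<close> may be lowered to \<open>G\<close>.\<close>

lemma two_point_small_deficit_bound:
  fixes u v \<alpha> \<beta> \<gamma> :: real
  assumes "0 \<le> u" "u \<le> \<beta>" "0 \<le> v" "v \<le> \<alpha>" "\<gamma> \<le> 1" "1 - \<gamma> \<le> u * v"
  shows "h7_value \<gamma> \<alpha> \<beta> \<le> u * \<alpha> + v * \<beta> - u * v - (1 - \<gamma>)"
proof -
  define P Q G where "P = sqrt (u * v)" and "Q = sqrt (\<alpha> * \<beta>)" and "G = sqrt (1 - \<gamma>)"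
  have nn: "0 \<le> \<alpha>" "0 \<le> \<beta>" using assms by auto
  have "u * v \<le> \<beta> * \<alpha>" using assms nn by (intro mult_mono) auto
  then have GPQ: "0 \<le> G" "G \<le> P" "P \<le> Q" using assms by (auto simp: P_def Q_def G_def mult.commute)
  have sq: "P * P = u * v" "G * G = 1 - \<gamma>" using assms nn by (auto simp: P_def G_def)
  have "2 * (Q * P) \<le> u * \<alpha> + v * \<beta>"
    using two_sqrt_le_add[of \<alpha> \<beta> u v "u * v"] assms nn unfolding P_def Q_def by (simp add: real_sqrt_mult)
  moreover have "0 \<le> (P - G) * (2 * Q - P - G)" using GPQ by (intro mult_nonneg_nonneg) auto
  then have "2 * (Q * G) - 2 * (G * G) \<le> 2 * (Q * P) - P * P - G * G" by (simp add: algebra_simps)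
  moreover have "h7_value \<gamma> \<alpha> \<beta> = 2 * (Q * G) - 2 * (G * G)"
    unfolding sq(2) unfolding h7_value_def Q_def G_def by (simp add: real_sqrt_mult)
  ultimately show ?thesis using sq by simp
qed

text \<open>\<open>k\<close>, \<open>k'\<close> and \<open>k''\<close> are the missing weights in
  the parts \<open>u * v\<close>, \<open>u * v1\<close> and \<open>u1 * v\<close>, where a missing
  pair costs 1, \<open>s\<close> and \<open>r\<close>. The cases ask whether the deficit fits into
  the first part, the most profitable one.\<close>

lemma two_point_bound:
  fixes u u1 v v1 r s \<alpha> \<beta> \<gamma> k k' k'' :: real
  assumes nn: "0 \<le> u" "0 \<le> u1" "u + u1 \<le> 1" "0 \<le> v" "0 \<le> v1" "v + v1 \<le> 1" "0 \<le> r" "0 \<le> s" "r + s = 1"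
    and \<beta>: "\<beta> = u + r * u1" and \<alpha>: "\<alpha> = v + s * v1" and \<gamma>: "\<gamma> \<le> 1" "0 \<le> \<gamma>"
    and k: "0 \<le> k" "k \<le> u * v" "0 \<le> k'" "0 \<le> k''" "k + k' + k'' \<le> 1 - \<gamma>"
  shows "h7_min \<alpha> \<beta> \<gamma> \<le> u * \<alpha> + v * \<beta> - u * v - k - s * k' - r * k''"
proof (cases "1 - \<gamma> \<le> u * v")
  case True
  have "s * k' \<le> 1 * k'" "r * k'' \<le> 1 * k''" by (rule mult_right_mono; use nn k in simp)+
  moreover have "h7_value \<gamma> \<alpha> \<beta> \<le> u * \<alpha> + v * \<beta> - u * v - (1 - \<gamma>)"
    using True nn \<alpha> \<beta> \<gamma> by (intro two_point_small_deficit_bound) auto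
  ultimately show ?thesis using k unfolding h7_min_def by simp
next
  case False
  have fill: "k + s * k' + r * k'' \<le> u * v + m * ((1 - \<gamma>) - u * v)" if m: "s \<le> m" "r \<le> m" "m \<le> 1" for m
  proof -
    have "s * k' \<le> m * k'" "r * k'' \<le> m * k''" using k m by (auto intro!: mult_right_mono)
    moreover have "m * (k' + k'') \<le> m * ((1 - \<gamma>) - k)" using k m nn by (intro mult_left_mono) auto
    moreover have "(1 - m) * k \<le> (1 - m) * (u * v)" using k m by (intro mult_left_mono) auto
    ultimately show ?thesis by (simp add: algebra_simps)
  qed
  show ?thesis
  proof (cases "r \<le> s")
    case True
    have "min (h7_value \<beta> \<gamma> \<alpha>) (h7_value \<gamma> \<alpha> \<beta>) \<le> u * \<alpha> + v * \<beta> - 2 * (u * v) - s * ((1 - \<gamma>) - u * v)"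
      using False by (intro two_point_fill_bound[OF nn \<beta> \<alpha> \<gamma>]) auto
    then show ?thesis using fill[of s] True nn unfolding h7_min_def by simp
  next
    \<comment> \<open>Interchanging A and B interchanges \<open>r\<close> with \<open>s\<close> and
      \<open>u\<close> with \<open>v\<close>.\<close>
    case c: False
    have "min (h7_value \<alpha> \<gamma> \<beta>) (h7_value \<gamma> \<beta> \<alpha>) \<le> v * \<beta> + u * \<alpha> - 2 * (v * u) - r * ((1 - \<gamma>) - v * u)"
      using False nn by (intro two_point_fill_bound[OF nn(4-6) nn(1-3) nn(8,7) _ \<alpha> \<beta> \<gamma>]) (auto simp: mult.commute)
    then show ?thesis using fill[of r] c nn unfolding h7_min_def
      by (simp add: h7_value_commute[of \<alpha> \<gamma>] h7_value_commute[of \<gamma> \<beta>] mult.commute)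
  qed
qed

text \<open>The neighbourhoods in the two vertices of C are nested, as \<open>h1 \<le> h2\<close>
  and \<open>g2 \<le> g1\<close>. So \<open>U\<close> and \<open>V\<close> measure the parts joined
  to both vertices, \<open>U1\<close> the part of A joined only to the second and \<open>V1\<close>
  the part of B joined only to the first. Expanding the triangle density in these parts gives the
  expression of \<open>two_point_bound\<close> with \<open>r = w2\<close> and
  \<open>s = w1\<close>.\<close>

lemma two_vertex_class_bound:
  fixes u h1 h2 :: "'a \<Rightarrow> real" and v g1 g2 :: "'b \<Rightarrow> real" and f :: "'a \<Rightarrow> 'b \<Rightarrow> real"
  assumes fin: "finite A" "finite B"
    and u: "\<And>a. a \<in> A \<Longrightarrow> 0 \<le> u a" "(\<Sum>a\<in>A. u a) = 1" and v: "\<And>b. b \<in> B \<Longrightarrow> 0 \<le> v b" "(\<Sum>b\<in>B. v b) = 1"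
    and h: "\<And>a. a \<in> A \<Longrightarrow> 0 \<le> h1 a \<and> h1 a \<le> h2 a \<and> h2 a \<le> 1"
    and g: "\<And>b. b \<in> B \<Longrightarrow> 0 \<le> g2 b \<and> g2 b \<le> g1 b \<and> g1 b \<le> 1"
    and f: "\<And>a b. a \<in> A \<Longrightarrow> b \<in> B \<Longrightarrow> 0 \<le> f a b \<and> f a b \<le> 1"
    and w: "0 \<le> w1" "0 \<le> w2" "w1 + w2 = 1"
    and \<alpha>: "\<alpha> = (\<Sum>b\<in>B. v b * (w1 * g1 b + w2 * g2 b))"
    and \<beta>: "\<beta> = (\<Sum>a\<in>A. u a * (w1 * h1 a + w2 * h2 a))"
    and \<gamma>: "\<gamma> = (\<Sum>a\<in>A. \<Sum>b\<in>B. u a * v b * f a b)"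
  shows "h7_min \<alpha> \<beta> \<gamma> \<le> (\<Sum>a\<in>A. \<Sum>b\<in>B. u a * v b * f a b * (w1 * h1 a * g1 b + w2 * h2 a * g2 b))"
proof -
  define S where "S \<phi> = (\<Sum>a\<in>A. \<Sum>b\<in>B. u a * v b * \<phi> a b)" for \<phi> :: "'a \<Rightarrow> 'b \<Rightarrow> real"
  have S_add: "S (\<lambda>a b. \<phi> a b + \<psi> a b) = S \<phi> + S \<psi>" for \<phi> \<psi> by (simp add: S_def distrib_left sum.distrib)
  have S_diff: "S (\<lambda>a b. \<phi> a b - \<psi> a b) = S \<phi> - S \<psi>" for \<phi> \<psi> by (simp add: S_def right_diff_distrib sum_subtractf)
  have S_scale: "S (\<lambda>a b. c * \<phi> a b) = c * S \<phi>" for \<phi> c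
    by (simp add: S_def sum_distrib_left mult.commute mult.left_commute)
  have S_prod: "S (\<lambda>a b. \<phi> a * \<psi> b) = (\<Sum>a\<in>A. u a * \<phi> a) * (\<Sum>b\<in>B. v b * \<psi> b)" for \<phi> \<psi>
    unfolding S_def sum_product by (simp add: mult.commute mult.left_commute)
  have S_mono: "S \<phi> \<le> S \<psi>" if "\<And>a b. a \<in> A \<Longrightarrow> b \<in> B \<Longrightarrow> \<phi> a b \<le> \<psi> a b" for \<phi> \<psi>
    unfolding S_def using that u(1) v(1) by (intro sum_mono mult_left_mono) auto
  have S_const: "S (\<lambda>_ _. c) = c" for c
    using S_prod[of "\<lambda>_. 1" "\<lambda>_. c"] u(2) v(2) by (simp flip: sum_distrib_right)
  define U U1 V V1 where "U = (\<Sum>a\<in>A. u a * h1 a)" and "U1 = (\<Sum>a\<in>A. u a * (h2 a - h1 a))"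
    and "V = (\<Sum>b\<in>B. v b * g2 b)" and "V1 = (\<Sum>b\<in>B. v b * (g1 b - g2 b))"
  define k k' k'' where "k = S (\<lambda>a b. (1 - f a b) * (h1 a * g2 b))"
    and "k' = S (\<lambda>a b. (1 - f a b) * (h1 a * (g1 b - g2 b)))"
    and "k'' = S (\<lambda>a b. (1 - f a b) * ((h2 a - h1 a) * g2 b))"
  have UU1: "U + U1 = (\<Sum>a\<in>A. u a * h2 a)" and VV1: "V + V1 = (\<Sum>b\<in>B. v b * g1 b)"
    unfolding U_def U1_def V_def V1_def sum.distrib[symmetric] by (simp_all add: algebra_simps)
  have bU: "0 \<le> U" "0 \<le> U1" "U + U1 \<le> 1"
  proof -
    show "0 \<le> U" "0 \<le> U1" unfolding U_def U1_def using u(1) h by (auto intro!: sum_nonneg)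
    have "u a * h2 a \<le> u a * 1" if "a \<in> A" for a using u(1) h that by (intro mult_left_mono) auto
    then show "U + U1 \<le> 1" unfolding UU1 using sum_mono[of A "\<lambda>a. u a * h2 a" u] u(2) by simp
  qed
  have bV: "0 \<le> V" "0 \<le> V1" "V + V1 \<le> 1"
  proof -
    show "0 \<le> V" "0 \<le> V1" unfolding V_def V1_def using v(1) g by (auto intro!: sum_nonneg)
    have "v b * g1 b \<le> v b * 1" if "b \<in> B" for b using v(1) g that by (intro mult_left_mono) auto
    then show "V + V1 \<le> 1" unfolding VV1 using sum_mono[of B "\<lambda>b. v b * g1 b" v] v(2) by simp
  qed
  have w1: "w1 = 1 - w2" using w by simp
  have \<beta>': "\<beta> = U + w2 * U1" unfolding \<beta> U_def U1_def sum_distrib_left sum.distrib[symmetric] w1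
    by (intro sum.cong) (auto simp: algebra_simps)
  have \<alpha>': "\<alpha> = V + w1 * V1" unfolding \<alpha> V_def V1_def sum_distrib_left sum.distrib[symmetric] w1
    by (intro sum.cong) (auto simp: algebra_simps)
  have \<gamma>': "\<gamma> = S f" unfolding \<gamma> S_def ..
  have \<gamma>01: "0 \<le> \<gamma>" "\<gamma> \<le> 1" using S_mono[of "\<lambda>_ _. 0" f] S_mono[of f "\<lambda>_ _. 1"] f S_const unfolding \<gamma>' by auto
  have pos: "0 \<le> (1 - f a b) * (h1 a * g2 b)" "0 \<le> (1 - f a b) * (h1 a * (g1 b - g2 b))"
    "0 \<le> (1 - f a b) * ((h2 a - h1 a) * g2 b)" "h1 a * g2 b + h1 a * (g1 b - g2 b) + (h2 a - h1 a) * g2 b \<le> 1"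
    "0 \<le> f a b * (h1 a * g2 b)"
    if "a \<in> A" "b \<in> B" for a b
  proof -
    note ab = h[OF that(1)] g[OF that(2)] f[OF that]
    show "0 \<le> (1 - f a b) * (h1 a * g2 b)" "0 \<le> (1 - f a b) * (h1 a * (g1 b - g2 b))"
      "0 \<le> (1 - f a b) * ((h2 a - h1 a) * g2 b)" "0 \<le> f a b * (h1 a * g2 b)"
      using ab by (auto intro!: mult_nonneg_nonneg)
    have "h1 a * g1 b \<le> h1 a * 1" "(h2 a - h1 a) * g2 b \<le> (h2 a - h1 a) * 1"
      by (rule mult_left_mono; use ab in simp)+
    then show "h1 a * g2 b + h1 a * (g1 b - g2 b) + (h2 a - h1 a) * g2 b \<le> 1" using ab by (simp add: algebra_simps)
  qed
  have k0: "0 \<le> k" "0 \<le> k'" "0 \<le> k''"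
    using S_mono[of "\<lambda>_ _. 0"] pos S_const[of 0] unfolding k_def k'_def k''_def by (metis (no_types, lifting))+
  have ksum: "k + k' + k'' \<le> 1 - \<gamma>"
  proof -
    have "k + k' + k'' \<le> S (\<lambda>a b. 1 - f a b)"
      unfolding k_def k'_def k''_def S_add[symmetric]
    proof (rule S_mono)
      fix a b assume ab: "a \<in> A" "b \<in> B"
      have "(1 - f a b) * (h1 a * g2 b + h1 a * (g1 b - g2 b) + (h2 a - h1 a) * g2 b) \<le> (1 - f a b) * 1"
        using pos(4)[OF ab] f[OF ab] by (intro mult_left_mono) auto
      then show "(1 - f a b) * (h1 a * g2 b) + (1 - f a b) * (h1 a * (g1 b - g2 b)) + (1 - f a b) * ((h2 a - h1 a) * g2 b) \<le> 1 - f a b"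
        by (simp only: distrib_left mult_1_right)
    qed
    then show ?thesis using S_diff[of "\<lambda>_ _. 1" f] S_const \<gamma>' by simp
  qed
  have kUV: "k \<le> U * V"
  proof -
    have "k \<le> S (\<lambda>a b. h1 a * g2 b)" unfolding k_def using pos(5) by (intro S_mono) (auto simp: algebra_simps)
    then show ?thesis unfolding S_prod U_def V_def .
  qed
  have "h7_min \<alpha> \<beta> \<gamma> \<le> U * \<alpha> + V * \<beta> - U * V - k - w1 * k' - w2 * k''"
    using bU bV w \<gamma>01 \<beta>' \<alpha>' k0 kUV ksum by (intro two_point_bound[of U U1 V V1 w2 w1]) auto
  also have "\<dots> = S (\<lambda>a b. f a b * (w1 * h1 a * g1 b + w2 * h2 a * g2 b))"
  proof -
    have 1: "f a b * (w1 * h1 a * g1 b + w2 * h2 a * g2 b) =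
      h1 a * g2 b + w1 * (h1 a * (g1 b - g2 b)) + w2 * ((h2 a - h1 a) * g2 b)
      - (1 - f a b) * (h1 a * g2 b) - w1 * ((1 - f a b) * (h1 a * (g1 b - g2 b))) - w2 * ((1 - f a b) * ((h2 a - h1 a) * g2 b))" for a b
      unfolding w1 by (simp add: algebra_simps)
    have "S (\<lambda>a b. f a b * (w1 * h1 a * g1 b + w2 * h2 a * g2 b)) = U * V + w1 * (U * V1) + w2 * (U1 * V) - k - w1 * k' - w2 * k''"
      unfolding 1 S_diff S_add S_scale S_prod k_def k'_def k''_def U_def U1_def V_def V1_def ..
    then show ?thesis unfolding \<alpha>' \<beta>' by (simp add: algebra_simps)
  qed
  also have "\<dots> = (\<Sum>a\<in>A. \<Sum>b\<in>B. u a * v b * f a b * (w1 * h1 a * g1 b + w2 * h2 a * g2 b))"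
    unfolding S_def by (simp add: mult.assoc)
  finally show ?thesis .
qed

section \<open>Weightings of H9\<close>

lemma sum_lessThan_3: "(\<Sum>i<3. F i) = F 0 + F 1 + F (2::nat)" for F :: "nat \<Rightarrow> real"
  by (simp add: eval_nat_numeral)

lemma all_less_3: "(\<forall>i<3. P i) \<longleftrightarrow> P 0 \<and> P 1 \<and> P (2::nat)"
  by (auto simp: eval_nat_numeral less_Suc_eq)

definition weights3 :: "(nat \<Rightarrow> real) \<Rightarrow> bool" where
  "weights3 u \<longleftrightarrow> (\<forall>i<3. 0 \<le> u i) \<and> (\<Sum>i<3. u i) = 1"

definition dens3 :: "(nat \<Rightarrow> real) \<Rightarrow> (nat \<Rightarrow> real) \<Rightarrow> (nat \<Rightarrow> nat \<Rightarrow> real) \<Rightarrow> real" where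
  "dens3 u v f = (\<Sum>i<3. \<Sum>j<3. u i * v j * f i j)"

text \<open>Adjacencies are read cyclically: \<open>f\<close> from A to B, \<open>g\<close> from B
  to C and \<open>h\<close> from C to A. Rotating the classes then needs no transposition, and each
  estimate is proved for one class only.\<close>

definition tri3 :: "(nat \<Rightarrow> real) \<Rightarrow> (nat \<Rightarrow> real) \<Rightarrow> (nat \<Rightarrow> real) \<Rightarrow>
    (nat \<Rightarrow> nat \<Rightarrow> real) \<Rightarrow> (nat \<Rightarrow> nat \<Rightarrow> real) \<Rightarrow> (nat \<Rightarrow> nat \<Rightarrow> real) \<Rightarrow> real" where
  "tri3 u v w f g h = (\<Sum>i<3. \<Sum>j<3. \<Sum>k<3. u i * v j * w k * (f i j * g j k * h k i))"

text \<open>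
  With the classes of \<open>H9\<close> numbered \<open>(a\<^sub>2, a\<^sub>3, a\<^sub>1)\<close>, \<open>(b\<^sub>2, b\<^sub>3, b\<^sub>1)\<close>, \<open>(c\<^sub>3, c\<^sub>2, c\<^sub>1)\<close> by
  \<open>0, 1, 2\<close>, the adjacency of \<open>a\<close> to \<open>b\<close>, of \<open>b\<close> to \<open>c\<close> and of \<open>c\<close> to \<open>a\<close> is in each case that the
  index does not increase. So \<open>H9\<close> has a cyclic symmetry and its triangles have constant index.
\<close>
definition h9_adj :: "nat \<Rightarrow> nat \<Rightarrow> real" where
  "h9_adj i j = of_bool (j \<le> i)"

definition h9_weights :: "real \<Rightarrow> real \<Rightarrow> real \<Rightarrow> ((nat \<Rightarrow> real) \<times> (nat \<Rightarrow> real) \<times> (nat \<Rightarrow> real)) set" where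
  "h9_weights \<alpha> \<beta> \<gamma> = {(u, v, w). weights3 u \<and> weights3 v \<and> weights3 w \<and>
     dens3 v w h9_adj = \<alpha> \<and> dens3 w u h9_adj = \<beta> \<and> dens3 u v h9_adj = \<gamma>}"

definition h9_density :: "(nat \<Rightarrow> real) \<times> (nat \<Rightarrow> real) \<times> (nat \<Rightarrow> real) \<Rightarrow> real" where
  "h9_density = (\<lambda>(u, v, w). \<Sum>i<3. u i * v i * w i)"

lemma tri3_rotate: "tri3 v w u g h f = tri3 u v w f g h"
  unfolding tri3_def sum_lessThan_3 by (simp add: algebra_simps)

lemma tri3_h9: "tri3 u v w h9_adj h9_adj h9_adj = h9_density (u, v, w)"
  unfolding tri3_def h9_density_def h9_adj_def by (simp add: sum_lessThan_3)

lemma h9_weights_rotate: "(u, v, w) \<in> h9_weights \<alpha> \<beta> \<gamma> \<Longrightarrow> (v, w, u) \<in> h9_weights \<beta> \<gamma> \<alpha>"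
  by (auto simp: h9_weights_def)

lemma h9_density_rotate: "h9_density (v, w, u) = h9_density (u, v, w)"
  by (simp add: h9_density_def sum_lessThan_3)

lemma R_rotate: "(\<alpha>, \<beta>, \<gamma>) \<in> R \<Longrightarrow> (\<beta>, \<gamma>, \<alpha>) \<in> R"
  by (auto simp: R_def mult.commute)

lemma R_up: "(\<alpha>, \<beta>, \<gamma>) \<in> R \<Longrightarrow> \<gamma> \<le> \<gamma>' \<Longrightarrow> \<gamma>' \<le> 1 \<Longrightarrow> (\<alpha>, \<beta>, \<gamma>') \<in> R"
proof -
  assume a: "(\<alpha>, \<beta>, \<gamma>) \<in> R" "\<gamma> \<le> \<gamma>'" "\<gamma>' \<le> 1"
  then have "\<alpha> * \<gamma> \<le> \<alpha> * \<gamma>'" "\<beta> * \<gamma> \<le> \<beta> * \<gamma>'" by (auto simp: R_def intro!: mult_left_mono)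
  with a show ?thesis by (auto simp: R_def)
qed

lemma h7_value_pos:
  assumes "(\<alpha>, \<beta>, \<gamma>) \<in> R" "\<gamma> < 1"
  shows "0 < h7_value \<gamma> \<alpha> \<beta>"
proof -
  have "(1 - \<gamma>) * (1 - \<gamma>) < \<alpha> * \<beta> * (1 - \<gamma>)"
    using assms by (intro mult_strict_right_mono) (auto simp: R_def)
  then have "(1 - \<gamma>)\<^sup>2 < \<alpha> * \<beta> * (1 - \<gamma>)" by (simp add: power2_eq_square)
  then have "1 - \<gamma> < sqrt (\<alpha> * \<beta> * (1 - \<gamma>))" by (rule real_less_rsqrt)
  then show ?thesis by (simp add: h7_value_def)
qed

text \<open>Some \<open>h7_value\<close> vanishes as soon as a density is 1; in that case the
  conditions of \<open>R\<close> make the linear bound positive instead.\<close>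

lemma lower_bound_pos:
  assumes "(\<alpha>, \<beta>, \<gamma>) \<in> R"
  shows "0 < \<alpha> + \<beta> + \<gamma> - 2 \<or> 0 < h7_min \<alpha> \<beta> \<gamma>"
proof (cases "\<alpha> < 1 \<and> \<beta> < 1 \<and> \<gamma> < 1")
  case True
  note r = R_rotate[OF assms] R_rotate[OF R_rotate[OF assms]]
  show ?thesis
    using h7_value_pos[OF assms] h7_value_pos[OF r(1)] h7_value_pos[OF r(2)] True by (simp add: h7_min_def)
next
  case False
  with assms show ?thesis by (auto simp: R_def)
qed

text \<open>\<open>B\<close> and \<open>C\<close> are the weights of \<open>b2\<close> and
  \<open>c1\<close>, while \<open>b3\<close> and \<open>c2\<close> get 0. The equations in
  \<open>d\<close> express the three densities through the weights of missing edges.\<close>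

lemma h7_weights:
  fixes u0 u1 u2 B C :: real
  assumes u: "0 \<le> u0" "0 \<le> u1" "0 \<le> u2" "u0 + u1 + u2 = 1" and BC: "0 \<le> B" "B \<le> 1" "0 \<le> C" "C \<le> 1"
    and d: "B * C = 1 - \<alpha>" "(u1 + u2) * (1 - C) = 1 - \<beta>" "(u0 + u1) * (1 - B) = 1 - \<gamma>"
  shows "\<exists>x\<in>h9_weights \<alpha> \<beta> \<gamma>. h9_density x = \<beta> * B + \<gamma> * C - 2 * (1 - \<alpha>)"
proof
  let ?x = "(\<lambda>i::nat. if i = 0 then u0 else if i = 1 then u1 else u2, \<lambda>i::nat. if i = 0 then B else if i = 1 then 0 else 1 - B,
    \<lambda>i::nat. if i = 0 then 1 - C else if i = 1 then 0 else C)"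
  have u0: "u0 = 1 - u1 - u2" using u by simp
  show "?x \<in> h9_weights \<alpha> \<beta> \<gamma>"
    unfolding h9_weights_def weights3_def all_less_3 dens3_def h9_adj_def sum_lessThan_3
    using u BC d by (simp add: u0) (simp add: algebra_simps)
  have "h9_density ?x = B * ((1 - C) - (u1 + u2) * (1 - C)) + C * ((1 - B) - (u0 + u1) * (1 - B))"
    unfolding h9_density_def sum_lessThan_3 by (simp add: u0) (simp add: algebra_simps)
  also have "\<dots> = \<beta> * B + \<gamma> * C - 2 * (B * C)" unfolding d(2,3) by (simp add: algebra_simps)
  finally show "h9_density ?x = \<beta> * B + \<gamma> * C - 2 * (1 - \<alpha>)" unfolding d(1) .
qed

text \<open>For \<open>\<alpha> < 1\<close> the weightings of \<open>h7_weights\<close> form a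
  family in the single parameter \<open>B\<close>, with \<open>C = (1 - \<alpha>) / B\<close> and
  density \<open>t B\<close>. The least value of \<open>t\<close> is \<open>h7_value\<close>; if it
  lies below the linear bound, \<open>B\<close> is increased until the linear bound is met.\<close>

lemma h9_attains:
  assumes "(\<alpha>, \<beta>, \<gamma>) \<in> R"
  shows "\<exists>x\<in>h9_weights \<alpha> \<beta> \<gamma>. h9_density x = max (\<alpha> + \<beta> + \<gamma> - 2) (h7_value \<alpha> \<beta> \<gamma>)"
proof -
  have b: "0 \<le> \<alpha>" "\<alpha> \<le> 1" "0 \<le> \<beta>" "\<beta> \<le> 1" "0 \<le> \<gamma>" "\<gamma> \<le> 1" and r: "\<alpha> * \<beta> + \<gamma> > 1" "\<alpha> * \<gamma> + \<beta> > 1" "\<beta> * \<gamma> + \<alpha> > 1"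
    using assms by (auto simp: R_def)
  have pos: "0 < \<alpha>" "0 < \<beta>" "0 < \<gamma>" using b r by (auto simp: order.order_iff_strict)
  have le: "\<alpha> * \<beta> \<le> \<beta>" "\<alpha> * \<gamma> \<le> \<gamma>" using b by (auto simp: mult_left_le_one_le)
  show ?thesis
  proof (cases "\<alpha> = 1")
    case True
    \<comment> \<open>Here \<open>C = 0\<close> and \<open>a3\<close> has weight 0, so only the
      density \<open>\<gamma>\<close> determines \<open>B\<close>.\<close>
    define B where "B = 1 - (1 - \<gamma>) / \<beta>"
    have \<beta>B: "\<beta> * (1 - B) = 1 - \<gamma>" "0 \<le> B" "B \<le> 1" using pos r b True by (auto simp: B_def field_simps)
    have ex: "\<exists>x\<in>h9_weights \<alpha> \<beta> \<gamma>. h9_density x = \<beta> * B + \<gamma> * 0 - 2 * (1 - \<alpha>)"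
      by (rule h7_weights[of \<beta> 0 "1 - \<beta>"]) (use \<beta>B b True in auto)
    have "\<beta> * B + \<gamma> * 0 - 2 * (1 - \<alpha>) = \<alpha> + \<beta> + \<gamma> - 2" using \<beta>B(1) True by (simp add: algebra_simps)
    moreover have "h7_value \<alpha> \<beta> \<gamma> = 0" "0 \<le> \<alpha> + \<beta> + \<gamma> - 2" using True r by (simp_all add: h7_value_def)
    ultimately have "\<beta> * B + \<gamma> * 0 - 2 * (1 - \<alpha>) = max (\<alpha> + \<beta> + \<gamma> - 2) (h7_value \<alpha> \<beta> \<gamma>)" by simp
    then show ?thesis using ex by (simp only:)
  next
    case False
    then have \<alpha>1: "\<alpha> < 1" using b by simp
    define t where "t B = \<beta> * B + \<gamma> * ((1 - \<alpha>) / B) - 2 * (1 - \<alpha>)" for B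
    \<comment> \<open>Equality of the two terms, \<open>\<beta> * B = \<gamma> * C\<close>. Both
      further bounds on \<open>B0\<close> come from the condition
      \<open>\<beta> * \<gamma> + \<alpha> > 1\<close>; they keep \<open>B\<close> below
      \<open>\<gamma>\<close> and \<open>C\<close> below \<open>\<beta>\<close>.\<close>
    define B0 where "B0 = sqrt (\<gamma> * (1 - \<alpha>) / \<beta>)"
    have B0: "0 < B0" "B0 \<le> \<gamma>" "1 - \<alpha> \<le> \<beta> * B0"
    proof -
      show "0 < B0" using pos \<alpha>1 by (simp add: B0_def)
      have "\<gamma> * (1 - \<alpha>) \<le> \<gamma> * (\<beta> * \<gamma>)" using r b by (intro mult_left_mono) auto
      then have "\<gamma> * (1 - \<alpha>) / \<beta> \<le> \<gamma>\<^sup>2" using pos by (simp add: field_simps power2_eq_square)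
      then show "B0 \<le> \<gamma>" unfolding B0_def using b by (intro real_le_lsqrt) auto
      have "(1 - \<alpha>) * (1 - \<alpha>) \<le> (\<beta> * \<gamma>) * (1 - \<alpha>)" using r \<alpha>1 by (intro mult_right_mono) auto
      then have "(1 - \<alpha>) * (1 - \<alpha>) / (\<beta> * \<beta>) \<le> (\<beta> * \<gamma>) * (1 - \<alpha>) / (\<beta> * \<beta>)" using pos by (intro divide_right_mono) auto
      then have "((1 - \<alpha>) / \<beta>)\<^sup>2 \<le> \<gamma> * (1 - \<alpha>) / \<beta>" using pos by (simp add: power2_eq_square)
      then have "(1 - \<alpha>) / \<beta> \<le> B0" unfolding B0_def by (rule real_le_rsqrt)
      then show "1 - \<alpha> \<le> \<beta> * B0" using pos by (simp add: field_simps)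
    qed
    have t0: "t B0 = h7_value \<alpha> \<beta> \<gamma>"
    proof -
      have sq: "B0 * B0 = \<gamma> * (1 - \<alpha>) / \<beta>" using pos \<alpha>1 by (simp add: B0_def)
      have "\<gamma> * ((1 - \<alpha>) / B0) = \<beta> * B0"
      proof -
        have "\<gamma> * (1 - \<alpha>) = \<beta> * B0 * B0" using sq pos by (simp add: field_simps)
        then show ?thesis using B0(1) by (simp add: field_simps)
      qed
      moreover have "\<beta> * B0 = sqrt (\<beta> * \<gamma> * (1 - \<alpha>))"
      proof (rule real_sqrt_unique[symmetric])
        have "(\<beta> * B0)\<^sup>2 = \<beta> * \<beta> * (B0 * B0)" by (simp add: power2_eq_square)
        then show "(\<beta> * B0)\<^sup>2 = \<beta> * \<gamma> * (1 - \<alpha>)" unfolding sq using pos by simp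
      qed (use pos B0 in simp)
      ultimately show ?thesis by (simp add: t_def h7_value_def)
    qed
    have t1: "\<alpha> + \<beta> + \<gamma> - 2 \<le> t \<gamma>"
    proof -
      have "0 \<le> (1 - \<beta>) * (1 - \<gamma>)" using b by simp
      moreover have "t \<gamma> = \<beta> * \<gamma> - (1 - \<alpha>)" using pos by (simp add: t_def)
      ultimately show ?thesis by (simp add: algebra_simps)
    qed
    have "\<exists>B. B0 \<le> B \<and> B \<le> \<gamma> \<and> t B = max (\<alpha> + \<beta> + \<gamma> - 2) (h7_value \<alpha> \<beta> \<gamma>)"
    proof (cases "\<alpha> + \<beta> + \<gamma> - 2 \<le> h7_value \<alpha> \<beta> \<gamma>")
      case True
      then show ?thesis using t0 B0(2) by (intro exI[of _ B0]) (simp add: max_def)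
    next
      case c: False
      have "continuous_on {B0..\<gamma>} t" unfolding t_def using B0(1) by (intro continuous_intros) auto
      then have "\<exists>B. B0 \<le> B \<and> B \<le> \<gamma> \<and> t B = \<alpha> + \<beta> + \<gamma> - 2"
        using IVT'[of t B0 "\<alpha> + \<beta> + \<gamma> - 2" \<gamma>] t0 t1 c B0(2) by auto
      then show ?thesis using c by (simp add: max_def)
    qed
    then obtain B where B: "B0 \<le> B" "B \<le> \<gamma>" "t B = max (\<alpha> + \<beta> + \<gamma> - 2) (h7_value \<alpha> \<beta> \<gamma>)" by blast
    define C where "C = (1 - \<alpha>) / B"
    have Bpos: "0 < B" using B B0 by simp
    have BC: "B * C = 1 - \<alpha>" "0 \<le> C" using Bpos \<alpha>1 by (auto simp: C_def)
    have "1 - \<alpha> \<le> \<beta> * B" using B0(3) B(1) pos by (smt (verit) mult_left_mono)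
    then have C\<beta>: "C \<le> \<beta>" using Bpos by (simp add: C_def field_simps)
    have C1: "C < 1"
    proof (rule ccontr)
      assume "\<not> C < 1"
      then have "\<beta> = 1" "C = 1" using C\<beta> b by auto
      then have "B = 1 - \<alpha>" using BC by simp
      moreover have "B0 * B0 = \<gamma> * (1 - \<alpha>)" using pos \<alpha>1 \<open>\<beta> = 1\<close> by (simp add: B0_def)
      moreover have "B0 * B0 \<le> B * B" using B(1) B0(1) by (intro mult_mono) auto
      ultimately have "\<gamma> * (1 - \<alpha>) \<le> (1 - \<alpha>) * (1 - \<alpha>)" by simp
      then have "\<gamma> \<le> 1 - \<alpha>" using \<alpha>1 by (simp add: mult_le_cancel_right)
      then show False using r \<open>\<beta> = 1\<close> by simp
    qed
    \<comment> \<open>\<open>u2'\<close> and, below, \<open>u0'\<close> are the sums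
      \<open>u1 + u2\<close> and \<open>u0 + u1\<close> demanded by the densities
      \<open>\<beta>\<close> and \<open>\<gamma>\<close>.\<close>
    define u2' where "u2' = (1 - \<beta>) / (1 - C)"
    have u2': "u2' * (1 - C) = 1 - \<beta>" "0 \<le> u2'" "u2' \<le> 1" using C1 b C\<beta> by (auto simp: u2'_def field_simps)
    have tB: "t B = \<beta> * B + \<gamma> * C - 2 * (1 - \<alpha>)" by (simp add: t_def C_def)
    have "\<exists>x\<in>h9_weights \<alpha> \<beta> \<gamma>. h9_density x = t B"
    proof (cases "B = 1")
      case True
      show ?thesis unfolding tB
        by (rule h7_weights[of "1 - u2'" 0 u2']) (use u2' BC C1 True B b in auto)
    next
      case B1: False
      then have "B < 1" using B b by simp
      define u0' where "u0' = (1 - \<gamma>) / (1 - B)"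
      have u0': "u0' * (1 - B) = 1 - \<gamma>" "0 \<le> u0'" "u0' \<le> 1" using \<open>B < 1\<close> b B(2) by (auto simp: u0'_def field_simps)
      \<comment> \<open>The weight left for \<open>a3\<close> is \<open>u0' + u2' - 1\<close>. Its
        nonnegativity is exactly the linear lower bound on \<open>t B\<close>.\<close>
      have "1 \<le> u0' + u2'"
      proof -
        have "\<alpha> + \<beta> + \<gamma> - 2 \<le> \<beta> * B + \<gamma> * C - 2 * (1 - \<alpha>)" using B(3) tB by simp
        then have "(1 - B) * (1 - C) \<le> (1 - \<gamma>) * (1 - C) + (1 - \<beta>) * (1 - B)"
          using BC(1) by (simp add: algebra_simps)
        also have "\<dots> = (u0' + u2') * ((1 - B) * (1 - C))" unfolding u0'(1)[symmetric] u2'(1)[symmetric] by (simp add: algebra_simps)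
        finally show ?thesis using \<open>B < 1\<close> C1 by (simp add: mult_le_cancel_right1 not_less)
      qed
      then show ?thesis unfolding tB
        by (intro h7_weights[of "1 - u2'" "u0' + u2' - 1" "1 - u0'"]) (use u2' u0' BC C1 B b Bpos in auto)
    qed
    then show ?thesis using B(3) by simp
  qed
qed

lemma h9_attains_lower_bound:
  assumes "(\<alpha>, \<beta>, \<gamma>) \<in> R"
  shows "\<exists>x\<in>h9_weights \<alpha> \<beta> \<gamma>. h9_density x = max (\<alpha> + \<beta> + \<gamma> - 2) (h7_min \<alpha> \<beta> \<gamma>)"
proof -
  note R2 = R_rotate[OF assms]
  note R3 = R_rotate[OF R2]
  obtain x where x: "x \<in> h9_weights \<alpha> \<beta> \<gamma>" "h9_density x = max (\<alpha> + \<beta> + \<gamma> - 2) (h7_value \<alpha> \<beta> \<gamma>)"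
    using h9_attains[OF assms] by blast
  obtain y where y: "y \<in> h9_weights \<alpha> \<beta> \<gamma>" "h9_density y = max (\<alpha> + \<beta> + \<gamma> - 2) (h7_value \<beta> \<gamma> \<alpha>)"
  proof -
    obtain u v w where uvw: "(u, v, w) \<in> h9_weights \<beta> \<gamma> \<alpha>" "h9_density (u, v, w) = max (\<beta> + \<gamma> + \<alpha> - 2) (h7_value \<beta> \<gamma> \<alpha>)"
      using h9_attains[OF R2] by (auto simp: Bex_def)
    show thesis
      using that[OF h9_weights_rotate[OF h9_weights_rotate[OF uvw(1)]]] uvw(2)
      by (simp add: h9_density_rotate[of w u v] h9_density_rotate[of v w u] add.commute add.left_commute)
  qed
  obtain z where z: "z \<in> h9_weights \<alpha> \<beta> \<gamma>" "h9_density z = max (\<alpha> + \<beta> + \<gamma> - 2) (h7_value \<gamma> \<alpha> \<beta>)"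
  proof -
    obtain u v w where uvw: "(u, v, w) \<in> h9_weights \<gamma> \<alpha> \<beta>" "h9_density (u, v, w) = max (\<gamma> + \<alpha> + \<beta> - 2) (h7_value \<gamma> \<alpha> \<beta>)"
      using h9_attains[OF R3] by (auto simp: Bex_def)
    show thesis
      using that[OF h9_weights_rotate[OF uvw(1)]] uvw(2) by (simp add: h9_density_rotate[of v w u] add.commute add.left_commute)
  qed
  have "h7_min \<alpha> \<beta> \<gamma> \<in> {h7_value \<alpha> \<beta> \<gamma>, h7_value \<beta> \<gamma> \<alpha>, h7_value \<gamma> \<alpha> \<beta>}"
    unfolding h7_min_def min_def by simp
  then show ?thesis
  proof (elim insertE emptyE)
    assume "h7_min \<alpha> \<beta> \<gamma> = h7_value \<alpha> \<beta> \<gamma>" then show ?thesis using x by (intro bexI[of _ x]) simp_all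
  next
    assume "h7_min \<alpha> \<beta> \<gamma> = h7_value \<beta> \<gamma> \<alpha>" then show ?thesis using y by (intro bexI[of _ y]) simp_all
  next
    assume "h7_min \<alpha> \<beta> \<gamma> = h7_value \<gamma> \<alpha> \<beta>" then show ?thesis using z by (intro bexI[of _ z]) simp_all
  qed
qed

section \<open>Staircases\<close>

definition staircase :: "(nat \<Rightarrow> nat \<Rightarrow> real) \<Rightarrow> bool" where
  "staircase f \<longleftrightarrow> (\<forall>i<3. \<forall>j<3. f i j = 0 \<or> f i j = 1) \<and>
     (\<forall>i<3. \<forall>j<3. \<forall>i'<3. \<forall>j'<3. i \<le> i' \<longrightarrow> j' \<le> j \<longrightarrow> f i j \<le> f i' j')"

text \<open>Each row is an initial segment, and the lengths do not decrease. Distinct rows have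
  distinct lengths, and distinct columns require the lengths 1 and 2 to occur. So the lengths are 1,
  2, 3 or 0, 1, 2.\<close>

lemma staircase_cases:
  assumes "staircase f"
  shows "(\<forall>j<3. f 0 j = f 1 j) \<or> (\<forall>j<3. f 1 j = f 2 j) \<or> (\<forall>i<3. f i 0 = f i 1) \<or> (\<forall>i<3. f i 1 = f i 2) \<or>
    (\<forall>i<3. \<forall>j<3. f i j = of_bool (j \<le> i)) \<or> (\<forall>i<3. \<forall>j<3. f i j = of_bool (j < i))"
proof -
  define b where "b i j \<longleftrightarrow> f i j = 1" for i j
  have f: "f i j = of_bool (b i j)" if "i < 3" "j < 3" for i j using assms that by (auto simp: staircase_def b_def)
  have mono: "b i' j'" if "b i j" "i \<le> i'" "j' \<le> j" "i' < 3" "j < 3" for i j i' j'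
  proof -
    have "f i j \<le> f i' j'" using assms that unfolding staircase_def by auto
    then show ?thesis using that f[of i j] f[of i' j'] by (auto simp: of_bool_def split: if_splits)
  qed
  have col: "b 0 j \<longrightarrow> b 1 j" "b 1 j \<longrightarrow> b 2 j" if "j < 3" for j using mono[of 0 j 1 j] mono[of 1 j 2 j] that by auto
  have row: "b i 2 \<longrightarrow> b i 1" "b i 1 \<longrightarrow> b i 0" if "i < 3" for i using mono[of i 2 i 1] mono[of i 1 i 0] that by auto
  show ?thesis
    using col[of 0] col[of 1] col[of 2] row[of 0] row[of 1] row[of 2] unfolding all_less_3
    by (simp add: f del: One_nat_def) blast
qed

text \<open>The last three hypotheses say that C acts like two vertices with fractional adjacencies,
  for single edges and for pairs of edges at once.\<close>

lemma tri3_reduction_to_two: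
  fixes W1 W2 :: real
  assumes uv: "weights3 u" "weights3 v" and f: "\<forall>i<3. \<forall>j<3. 0 \<le> f i j \<and> f i j \<le> 1"
    and W: "0 \<le> W1" "0 \<le> W2" "W1 + W2 = 1"
    and h: "\<forall>i<3. 0 \<le> h1 i \<and> h1 i \<le> h2 i \<and> h2 i \<le> 1"
    and g: "\<forall>j<3. 0 \<le> g2 j \<and> g2 j \<le> g1 j \<and> g1 j \<le> 1"
    and eg: "\<forall>j<3. (\<Sum>k<3. w k * g j k) = W1 * g1 j + W2 * g2 j"
    and eh: "\<forall>i<3. (\<Sum>k<3. w k * h k i) = W1 * h1 i + W2 * h2 i"
    and egh: "\<forall>i<3. \<forall>j<3. (\<Sum>k<3. w k * (g j k * h k i)) = W1 * h1 i * g1 j + W2 * h2 i * g2 j"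
  shows "h7_min (dens3 v w g) (dens3 w u h) (dens3 u v f) \<le> tri3 u v w f g h"
proof -
  have "dens3 v w g = (\<Sum>j<3. v j * (\<Sum>k<3. w k * g j k))"
    unfolding dens3_def sum_lessThan_3 by (simp add: algebra_simps)
  also have "\<dots> = (\<Sum>j<3. v j * (W1 * g1 j + W2 * g2 j))" using eg by (intro sum.cong) auto
  finally have \<alpha>: "dens3 v w g = (\<Sum>j<3. v j * (W1 * g1 j + W2 * g2 j))" .
  have "dens3 w u h = (\<Sum>i<3. u i * (\<Sum>k<3. w k * h k i))"
    unfolding dens3_def sum_lessThan_3 by (simp add: algebra_simps)
  also have "\<dots> = (\<Sum>i<3. u i * (W1 * h1 i + W2 * h2 i))" using eh by (intro sum.cong) auto
  finally have \<beta>: "dens3 w u h = (\<Sum>i<3. u i * (W1 * h1 i + W2 * h2 i))" .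
  have "tri3 u v w f g h = (\<Sum>i<3. \<Sum>j<3. u i * v j * f i j * (\<Sum>k<3. w k * (g j k * h k i)))"
    unfolding tri3_def sum_lessThan_3 by (simp add: algebra_simps)
  also have "\<dots> = (\<Sum>i<3. \<Sum>j<3. u i * v j * f i j * (W1 * h1 i * g1 j + W2 * h2 i * g2 j))"
    using egh by (intro sum.cong refl) simp
  finally have t: "tri3 u v w f g h = (\<Sum>i<3. \<Sum>j<3. u i * v j * f i j * (W1 * h1 i * g1 j + W2 * h2 i * g2 j))" .
  have \<gamma>: "dens3 u v f = (\<Sum>i<3. \<Sum>j<3. u i * v j * f i j)" by (simp only: dens3_def)
  have u: "\<And>i. i \<in> {..<3} \<Longrightarrow> 0 \<le> u i" "(\<Sum>i<3. u i) = 1" and v: "\<And>i. i \<in> {..<3} \<Longrightarrow> 0 \<le> v i" "(\<Sum>i<3. v i) = 1"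
    using uv by (auto simp: weights3_def)
  have h': "\<And>i. i \<in> {..<3} \<Longrightarrow> 0 \<le> h1 i \<and> h1 i \<le> h2 i \<and> h2 i \<le> 1" using h by blast
  have g': "\<And>i. i \<in> {..<3} \<Longrightarrow> 0 \<le> g2 i \<and> g2 i \<le> g1 i \<and> g1 i \<le> 1" using g by blast
  have f': "\<And>i j. i \<in> {..<3} \<Longrightarrow> j \<in> {..<3} \<Longrightarrow> 0 \<le> f i j \<and> f i j \<le> 1" using f by blast
  show ?thesis unfolding t
    by (rule two_vertex_class_bound[OF _ _ u v h' g' f' W \<alpha> \<beta> \<gamma>]) auto
qed

lemma split_weight:
  fixes a b :: real
  assumes "0 \<le> a" "0 \<le> b"
  obtains \<theta> where "0 \<le> \<theta>" "\<theta> \<le> 1" "a = \<theta> * (a + b)" "b = (1 - \<theta>) * (a + b)"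
proof (cases "a + b = 0")
  case True
  then show thesis using assms by (intro that[of 0]) auto
next
  case False
  then have "a + b > 0" using assms by simp
  then show thesis using assms by (intro that[of "a / (a + b)"]) (auto simp: field_simps)
qed

text \<open>Two vertices of C with the same neighbours in B merge into one whose adjacency to A is
  the weighted average: the common factor makes products of adjacencies average correctly as well.
  The same holds with A and B exchanged, and a vertex of weight 0 is simply dropped. Averages of
  consecutive rows or columns stay between them, so the nesting survives.\<close>

lemma redundant_vertex_bound:
  assumes w: "weights3 u" "weights3 v" "weights3 w" and s: "staircase f" "staircase g" "staircase h"
    and eq: "(\<forall>j<3. g j 0 = g j 1) \<or> (\<forall>j<3. g j 1 = g j 2) \<or> (\<forall>i<3. h 0 i = h 1 i) \<or> (\<forall>i<3. h 1 i = h 2 i) \<or>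
      w 0 = 0 \<or> w 1 = 0 \<or> w 2 = 0"
  shows "h7_min (dens3 v w g) (dens3 w u h) (dens3 u v f) \<le> tri3 u v w f g h"
proof -
  have f: "\<forall>i<3. \<forall>j<3. 0 \<le> f i j \<and> f i j \<le> 1" using s(1) unfolding staircase_def by force
  have g: "0 \<le> g j k" "g j k \<le> 1" if "j < 3" "k < 3" for j k using s(2) that unfolding staircase_def by force+
  have h: "0 \<le> h k i" "h k i \<le> 1" if "k < 3" "i < 3" for k i using s(3) that unfolding staircase_def by force+
  have gm: "g j 1 \<le> g j 0" "g j 2 \<le> g j 1" "g j 2 \<le> g j 0" if "j < 3" for j using s(2) that unfolding staircase_def by auto
  have hm: "h 0 i \<le> h 1 i" "h 1 i \<le> h 2 i" "h 0 i \<le> h 2 i" if "i < 3" for i using s(3) that unfolding staircase_def by auto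
  have w0: "0 \<le> w 0" "0 \<le> w 1" "0 \<le> w 2" and w1: "w 0 + w 1 + w 2 = 1"
    using w(3) unfolding weights3_def sum_lessThan_3 all_less_3 by auto
  obtain \<theta> where \<theta>: "0 \<le> \<theta>" "\<theta> \<le> 1" "w 0 = \<theta> * (w 0 + w 1)" "w 1 = (1 - \<theta>) * (w 0 + w 1)"
    using split_weight[OF w0(1,2)] .
  obtain \<theta>' where \<theta>': "0 \<le> \<theta>'" "\<theta>' \<le> 1" "w 1 = \<theta>' * (w 1 + w 2)" "w 2 = (1 - \<theta>') * (w 1 + w 2)"
    using split_weight[OF w0(2,3)] .
  have between: "a \<le> t * a + (1 - t) * b \<and> t * a + (1 - t) * b \<le> b" if "0 \<le> t" "t \<le> 1" "a \<le> b" for t a b :: real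
  proof -
    have "0 \<le> (1 - t) * (b - a)" "0 \<le> t * (b - a)" using that by auto
    then show ?thesis by (simp add: algebra_simps)
  qed
  have between': "a \<le> t * b + (1 - t) * a \<and> t * b + (1 - t) * a \<le> b" if "0 \<le> t" "t \<le> 1" "a \<le> b" for t a b :: real
    using between[of "1 - t" a b] that by simp
  have avg: "(w 0 + w 1) * (\<theta> * a + (1 - \<theta>) * b) = w 0 * a + w 1 * b" for a b
  proof -
    have "(w 0 + w 1) * (\<theta> * a + (1 - \<theta>) * b) = (\<theta> * (w 0 + w 1)) * a + ((1 - \<theta>) * (w 0 + w 1)) * b"
      by (simp add: algebra_simps)
    then show ?thesis using \<theta>(3,4) by simp
  qed
  have avg': "(w 1 + w 2) * (\<theta>' * a + (1 - \<theta>') * b) = w 1 * a + w 2 * b" for a b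
  proof -
    have "(w 1 + w 2) * (\<theta>' * a + (1 - \<theta>') * b) = (\<theta>' * (w 1 + w 2)) * a + ((1 - \<theta>') * (w 1 + w 2)) * b"
      by (simp add: algebra_simps)
    then show ?thesis using \<theta>'(3,4) by simp
  qed
  have avgr: "(w 0 + w 1) * x * (\<theta> * a + (1 - \<theta>) * b) = x * (w 0 * a + w 1 * b)" for x a b
    unfolding avg[symmetric] by (simp only: mult.commute mult.left_commute mult.assoc)
  have avgr': "(w 1 + w 2) * x * (\<theta>' * a + (1 - \<theta>') * b) = x * (w 1 * a + w 2 * b)" for x a b
    unfolding avg'[symmetric] by (simp only: mult.commute mult.left_commute mult.assoc)
  note red = tri3_reduction_to_two[OF w(1,2) f]
  note avgs = sum_lessThan_3 avg avg' avgr avgr'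
  from eq show ?thesis
  proof (elim disjE)
    assume e: "\<forall>j<3. g j 0 = g j 1"
    show ?thesis
    proof (rule red[where ?W1.0 = "w 0 + w 1" and ?W2.0 = "w 2" and ?h1.0 = "\<lambda>i. \<theta> * h 0 i + (1 - \<theta>) * h 1 i" and ?h2.0 = "h 2" and ?g1.0 = "\<lambda>j. g j 0" and ?g2.0 = "\<lambda>j. g j 2"])
      show "\<forall>i<3. 0 \<le> (\<lambda>i. \<theta> * h 0 i + (1 - \<theta>) * h 1 i) i \<and> (\<lambda>i. \<theta> * h 0 i + (1 - \<theta>) * h 1 i) i \<le> (h 2) i \<and> (h 2) i \<le> 1"
      proof (intro allI impI)
        fix i :: nat assume i: "i < 3"
        show "0 \<le> (\<lambda>i. \<theta> * h 0 i + (1 - \<theta>) * h 1 i) i \<and> (\<lambda>i. \<theta> * h 0 i + (1 - \<theta>) * h 1 i) i \<le> (h 2) i \<and> (h 2) i \<le> 1"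
          using between[OF \<theta>(1,2) hm(1)[OF i]] between[OF \<theta>'(1,2) hm(2)[OF i]] hm[OF i] h[of 0 i] h[of 1 i] h[of 2 i] i by auto
      qed
      show "\<forall>j<3. 0 \<le> (\<lambda>j. g j 2) j \<and> (\<lambda>j. g j 2) j \<le> (\<lambda>j. g j 0) j \<and> (\<lambda>j. g j 0) j \<le> 1"
      proof (intro allI impI)
        fix j :: nat assume j: "j < 3"
        show "0 \<le> (\<lambda>j. g j 2) j \<and> (\<lambda>j. g j 2) j \<le> (\<lambda>j. g j 0) j \<and> (\<lambda>j. g j 0) j \<le> 1"
          using between'[OF \<theta>(1,2) gm(1)[OF j]] between'[OF \<theta>'(1,2) gm(2)[OF j]] gm[OF j] g[of j 0] g[of j 1] g[of j 2] j by auto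
      qed
    qed (use w0 w1 in simp, use w0 w1 in simp, use w1 e in simp, unfold avgs, use e in \<open>simp_all add: algebra_simps\<close>)
  next
    assume e: "\<forall>j<3. g j 1 = g j 2"
    show ?thesis
    proof (rule red[where ?W1.0 = "w 0" and ?W2.0 = "w 1 + w 2" and ?h1.0 = "h 0" and ?h2.0 = "\<lambda>i. \<theta>' * h 1 i + (1 - \<theta>') * h 2 i" and ?g1.0 = "\<lambda>j. g j 0" and ?g2.0 = "\<lambda>j. g j 1"])
      show "\<forall>i<3. 0 \<le> (h 0) i \<and> (h 0) i \<le> (\<lambda>i. \<theta>' * h 1 i + (1 - \<theta>') * h 2 i) i \<and> (\<lambda>i. \<theta>' * h 1 i + (1 - \<theta>') * h 2 i) i \<le> 1"
      proof (intro allI impI)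
        fix i :: nat assume i: "i < 3"
        show "0 \<le> (h 0) i \<and> (h 0) i \<le> (\<lambda>i. \<theta>' * h 1 i + (1 - \<theta>') * h 2 i) i \<and> (\<lambda>i. \<theta>' * h 1 i + (1 - \<theta>') * h 2 i) i \<le> 1"
          using between[OF \<theta>(1,2) hm(1)[OF i]] between[OF \<theta>'(1,2) hm(2)[OF i]] hm[OF i] h[of 0 i] h[of 1 i] h[of 2 i] i by auto
      qed
      show "\<forall>j<3. 0 \<le> (\<lambda>j. g j 1) j \<and> (\<lambda>j. g j 1) j \<le> (\<lambda>j. g j 0) j \<and> (\<lambda>j. g j 0) j \<le> 1"
      proof (intro allI impI)
        fix j :: nat assume j: "j < 3"
        show "0 \<le> (\<lambda>j. g j 1) j \<and> (\<lambda>j. g j 1) j \<le> (\<lambda>j. g j 0) j \<and> (\<lambda>j. g j 0) j \<le> 1"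
          using between'[OF \<theta>(1,2) gm(1)[OF j]] between'[OF \<theta>'(1,2) gm(2)[OF j]] gm[OF j] g[of j 0] g[of j 1] g[of j 2] j by auto
      qed
    qed (use w0 w1 in simp, use w0 w1 in simp, use w1 e in simp, unfold avgs, use e in \<open>simp_all add: algebra_simps\<close>)
  next
    assume e: "\<forall>i<3. h 0 i = h 1 i"
    show ?thesis
    proof (rule red[where ?W1.0 = "w 0 + w 1" and ?W2.0 = "w 2" and ?h1.0 = "h 0" and ?h2.0 = "h 2" and ?g1.0 = "\<lambda>j. \<theta> * g j 0 + (1 - \<theta>) * g j 1" and ?g2.0 = "\<lambda>j. g j 2"])
      show "\<forall>i<3. 0 \<le> (h 0) i \<and> (h 0) i \<le> (h 2) i \<and> (h 2) i \<le> 1"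
      proof (intro allI impI)
        fix i :: nat assume i: "i < 3"
        show "0 \<le> (h 0) i \<and> (h 0) i \<le> (h 2) i \<and> (h 2) i \<le> 1"
          using between[OF \<theta>(1,2) hm(1)[OF i]] between[OF \<theta>'(1,2) hm(2)[OF i]] hm[OF i] h[of 0 i] h[of 1 i] h[of 2 i] i by auto
      qed
      show "\<forall>j<3. 0 \<le> (\<lambda>j. g j 2) j \<and> (\<lambda>j. g j 2) j \<le> (\<lambda>j. \<theta> * g j 0 + (1 - \<theta>) * g j 1) j \<and> (\<lambda>j. \<theta> * g j 0 + (1 - \<theta>) * g j 1) j \<le> 1"
      proof (intro allI impI)
        fix j :: nat assume j: "j < 3"
        show "0 \<le> (\<lambda>j. g j 2) j \<and> (\<lambda>j. g j 2) j \<le> (\<lambda>j. \<theta> * g j 0 + (1 - \<theta>) * g j 1) j \<and> (\<lambda>j. \<theta> * g j 0 + (1 - \<theta>) * g j 1) j \<le> 1"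
          using between'[OF \<theta>(1,2) gm(1)[OF j]] between'[OF \<theta>'(1,2) gm(2)[OF j]] gm[OF j] g[of j 0] g[of j 1] g[of j 2] j by auto
      qed
    qed (use w0 w1 in simp, use w0 w1 in simp, use w1 e in simp, unfold avgs, use e in \<open>simp_all add: algebra_simps\<close>)
  next
    assume e: "\<forall>i<3. h 1 i = h 2 i"
    show ?thesis
    proof (rule red[where ?W1.0 = "w 0" and ?W2.0 = "w 1 + w 2" and ?h1.0 = "h 0" and ?h2.0 = "h 1" and ?g1.0 = "\<lambda>j. g j 0" and ?g2.0 = "\<lambda>j. \<theta>' * g j 1 + (1 - \<theta>') * g j 2"])
      show "\<forall>i<3. 0 \<le> (h 0) i \<and> (h 0) i \<le> (h 1) i \<and> (h 1) i \<le> 1"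
      proof (intro allI impI)
        fix i :: nat assume i: "i < 3"
        show "0 \<le> (h 0) i \<and> (h 0) i \<le> (h 1) i \<and> (h 1) i \<le> 1"
          using between[OF \<theta>(1,2) hm(1)[OF i]] between[OF \<theta>'(1,2) hm(2)[OF i]] hm[OF i] h[of 0 i] h[of 1 i] h[of 2 i] i by auto
      qed
      show "\<forall>j<3. 0 \<le> (\<lambda>j. \<theta>' * g j 1 + (1 - \<theta>') * g j 2) j \<and> (\<lambda>j. \<theta>' * g j 1 + (1 - \<theta>') * g j 2) j \<le> (\<lambda>j. g j 0) j \<and> (\<lambda>j. g j 0) j \<le> 1"
      proof (intro allI impI)
        fix j :: nat assume j: "j < 3"
        show "0 \<le> (\<lambda>j. \<theta>' * g j 1 + (1 - \<theta>') * g j 2) j \<and> (\<lambda>j. \<theta>' * g j 1 + (1 - \<theta>') * g j 2) j \<le> (\<lambda>j. g j 0) j \<and> (\<lambda>j. g j 0) j \<le> 1"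
          using between'[OF \<theta>(1,2) gm(1)[OF j]] between'[OF \<theta>'(1,2) gm(2)[OF j]] gm[OF j] g[of j 0] g[of j 1] g[of j 2] j by auto
      qed
    qed (use w0 w1 in simp, use w0 w1 in simp, use w1 e in simp, unfold avgs, use e in \<open>simp_all add: algebra_simps\<close>)
  next
    assume e: "w 0 = 0"
    show ?thesis
    proof (rule red[where ?W1.0 = "w 1" and ?W2.0 = "w 2" and ?h1.0 = "h 1" and ?h2.0 = "h 2" and ?g1.0 = "\<lambda>j. g j 1" and ?g2.0 = "\<lambda>j. g j 2"])
      show "\<forall>i<3. 0 \<le> (h 1) i \<and> (h 1) i \<le> (h 2) i \<and> (h 2) i \<le> 1"
      proof (intro allI impI)
        fix i :: nat assume i: "i < 3"
        show "0 \<le> (h 1) i \<and> (h 1) i \<le> (h 2) i \<and> (h 2) i \<le> 1"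
          using between[OF \<theta>(1,2) hm(1)[OF i]] between[OF \<theta>'(1,2) hm(2)[OF i]] hm[OF i] h[of 0 i] h[of 1 i] h[of 2 i] i by auto
      qed
      show "\<forall>j<3. 0 \<le> (\<lambda>j. g j 2) j \<and> (\<lambda>j. g j 2) j \<le> (\<lambda>j. g j 1) j \<and> (\<lambda>j. g j 1) j \<le> 1"
      proof (intro allI impI)
        fix j :: nat assume j: "j < 3"
        show "0 \<le> (\<lambda>j. g j 2) j \<and> (\<lambda>j. g j 2) j \<le> (\<lambda>j. g j 1) j \<and> (\<lambda>j. g j 1) j \<le> 1"
          using between'[OF \<theta>(1,2) gm(1)[OF j]] between'[OF \<theta>'(1,2) gm(2)[OF j]] gm[OF j] g[of j 0] g[of j 1] g[of j 2] j by auto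
      qed
    qed (use w0 w1 in simp, use w0 w1 in simp, use w1 e in simp, unfold avgs, use e in \<open>simp_all add: algebra_simps\<close>)
  next
    assume e: "w 1 = 0"
    show ?thesis
    proof (rule red[where ?W1.0 = "w 0" and ?W2.0 = "w 2" and ?h1.0 = "h 0" and ?h2.0 = "h 2" and ?g1.0 = "\<lambda>j. g j 0" and ?g2.0 = "\<lambda>j. g j 2"])
      show "\<forall>i<3. 0 \<le> (h 0) i \<and> (h 0) i \<le> (h 2) i \<and> (h 2) i \<le> 1"
      proof (intro allI impI)
        fix i :: nat assume i: "i < 3"
        show "0 \<le> (h 0) i \<and> (h 0) i \<le> (h 2) i \<and> (h 2) i \<le> 1"
          using between[OF \<theta>(1,2) hm(1)[OF i]] between[OF \<theta>'(1,2) hm(2)[OF i]] hm[OF i] h[of 0 i] h[of 1 i] h[of 2 i] i by auto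
      qed
      show "\<forall>j<3. 0 \<le> (\<lambda>j. g j 2) j \<and> (\<lambda>j. g j 2) j \<le> (\<lambda>j. g j 0) j \<and> (\<lambda>j. g j 0) j \<le> 1"
      proof (intro allI impI)
        fix j :: nat assume j: "j < 3"
        show "0 \<le> (\<lambda>j. g j 2) j \<and> (\<lambda>j. g j 2) j \<le> (\<lambda>j. g j 0) j \<and> (\<lambda>j. g j 0) j \<le> 1"
          using between'[OF \<theta>(1,2) gm(1)[OF j]] between'[OF \<theta>'(1,2) gm(2)[OF j]] gm[OF j] g[of j 0] g[of j 1] g[of j 2] j by auto
      qed
    qed (use w0 w1 in simp, use w0 w1 in simp, use w1 e in simp, unfold avgs, use e in \<open>simp_all add: algebra_simps\<close>)
  next
    assume e: "w 2 = 0"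
    show ?thesis
    proof (rule red[where ?W1.0 = "w 0" and ?W2.0 = "w 1" and ?h1.0 = "h 0" and ?h2.0 = "h 1" and ?g1.0 = "\<lambda>j. g j 0" and ?g2.0 = "\<lambda>j. g j 1"])
      show "\<forall>i<3. 0 \<le> (h 0) i \<and> (h 0) i \<le> (h 1) i \<and> (h 1) i \<le> 1"
      proof (intro allI impI)
        fix i :: nat assume i: "i < 3"
        show "0 \<le> (h 0) i \<and> (h 0) i \<le> (h 1) i \<and> (h 1) i \<le> 1"
          using between[OF \<theta>(1,2) hm(1)[OF i]] between[OF \<theta>'(1,2) hm(2)[OF i]] hm[OF i] h[of 0 i] h[of 1 i] h[of 2 i] i by auto
      qed
      show "\<forall>j<3. 0 \<le> (\<lambda>j. g j 1) j \<and> (\<lambda>j. g j 1) j \<le> (\<lambda>j. g j 0) j \<and> (\<lambda>j. g j 0) j \<le> 1"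
      proof (intro allI impI)
        fix j :: nat assume j: "j < 3"
        show "0 \<le> (\<lambda>j. g j 1) j \<and> (\<lambda>j. g j 1) j \<le> (\<lambda>j. g j 0) j \<and> (\<lambda>j. g j 0) j \<le> 1"
          using between'[OF \<theta>(1,2) gm(1)[OF j]] between'[OF \<theta>'(1,2) gm(2)[OF j]] gm[OF j] g[of j 0] g[of j 1] g[of j 2] j by auto
      qed
    qed (use w0 w1 in simp, use w0 w1 in simp, use w1 e in simp, unfold avgs, use e in \<open>simp_all add: algebra_simps\<close>)
  qed
qed

lemma staircase_01: "staircase f \<Longrightarrow> i < 3 \<Longrightarrow> j < 3 \<Longrightarrow> 0 \<le> f i j \<and> f i j \<le> 1"
  unfolding staircase_def by force

text \<open>For \<open>x\<close>, \<open>y\<close>, \<open>z\<close> in {0, 1} one has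
  \<open>x + y + z - 2 \<le> x * y * z\<close>; averaging this over all triples of vertices gives
  the bound.\<close>

lemma tri3_ge:
  assumes w: "weights3 u" "weights3 v" "weights3 w" and s: "staircase f" "staircase g" "staircase h"
  shows "dens3 v w g + dens3 w u h + dens3 u v f - 2 \<le> tri3 u v w f g h"
proof -
  define S where "S \<phi> = (\<Sum>i<3. \<Sum>j<3. \<Sum>k<3. u i * v j * w k * \<phi> i j k)" for \<phi> :: "nat \<Rightarrow> nat \<Rightarrow> nat \<Rightarrow> real"
  have one: "u 0 + u 1 + u 2 = 1" "v 0 + v 1 + v 2 = 1" "w 0 + w 1 + w 2 = 1"
    using w by (auto simp: weights3_def sum_lessThan_3)
  have lin: "S (\<lambda>i j k. \<phi> i j k + \<psi> i j k) = S \<phi> + S \<psi>" "S (\<lambda>i j k. \<phi> i j k - \<psi> i j k) = S \<phi> - S \<psi>" for \<phi> \<psi>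
    unfolding S_def by (simp_all add: distrib_left right_diff_distrib sum.distrib sum_subtractf)
  have "S (\<lambda>i j k. f i j) = dens3 u v f * (w 0 + w 1 + w 2)" "S (\<lambda>i j k. g j k) = dens3 v w g * (u 0 + u 1 + u 2)"
    "S (\<lambda>i j k. h k i) = dens3 w u h * (v 0 + v 1 + v 2)"
    "S (\<lambda>i j k. 2) = 2 * ((u 0 + u 1 + u 2) * (v 0 + v 1 + v 2) * (w 0 + w 1 + w 2))"
    unfolding S_def dens3_def sum_lessThan_3 by (simp_all add: algebra_simps)
  then have "dens3 v w g + dens3 w u h + dens3 u v f - 2 = S (\<lambda>i j k. g j k + h k i + f i j - 2)"
    unfolding lin one by simp
  also have "\<dots> \<le> S (\<lambda>i j k. f i j * g j k * h k i)"
    unfolding S_def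
  proof (intro sum_mono mult_left_mono)
    fix i j k :: nat assume ijk: "i \<in> {..<3}" "j \<in> {..<3}" "k \<in> {..<3}"
    then have "f i j = 0 \<or> f i j = 1" "g j k = 0 \<or> g j k = 1" "h k i = 0 \<or> h k i = 1"
      using s unfolding staircase_def by auto
    then show "g j k + h k i + f i j - 2 \<le> f i j * g j k * h k i" by auto
    show "0 \<le> u i * v j * w k" using ijk w by (simp add: weights3_def)
  qed
  finally show ?thesis unfolding S_def tri3_def .
qed

text \<open>Three weights under two linear conditions leave one free direction; moving along it with
  \<open>\<tau>\<close> not decreasing ends when a weight vanishes.\<close>

lemma weights3_drop_vertex:
  assumes "weights3 u"
  shows "\<exists>u'. weights3 u' \<and> (u' 0 = 0 \<or> u' 1 = 0 \<or> u' 2 = 0) \<and> (\<Sum>i<3. u' i * \<phi> i) = (\<Sum>i<3. u i * \<phi> i) \<and>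
    (\<Sum>i<3. u i * \<tau> i) \<le> (\<Sum>i<3. u' i * \<tau> i)"
proof -
  obtain \<delta> :: "nat \<Rightarrow> real" where \<delta>: "(\<Sum>i<3. \<delta> i) = 0" "(\<Sum>i<3. \<delta> i * \<phi> i) = 0" "\<exists>i\<in>{..<3}. \<delta> i \<noteq> 0"
  \<comment> \<open>The general direction is the cross product of \<open>(1, 1, 1)\<close> and the
    values of \<open>\<phi>\<close> up to sign. It vanishes for constant \<open>\<phi>\<close>,
    hence the separate case.\<close>
  proof (cases "\<phi> 0 = \<phi> 1")
    case True
    then show thesis
      by (intro that[of "\<lambda>i. if i = 0 then 1 else if i = 1 then -1 else 0"]) (auto simp: sum_lessThan_3 intro!: bexI[of _ 0])
  next
    case False
    then show thesis
      by (intro that[of "\<lambda>i. if i = 0 then \<phi> 1 - \<phi> 2 else if i = 1 then \<phi> 2 - \<phi> 0 else \<phi> 0 - \<phi> 1"])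
        (auto simp: sum_lessThan_3 algebra_simps intro!: bexI[of _ 2])
  qed
  have u: "\<forall>i\<in>{..<3}. 0 \<le> u i" "(\<Sum>i<3. u i) = 1" using assms by (auto simp: weights3_def)
  obtain \<theta> s where \<theta>: "\<forall>i\<in>{..<3}. 0 \<le> u i + \<theta> * \<delta> i" "s \<in> {..<3}" "u s + \<theta> * \<delta> s = 0" "\<theta> * - (\<Sum>i<3. \<delta> i * \<tau> i) \<le> 0"
    using move_until_weight_vanishes[OF finite_lessThan u(1) \<delta>(1,3), where c = "- (\<Sum>i<3. \<delta> i * \<tau> i)"]
    by (elim exE conjE bexE) (rule that)
  have sum: "(\<Sum>i<3. (u i + \<theta> * \<delta> i) * \<zeta> i) = (\<Sum>i<3. u i * \<zeta> i) + \<theta> * (\<Sum>i<3. \<delta> i * \<zeta> i)" for \<zeta> :: "nat \<Rightarrow> real"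
    by (simp add: distrib_right sum.distrib sum_distrib_left mult.assoc)
  have s: "s = 0 \<or> s = 1 \<or> s = 2" using \<theta>(2) by auto
  show ?thesis
  proof (intro exI[of _ "\<lambda>i. u i + \<theta> * \<delta> i"] conjI)
    show "weights3 (\<lambda>i. u i + \<theta> * \<delta> i)" using \<theta>(1) u(2) sum[of "\<lambda>_. 1"] \<delta>(1) by (simp add: weights3_def)
    show "u 0 + \<theta> * \<delta> 0 = 0 \<or> u 1 + \<theta> * \<delta> 1 = 0 \<or> u 2 + \<theta> * \<delta> 2 = 0" using s \<theta>(3) by auto
    show "(\<Sum>i<3. (u i + \<theta> * \<delta> i) * \<phi> i) = (\<Sum>i<3. u i * \<phi> i)" using sum[of \<phi>] \<delta>(2) by simp
    show "(\<Sum>i<3. u i * \<tau> i) \<le> (\<Sum>i<3. (u i + \<theta> * \<delta> i) * \<tau> i)" using sum[of \<tau>] \<theta>(4) by simp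
  qed
qed

lemma redundant_vertex_bound_rotated:
  assumes w: "weights3 u" "weights3 v" "weights3 w" and s: "staircase f" "staircase g" "staircase h"
    and eq: "(\<forall>j<3. h j 0 = h j 1) \<or> (\<forall>j<3. h j 1 = h j 2) \<or> (\<forall>i<3. f 0 i = f 1 i) \<or> (\<forall>i<3. f 1 i = f 2 i) \<or>
      u 0 = 0 \<or> u 1 = 0 \<or> u 2 = 0"
  shows "h7_min (dens3 v w g) (dens3 w u h) (dens3 u v f) \<le> tri3 u v w f g h"
  using redundant_vertex_bound[OF w(2,3,1) s(2,3,1) eq] by (simp only: h7_min_rotate tri3_rotate)

text \<open>
  A staircase without repeated rows or columns has its steps on the diagonal or just below it.
  If all three are of the first kind we are in \<open>H9\<close>. Otherwise no triangle is left, whatever the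
  weights, so one vertex may be dropped without lowering a density, contradicting the bound for
  classes of two vertices.
\<close>
lemma staircase_bound:
  assumes w: "weights3 u" "weights3 v" "weights3 w" and s: "staircase f" "staircase g" "staircase h"
    and R: "(dens3 v w g, dens3 w u h, dens3 u v f) \<in> R"
  shows "h7_min (dens3 v w g) (dens3 w u h) (dens3 u v f) \<le> tri3 u v w f g h \<or>
    (\<forall>i<3. \<forall>j<3. f i j = h9_adj i j \<and> g i j = h9_adj i j \<and> h i j = h9_adj i j)"
proof (rule ccontr)
  assume c: "\<not> ?thesis"
  note RC = redundant_vertex_bound[OF w s]
  note RA = redundant_vertex_bound_rotated[OF w s]
  have RB: "h7_min (dens3 v w g) (dens3 w u h) (dens3 u v f) \<le> tri3 u v w f g h"
    if "(\<forall>j<3. f j 0 = f j 1) \<or> (\<forall>j<3. f j 1 = f j 2) \<or> (\<forall>i<3. g 0 i = g 1 i) \<or> (\<forall>i<3. g 1 i = g 2 i)"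
    using redundant_vertex_bound_rotated[OF w(2,3,1) s(2,3,1)] that by (auto simp only: h7_min_rotate tri3_rotate)
  have F: "(\<forall>i<3. \<forall>j<3. f i j = of_bool (j \<le> i)) \<or> (\<forall>i<3. \<forall>j<3. f i j = of_bool (j < i))"
    using staircase_cases[OF s(1)] RA RB c by blast
  have G: "(\<forall>i<3. \<forall>j<3. g i j = of_bool (j \<le> i)) \<or> (\<forall>i<3. \<forall>j<3. g i j = of_bool (j < i))"
    using staircase_cases[OF s(2)] RB RC c by blast
  have H: "(\<forall>i<3. \<forall>j<3. h i j = of_bool (j \<le> i)) \<or> (\<forall>i<3. \<forall>j<3. h i j = of_bool (j < i))"
    using staircase_cases[OF s(3)] RC RA c by blast
  \<comment> \<open>A triangle would give \<open>j \<le> i\<close>, \<open>k \<le> j\<close> and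
    \<open>i \<le> k\<close> with at least one of them strict.\<close>
  have zero: "f i j * g j k * h k i = 0" if "i < 3" "j < 3" "k < 3" for i j k
  proof -
    have "\<not> ((\<forall>i<3. \<forall>j<3. f i j = of_bool (j \<le> i)) \<and> (\<forall>i<3. \<forall>j<3. g i j = of_bool (j \<le> i)) \<and> (\<forall>i<3. \<forall>j<3. h i j = of_bool (j \<le> i)))"
      using c unfolding h9_adj_def by blast
    then have "(\<forall>i<3. \<forall>j<3. f i j = of_bool (j < i)) \<or> (\<forall>i<3. \<forall>j<3. g i j = of_bool (j < i)) \<or> (\<forall>i<3. \<forall>j<3. h i j = of_bool (j < i))"
      using F G H by blast
    then have "f i j = of_bool (j < i) \<or> g j k = of_bool (k < j) \<or> h k i = of_bool (i < k)" using that by blast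
    moreover have "f i j = of_bool (j \<le> i) \<or> f i j = of_bool (j < i)" using F that by blast
    moreover have "g j k = of_bool (k \<le> j) \<or> g j k = of_bool (k < j)" using G that by blast
    moreover have "h k i = of_bool (i \<le> k) \<or> h k i = of_bool (i < k)" using H that by blast
    ultimately show ?thesis by (elim disjE) simp_all
  qed
  \<comment> \<open>The density between B and C does not involve \<open>u\<close>, the one between C
    and A is kept, and the one between A and B can only grow. So the densities stay in
    \<open>R\<close> by \<open>R_up\<close>, where the lower bounds are positive although there is
    no triangle.\<close>
  obtain u' where u': "weights3 u'" "u' 0 = 0 \<or> u' 1 = 0 \<or> u' 2 = 0"
    "(\<Sum>i<3. u' i * (\<Sum>k<3. w k * h k i)) = (\<Sum>i<3. u i * (\<Sum>k<3. w k * h k i))"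
    "(\<Sum>i<3. u i * (\<Sum>j<3. v j * f i j)) \<le> (\<Sum>i<3. u' i * (\<Sum>j<3. v j * f i j))"
    using weights3_drop_vertex[OF w(1), where \<phi> = "\<lambda>i. \<Sum>k<3. w k * h k i" and \<tau> = "\<lambda>i. \<Sum>j<3. v j * f i j"]
    by (elim exE conjE) (rule that)
  have dens: "dens3 w x h = (\<Sum>i<3. x i * (\<Sum>k<3. w k * h k i))" "dens3 x v f = (\<Sum>i<3. x i * (\<Sum>j<3. v j * f i j))" for x
    unfolding dens3_def sum_lessThan_3 by (simp_all add: algebra_simps)
  have le1: "dens3 u' v f \<le> 1"
  proof -
    have "dens3 u' v f \<le> (\<Sum>i<3. \<Sum>j<3. u' i * v j * 1)" unfolding dens3_def
      using u'(1) w(2) staircase_01[OF s(1)] by (intro sum_mono mult_left_mono) (auto simp: weights3_def)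
    also have "\<dots> = (\<Sum>i<3. u' i) * (\<Sum>j<3. v j)" by (simp add: sum_product)
    finally show ?thesis using u'(1) w(2) by (simp add: weights3_def)
  qed
  have "tri3 u' v w f g h = 0" unfolding tri3_def using zero by (intro sum.neutral ballI) simp
  moreover have "h7_min (dens3 v w g) (dens3 w u' h) (dens3 u' v f) \<le> tri3 u' v w f g h"
    using redundant_vertex_bound_rotated[OF u'(1) w(2,3) s] u'(2) by blast
  moreover have "dens3 v w g + dens3 w u' h + dens3 u' v f - 2 \<le> tri3 u' v w f g h"
    by (rule tri3_ge[OF u'(1) w(2,3) s])
  moreover have "(dens3 v w g, dens3 w u' h, dens3 u' v f) \<in> R"
    using R_up[OF R _ le1] u'(3,4) unfolding dens by simp
  ultimately show False using lower_bound_pos by fastforce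
qed

lemma staircase_ge_h9:
  assumes w: "weights3 u" "weights3 v" "weights3 w" and s: "staircase f" "staircase g" "staircase h"
    and dens: "dens3 v w g = \<alpha>" "dens3 w u h = \<beta>" "dens3 u v f = \<gamma>" and R: "(\<alpha>, \<beta>, \<gamma>) \<in> R"
  shows "\<exists>x\<in>h9_weights \<alpha> \<beta> \<gamma>. h9_density x \<le> tri3 u v w f g h"
proof (cases "h7_min \<alpha> \<beta> \<gamma> \<le> tri3 u v w f g h")
  case True
  then have "max (\<alpha> + \<beta> + \<gamma> - 2) (h7_min \<alpha> \<beta> \<gamma>) \<le> tri3 u v w f g h"
    using tri3_ge[OF w s] dens by simp
  then show ?thesis using h9_attains_lower_bound[OF R] by force
next
  case False
  then have eq: "f i j = h9_adj i j" "g i j = h9_adj i j" "h i j = h9_adj i j" if "i < 3" "j < 3" for i j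
    using staircase_bound[OF w s] R that unfolding dens by auto
  have "dens3 v w h9_adj = \<alpha>" "dens3 w u h9_adj = \<beta>" "dens3 u v h9_adj = \<gamma>"
    using eq unfolding dens[symmetric] dens3_def by simp_all
  moreover have "tri3 u v w f g h = tri3 u v w h9_adj h9_adj h9_adj"
    using eq unfolding tri3_def by (intro sum.cong refl) simp
  ultimately show ?thesis using w unfolding tri3_h9 by (intro bexI[of _ "(u, v, w)"]) (auto simp: h9_weights_def)
qed

section \<open>Reduction to staircases\<close>

text \<open>The triangle density in the ideal case that every pair has the least common
  neighbourhood in C that its weights \<open>\<xi> i\<close> and \<open>y j\<close> allow.\<close>

definition overlap3 :: "(nat \<Rightarrow> real) \<Rightarrow> (nat \<Rightarrow> real) \<Rightarrow> (nat \<Rightarrow> nat \<Rightarrow> real) \<Rightarrow> (nat \<Rightarrow> real) \<Rightarrow> (nat \<Rightarrow> real) \<Rightarrow> real" where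
  "overlap3 u v f \<xi> y = (\<Sum>i<3. \<Sum>j<3. u i * v j * (f i j * max 0 (y j - \<xi> i)))"

lemma sum_mult_swap:
  "(\<Sum>j\<in>J. q j * (\<Sum>i\<in>I. p i * z i j)) = (\<Sum>i\<in>I. p i * (\<Sum>j\<in>J. q j * (z i j :: real)))"
  unfolding sum_distrib_left by (subst sum.swap) (simp add: mult.left_commute)

text \<open>The inequality \<open>g + h - 1 \<le> g * h\<close> bounds common neighbourhoods from
  below by \<open>P\<close>. As \<open>P\<close> depends only on \<open>\<xi>\<close> and
  \<open>y\<close>, A can be reduced for fixed B and then B for the new A; afterwards C survives
  only in these numbers.\<close>

lemma reduce_A_B:
  fixes u :: "'a \<Rightarrow> real" and v :: "'b \<Rightarrow> real" and w :: "'c \<Rightarrow> real"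
  assumes fin: "finite A" "finite B" "finite C"
    and u: "\<forall>a\<in>A. 0 \<le> u a" "(\<Sum>a\<in>A. u a) = 1" and v: "\<forall>b\<in>B. 0 \<le> v b" "(\<Sum>b\<in>B. v b) = 1"
    and w: "\<forall>c\<in>C. 0 \<le> w c" "(\<Sum>c\<in>C. w c) = 1"
    and f: "\<forall>a\<in>A. \<forall>b\<in>B. 0 \<le> f a b \<and> f a b \<le> 1" and g: "\<forall>b\<in>B. \<forall>c\<in>C. 0 \<le> g b c \<and> g b c \<le> 1"
    and h: "\<forall>c\<in>C. \<forall>a\<in>A. 0 \<le> h c a \<and> h c a \<le> 1"
  shows "\<exists>u' v' f' \<xi> y. weights3 u' \<and> weights3 v' \<and> (\<forall>i j. 0 \<le> f' i j \<and> f' i j \<le> (1::real)) \<and>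
    (\<forall>i j. i \<le> j \<longrightarrow> \<xi> i \<le> \<xi> j) \<and> (\<forall>i j. i \<le> j \<longrightarrow> y i \<le> y j) \<and>
    (\<forall>i. 0 \<le> \<xi> i \<and> \<xi> i \<le> 1) \<and> (\<forall>i. 0 \<le> y i \<and> y i \<le> 1) \<and>
    (\<Sum>j<3. v' j * y j) = (\<Sum>b\<in>B. \<Sum>c\<in>C. v b * w c * g b c) \<and>
    (\<Sum>i<3. u' i * \<xi> i) = 1 - (\<Sum>c\<in>C. \<Sum>a\<in>A. w c * u a * h c a) \<and>
    dens3 u' v' f' = (\<Sum>a\<in>A. \<Sum>b\<in>B. u a * v b * f a b) \<and>
    overlap3 u' v' f' \<xi> y \<le> (\<Sum>a\<in>A. \<Sum>b\<in>B. \<Sum>c\<in>C. u a * v b * w c * (f a b * g b c * h c a))"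
proof -
  define \<xi> where "\<xi> a = 1 - (\<Sum>c\<in>C. w c * h c a)" for a
  define y where "y b = (\<Sum>c\<in>C. w c * g b c)" for b
  have w_le: "(\<Sum>c\<in>C. w c * z c) \<le> 1 \<and> 0 \<le> (\<Sum>c\<in>C. w c * z c)" if "\<forall>c\<in>C. 0 \<le> z c \<and> z c \<le> 1" for z
  proof
    have "(\<Sum>c\<in>C. w c * z c) \<le> (\<Sum>c\<in>C. w c * 1)" using w(1) that by (intro sum_mono mult_left_mono) auto
    then show "(\<Sum>c\<in>C. w c * z c) \<le> 1" using w(2) by simp
    show "0 \<le> (\<Sum>c\<in>C. w c * z c)" using w(1) that by (intro sum_nonneg) auto
  qed
  have \<xi>01: "0 \<le> \<xi> a \<and> \<xi> a \<le> 1" if "a \<in> A" for a using w_le[of "\<lambda>c. h c a"] h that by (auto simp: \<xi>_def)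
  have y01: "0 \<le> y b \<and> y b \<le> 1" if "b \<in> B" for b using w_le[of "\<lambda>c. g b c"] g that by (auto simp: y_def)
  define P where "P a b = max 0 (y b - \<xi> a)" for a b
  have P_le: "P a b \<le> (\<Sum>c\<in>C. w c * (g b c * h c a))" if ab: "a \<in> A" "b \<in> B" for a b
  proof -
    have "0 \<le> (\<Sum>c\<in>C. w c * (g b c * h c a))" using w(1) g h ab by (intro sum_nonneg mult_nonneg_nonneg) auto
    moreover have "y b - \<xi> a = (\<Sum>c\<in>C. w c * (g b c + h c a - 1))"
      unfolding y_def \<xi>_def using w(2) by (simp add: algebra_simps sum.distrib sum_subtractf)
    moreover have "(\<Sum>c\<in>C. w c * (g b c + h c a - 1)) \<le> (\<Sum>c\<in>C. w c * (g b c * h c a))"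
    proof (intro sum_mono mult_left_mono)
      fix c assume c: "c \<in> C"
      have "0 \<le> (1 - g b c) * (1 - h c a)" using g h ab c by (intro mult_nonneg_nonneg) auto
      then show "g b c + h c a - 1 \<le> g b c * h c a" by (simp add: algebra_simps)
    qed (use w(1) in auto)
    ultimately show ?thesis unfolding P_def by simp
  qed
  obtain s :: "nat \<Rightarrow> 'a" and u' :: "nat \<Rightarrow> real" where s: "\<And>i. s i \<in> A" "\<And>i j. i \<le> j \<Longrightarrow> \<xi> (s i) \<le> \<xi> (s j)" "\<And>i. 0 \<le> u' i" "(\<Sum>i<3. u' i) = 1"
    "(\<Sum>i<3. u' i * \<xi> (s i)) = (\<Sum>a\<in>A. u a * \<xi> a)"
    "(\<Sum>i<3. u' i * (\<Sum>b\<in>B. v b * f (s i) b)) = (\<Sum>a\<in>A. u a * (\<Sum>b\<in>B. v b * f a b))"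
    "(\<Sum>i<3. u' i * (\<Sum>b\<in>B. v b * (f (s i) b * P (s i) b))) \<le> (\<Sum>a\<in>A. u a * (\<Sum>b\<in>B. v b * (f a b * P a b)))"
    by (rule caratheodory_3[OF fin(1) u, where key = \<xi> and \<phi> = \<xi> and \<psi> = "\<lambda>a. \<Sum>b\<in>B. v b * f a b"
          and \<tau> = "\<lambda>a. \<Sum>b\<in>B. v b * (f a b * P a b)"]) (rule that; (assumption | blast))
  obtain r :: "nat \<Rightarrow> 'b" and v' :: "nat \<Rightarrow> real" where r: "\<And>i. r i \<in> B" "\<And>i j. i \<le> j \<Longrightarrow> y (r i) \<le> y (r j)" "\<And>i. 0 \<le> v' i" "(\<Sum>i<3. v' i) = 1"
    "(\<Sum>i<3. v' i * y (r i)) = (\<Sum>b\<in>B. v b * y b)"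
    "(\<Sum>j<3. v' j * (\<Sum>i<3. u' i * f (s i) (r j))) = (\<Sum>b\<in>B. v b * (\<Sum>i<3. u' i * f (s i) b))"
    "(\<Sum>j<3. v' j * (\<Sum>i<3. u' i * (f (s i) (r j) * P (s i) (r j)))) \<le> (\<Sum>b\<in>B. v b * (\<Sum>i<3. u' i * (f (s i) b * P (s i) b)))"
    by (rule caratheodory_3[OF fin(2) v, where key = y and \<phi> = y and \<psi> = "\<lambda>b. \<Sum>i<3. u' i * f (s i) b"
          and \<tau> = "\<lambda>b. \<Sum>i<3. u' i * (f (s i) b * P (s i) b)"]) (rule that; (assumption | blast))
  have r6: "(\<Sum>i<3. u' i * (\<Sum>j<3. v' j * f (s i) (r j))) = (\<Sum>i<3. u' i * (\<Sum>b\<in>B. v b * f (s i) b))"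
    using r(6) sum_mult_swap[of v' u' "\<lambda>i j. f (s i) (r j)" "{..<3}" "{..<3}"] sum_mult_swap[of v u' "\<lambda>i b. f (s i) b" "{..<3}" B]
    by simp
  have r7: "(\<Sum>i<3. u' i * (\<Sum>j<3. v' j * (f (s i) (r j) * P (s i) (r j)))) \<le> (\<Sum>i<3. u' i * (\<Sum>b\<in>B. v b * (f (s i) b * P (s i) b)))"
    using r(7) sum_mult_swap[of v' u' "\<lambda>i j. f (s i) (r j) * P (s i) (r j)" "{..<3}" "{..<3}"]
      sum_mult_swap[of v u' "\<lambda>i b. f (s i) b * P (s i) b" "{..<3}" B]
    by simp
  show ?thesis
  proof (intro exI conjI allI impI)
    show "weights3 u'" "weights3 v'" using s r by (auto simp: weights3_def)
    show "0 \<le> f (s i) (r j)" "f (s i) (r j) \<le> 1" for i j using f s(1) r(1) by auto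
    show "\<xi> (s i) \<le> \<xi> (s j)" if "i \<le> j" for i j using s(2) that .
    show "y (r i) \<le> y (r j)" if "i \<le> j" for i j using r(2) that .
    show "0 \<le> \<xi> (s i)" "\<xi> (s i) \<le> 1" "0 \<le> y (r i)" "y (r i) \<le> 1" for i using \<xi>01 y01 s(1) r(1) by auto
    show "(\<Sum>j<3. v' j * y (r j)) = (\<Sum>b\<in>B. \<Sum>c\<in>C. v b * w c * g b c)"
      unfolding r(5) unfolding y_def by (simp add: sum_distrib_left mult.assoc)
    have "(\<Sum>a\<in>A. u a * \<xi> a) = 1 - (\<Sum>a\<in>A. \<Sum>c\<in>C. w c * u a * h c a)"
      unfolding \<xi>_def using u(2) by (simp add: right_diff_distrib sum_subtractf sum_distrib_left mult.left_commute mult.assoc)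
    also have "\<dots> = 1 - (\<Sum>c\<in>C. \<Sum>a\<in>A. w c * u a * h c a)" by (subst sum.swap) (rule refl)
    finally show "(\<Sum>i<3. u' i * \<xi> (s i)) = 1 - (\<Sum>c\<in>C. \<Sum>a\<in>A. w c * u a * h c a)" unfolding s(5) .
    have "dens3 u' v' (\<lambda>i j. f (s i) (r j)) = (\<Sum>i<3. u' i * (\<Sum>j<3. v' j * f (s i) (r j)))"
      unfolding dens3_def sum_distrib_left by (simp add: mult.assoc)
    also have "\<dots> = (\<Sum>a\<in>A. u a * (\<Sum>b\<in>B. v b * f a b))"
      using r6 s(6) by simp
    finally show "dens3 u' v' (\<lambda>i j. f (s i) (r j)) = (\<Sum>a\<in>A. \<Sum>b\<in>B. u a * v b * f a b)"
      by (simp add: sum_distrib_left mult.assoc)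
    have "overlap3 u' v' (\<lambda>i j. f (s i) (r j)) (\<lambda>i. \<xi> (s i)) (\<lambda>j. y (r j)) = (\<Sum>i<3. u' i * (\<Sum>j<3. v' j * (f (s i) (r j) * P (s i) (r j))))"
      unfolding overlap3_def P_def sum_distrib_left by (simp add: mult.assoc)
    also have "\<dots> \<le> (\<Sum>a\<in>A. u a * (\<Sum>b\<in>B. v b * (f a b * P a b)))"
      using r7 s(7) by linarith
    also have "\<dots> \<le> (\<Sum>a\<in>A. u a * (\<Sum>b\<in>B. v b * (f a b * (\<Sum>c\<in>C. w c * (g b c * h c a)))))"
      using u(1) v(1) f P_le by (intro sum_mono mult_left_mono) auto
    also have "\<dots> = (\<Sum>a\<in>A. \<Sum>b\<in>B. \<Sum>c\<in>C. u a * v b * w c * (f a b * g b c * h c a))"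
      by (simp add: sum_distrib_left mult.assoc mult.left_commute)
    finally show "overlap3 u' v' (\<lambda>i j. f (s i) (r j)) (\<lambda>i. \<xi> (s i)) (\<lambda>j. y (r j))
      \<le> (\<Sum>a\<in>A. \<Sum>b\<in>B. \<Sum>c\<in>C. u a * v b * w c * (f a b * g b c * h c a))" .
  qed
qed

text \<open>\<open>threshold_fill\<close> applies with price \<open>max 0 (y j - \<xi> i)\<close>,
  which falls with \<open>i\<close> and grows with \<open>j\<close>. Removing the one fractional
  pair doubles the number of vertices of A, so A is cut down to three once more.\<close>

lemma staircase_A_B:
  assumes w: "weights3 u" "weights3 v" and f: "\<forall>i j. 0 \<le> f i j \<and> f i j \<le> 1"
    and \<xi>: "\<forall>i j. i \<le> j \<longrightarrow> \<xi> i \<le> \<xi> j" "\<forall>i. 0 \<le> \<xi> i \<and> \<xi> i \<le> 1" and y: "\<forall>i j. i \<le> j \<longrightarrow> y i \<le> (y j :: real)"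
  shows "\<exists>u' \<xi>' f'. weights3 u' \<and> staircase f' \<and> (\<forall>i j. i \<le> j \<longrightarrow> \<xi>' i \<le> \<xi>' j) \<and> (\<forall>i. 0 \<le> \<xi>' i \<and> \<xi>' i \<le> 1) \<and>
    (\<Sum>i<3. u' i * \<xi>' i) = (\<Sum>i<3. u i * \<xi> i) \<and> dens3 u' v f' = dens3 u v f \<and>
    overlap3 u' v f' \<xi>' y \<le> overlap3 u v f \<xi> y"
proof -
  define E where "E = {..<3::nat} \<times> {..<3::nat}"
  define P where "P = (\<lambda>(i, j). max 0 (y j - \<xi> i))"
  define m where "m = (\<lambda>(i, j). u i * v j)"
  have sumE: "(\<Sum>e\<in>E. z e) = (\<Sum>i<3. \<Sum>j<3. z (i, j))" for z :: "nat \<times> nat \<Rightarrow> real"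
    unfolding E_def by (simp add: sum.cartesian_product)
  have "\<exists>f'. (\<forall>e\<in>E. 0 \<le> f' e \<and> f' e \<le> 1) \<and> (\<Sum>e\<in>E. m e * f' e) = (\<Sum>e\<in>E. m e * (\<lambda>(i, j). f i j) e) \<and>
    (\<Sum>e\<in>E. m e * f' e * P e) \<le> (\<Sum>e\<in>E. m e * (\<lambda>(i, j). f i j) e * P e) \<and>
    (\<forall>i j i' j'. (i, j) \<in> E \<longrightarrow> (i', j') \<in> E \<longrightarrow> i \<le> i' \<longrightarrow> j' \<le> j \<longrightarrow> f' (i, j) \<le> f' (i', j')) \<and>
    (\<exists>e0. \<forall>e\<in>E. e \<noteq> e0 \<longrightarrow> f' e = 0 \<or> f' e = 1)"
  proof (rule threshold_fill)
    show "finite E" unfolding E_def by simp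
    show "0 \<le> m e" if "e \<in> E" for e using that w by (auto simp: E_def m_def weights3_def)
    show "0 \<le> (\<lambda>(i, j). f i j) e \<and> (\<lambda>(i, j). f i j) e \<le> 1" if "e \<in> E" for e using f by (cases e) auto
    show "P (i', j') \<le> P (i, j)" if "i \<le> i'" "j' \<le> j" for i j i' j'
      using \<xi>(1)[rule_format, OF that(1)] y[rule_format, OF that(2)] by (auto simp: P_def)
  qed
  then obtain F e0 where F: "\<forall>e\<in>E. 0 \<le> F e \<and> F e \<le> 1" "(\<Sum>e\<in>E. m e * F e) = (\<Sum>e\<in>E. m e * (\<lambda>(i, j). f i j) e)"
    "(\<Sum>e\<in>E. m e * F e * P e) \<le> (\<Sum>e\<in>E. m e * (\<lambda>(i, j). f i j) e * P e)"
    "\<forall>i j i' j'. (i, j) \<in> E \<longrightarrow> (i', j') \<in> E \<longrightarrow> i \<le> i' \<longrightarrow> j' \<le> j \<longrightarrow> F (i, j) \<le> F (i', j')"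
    "\<forall>e\<in>E. e \<noteq> e0 \<longrightarrow> F e = 0 \<or> F e = 1"
    by (elim exE conjE) (rule that)
  define frac where "frac e \<longleftrightarrow> e \<in> E \<and> 0 < F e \<and> F e < 1" for e
  have frac_unique: "e = e0" if "frac e" for e using that F(5) unfolding frac_def by force
  have Fmono: "F (i, j) \<le> F (i', j')" if "i < 3" "j < 3" "i' < 3" "j' < 3" "i \<le> i'" "j' \<le> j" for i j i' j'
    using F(4) that unfolding E_def by auto
  have F01: "F (i, j) = 0 \<or> F (i, j) = 1" if "i < 3" "j < 3" "\<not> frac (i, j)" for i j
  proof -
    have "(i, j) \<in> E" using that unfolding E_def by simp
    then show ?thesis using F(1)[rule_format, of "(i, j)"] that(3) unfolding frac_def by auto
  qed
  \<comment> \<open>Every vertex of \<open>A\<close> is split into two copies, so that the one pair that is only partly an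
    edge becomes an edge for one copy and a non-edge for the other.\<close>
  define \<theta> where "\<theta> = (if frac e0 then F e0 else 0)"
  have \<theta>: "0 \<le> \<theta>" "\<theta> \<le> 1" unfolding \<theta>_def frac_def by auto
  define S where "S = {..<3::nat} \<times> (UNIV :: bool set)"
  define p where "p = (\<lambda>(i, b). u i * (if b then \<theta> else 1 - \<theta>))"
  define H :: "nat \<times> bool \<Rightarrow> nat \<Rightarrow> real" where "H = (\<lambda>(i, b) j. if frac (i, j) then of_bool b else F (i, j))"
  have sumS: "(\<Sum>x\<in>S. z x) = (\<Sum>i<3. z (i, True) + z (i, False))" for z :: "nat \<times> bool \<Rightarrow> real"
  proof -
    have "(\<Sum>x\<in>S. z x) = (\<Sum>(i, b)\<in>S. z (i, b))" by (intro sum.cong) auto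
    also have "\<dots> = (\<Sum>i<3. \<Sum>b\<in>UNIV. z (i, b))" unfolding S_def by (rule sum.cartesian_product[symmetric])
    finally show ?thesis by (simp add: UNIV_bool add.commute)
  qed
  have pH: "p (i, True) * H (i, True) j + p (i, False) * H (i, False) j = u i * F (i, j)" for i j
    using frac_unique[of "(i, j)"] by (auto simp: p_def H_def \<theta>_def algebra_simps)
  have S0: "finite S" "\<forall>x\<in>S. 0 \<le> p x" using w(1) \<theta> by (auto simp: S_def p_def weights3_def)
  have S1: "(\<Sum>x\<in>S. p x) = 1"
    using w(1) unfolding sumS by (simp add: p_def weights3_def flip: distrib_left)
  \<comment> \<open>The key orders lexicographically: of two copies of a vertex the one with the
    extra edge comes later. Both copies share \<open>\<xi>\<close>, so the order of
    \<open>\<xi>\<close> is respected too.\<close>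
  obtain s :: "nat \<Rightarrow> nat \<times> bool" and u' :: "nat \<Rightarrow> real" where s: "\<And>i. s i \<in> S" "\<And>i j. i \<le> j \<Longrightarrow> (\<lambda>(i, b). 2 * real i + of_bool b) (s i) \<le> (\<lambda>(i, b). 2 * real i + of_bool b) (s j)"
    "\<And>i. 0 \<le> u' i" "(\<Sum>i<3. u' i) = 1" "(\<Sum>i<3. u' i * \<xi> (fst (s i))) = (\<Sum>x\<in>S. p x * \<xi> (fst x))"
    "(\<Sum>i<3. u' i * (\<Sum>j<3. v j * H (s i) j)) = (\<Sum>x\<in>S. p x * (\<Sum>j<3. v j * H x j))"
    "(\<Sum>i<3. u' i * (\<Sum>j<3. v j * (H (s i) j * P (fst (s i), j)))) \<le> (\<Sum>x\<in>S. p x * (\<Sum>j<3. v j * (H x j * P (fst x, j))))"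
    by (rule caratheodory_3[OF S0 S1, where key = "\<lambda>(i, b). 2 * real i + of_bool b" and \<phi> = "\<lambda>x. \<xi> (fst x)"
          and \<psi> = "\<lambda>x. \<Sum>j<3. v j * H x j" and \<tau> = "\<lambda>x. \<Sum>j<3. v j * (H x j * P (fst x, j))"]) (rule that; (assumption | blast))
  have s3: "fst (s i) < 3" for i using s(1)[of i] unfolding S_def by auto
  have order: "fst (s i) < fst (s j) \<or> fst (s i) = fst (s j) \<and> snd (s i) \<le> snd (s j)" if "i \<le> j" for i j
    using s(2)[OF that] by (cases "s i"; cases "s j") (auto simp: of_bool_def split: if_splits)
  have pHsum: "(\<Sum>x\<in>S. p x * (\<Sum>j<3. v j * (H x j * Z (fst x) j))) = (\<Sum>i<3. u i * (\<Sum>j<3. v j * (F (i, j) * Z i j)))" for Z :: "nat \<Rightarrow> nat \<Rightarrow> real"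
  proof -
    have "p (i, True) * (\<Sum>j<3. v j * (H (i, True) j * Z i j)) + p (i, False) * (\<Sum>j<3. v j * (H (i, False) j * Z i j))
        = (\<Sum>j<3. v j * ((p (i, True) * H (i, True) j + p (i, False) * H (i, False) j) * Z i j))" for i
      unfolding sum_distrib_left sum.distrib[symmetric] by (intro sum.cong) (auto simp: algebra_simps)
    then show ?thesis unfolding sumS by (simp add: pH sum_distrib_left mult.assoc mult.left_commute)
  qed
  show ?thesis
  proof (intro exI conjI allI impI)
    show "weights3 u'" using s by (simp add: weights3_def)
    show "staircase (\<lambda>i j. H (s i) j)"
      unfolding staircase_def
    proof (intro conjI allI impI)
      show "H (s i) j = 0 \<or> H (s i) j = 1" if "j < 3" for i j
        using F01[OF s3 that, of i] by (cases "s i") (auto simp: H_def)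
      fix i j i' j' :: nat assume a: "j < 3" "j' < 3" "i \<le> i'" "j' \<le> j"
      obtain x b where xb: "s i = (x, b)" by (cases "s i")
      obtain x' b' where xb': "s i' = (x', b')" by (cases "s i'")
      have x: "x < 3" "x' < 3" "x < x' \<or> x = x' \<and> b \<le> b'" using s3[of i] s3[of i'] order[OF a(3)] xb xb' by auto
      have le: "F (x, j) \<le> F (x', j')" using Fmono[of x j x' j'] x a by auto
      have "H (x, b) j \<le> H (x', b') j'"
      proof (cases "frac (x, j)")
        case True
        note fr = this
        show ?thesis
        proof (cases "frac (x', j')")
          case True
          then have "x' = x" "j' = j" using frac_unique fr by (metis Pair_inject)+
          then show ?thesis using x by (auto simp: H_def)
        next
          case False
          then have "F (x', j') = 1" using F01[OF x(2) a(2)] le fr unfolding frac_def by auto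
          then show ?thesis using False fr by (simp add: H_def)
        qed
      next
        case False
        note nfr = this
        show ?thesis
        proof (cases "frac (x', j')")
          case True
          then have "F (x, j) = 0" using F01[OF x(1) a(1) nfr] le unfolding frac_def by auto
          then show ?thesis using nfr True by (simp add: H_def)
        next
          case False
          then show ?thesis using nfr le by (simp add: H_def)
        qed
      qed
      then show "H (s i) j \<le> H (s i') j'" using xb xb' by simp
    qed
    show "\<xi> (fst (s i)) \<le> \<xi> (fst (s j))" if "i \<le> j" for i j using order[OF that] \<xi>(1) by auto
    show "0 \<le> \<xi> (fst (s i))" "\<xi> (fst (s i)) \<le> 1" for i using \<xi>(2) by auto
    show "(\<Sum>i<3. u' i * \<xi> (fst (s i))) = (\<Sum>i<3. u i * \<xi> i)"
      unfolding s(5) sumS by (simp add: p_def flip: distrib_left distrib_right)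
    have "dens3 u' v (\<lambda>i j. H (s i) j) = (\<Sum>i<3. u' i * (\<Sum>j<3. v j * H (s i) j))"
      unfolding dens3_def sum_distrib_left by (simp add: mult.assoc)
    also have "\<dots> = (\<Sum>i<3. u i * (\<Sum>j<3. v j * F (i, j)))" unfolding s(6) using pHsum[of "\<lambda>_ _. 1"] by simp
    also have "\<dots> = (\<Sum>e\<in>E. m e * F e)" unfolding sumE m_def by (simp add: sum_distrib_left mult.assoc)
    also have "\<dots> = dens3 u v f" unfolding F(2) unfolding sumE m_def dens3_def by simp
    finally show "dens3 u' v (\<lambda>i j. H (s i) j) = dens3 u v f" .
    have "overlap3 u' v (\<lambda>i j. H (s i) j) (\<lambda>i. \<xi> (fst (s i))) y = (\<Sum>i<3. u' i * (\<Sum>j<3. v j * (H (s i) j * P (fst (s i), j))))"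
      unfolding overlap3_def sum_distrib_left P_def by (simp add: mult.assoc)
    also have "\<dots> \<le> (\<Sum>i<3. u i * (\<Sum>j<3. v j * (F (i, j) * P (i, j))))" using s(7) pHsum[of "\<lambda>i j. P (i, j)"] by simp
    also have "\<dots> = (\<Sum>e\<in>E. m e * F e * P e)" unfolding sumE m_def by (simp add: sum_distrib_left mult.assoc)
    also have "\<dots> \<le> (\<Sum>e\<in>E. m e * (\<lambda>(i, j). f i j) e * P e)" by (rule F(3))
    also have "\<dots> = overlap3 u v f \<xi> y" unfolding sumE m_def overlap3_def P_def by (simp add: mult.assoc)
    finally show "overlap3 u' v (\<lambda>i j. H (s i) j) (\<lambda>i. \<xi> (fst (s i))) y \<le> overlap3 u v f \<xi> y" .
  qed
qed

text \<open>
  The class \<open>C\<close> is laid out as the unit interval, \<open>a\<close> being adjacent to \<open>{\<xi> a <..1}\<close> and \<open>b\<close> to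
  \<open>{0..y b}\<close>, and cut at the endpoints that occur.
\<close>
lemma staircase_C:
  assumes w: "weights3 u" "weights3 v" and f: "staircase f"
    and \<xi>: "\<forall>i j. i \<le> j \<longrightarrow> \<xi> i \<le> \<xi> j" "\<forall>i. 0 \<le> \<xi> i \<and> \<xi> i \<le> 1" and y: "\<forall>i j. i \<le> j \<longrightarrow> y i \<le> (y j :: real)" "\<forall>i. 0 \<le> y i \<and> y i \<le> 1"
  shows "\<exists>w g h. weights3 w \<and> staircase g \<and> staircase h \<and> dens3 v w g = (\<Sum>j<3. v j * y j) \<and>
    dens3 w u h = 1 - (\<Sum>i<3. u i * \<xi> i) \<and> tri3 u v w f g h \<le> overlap3 u v f \<xi> y"
proof -
  \<comment> \<open>With 0 and 1 included the cells have total weight 1, and every interval from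
    some \<open>\<xi> i\<close> to some \<open>y j\<close> is a union of cells.\<close>
  define Q where "Q = {0, 1} \<union> \<xi> ` {..<3::nat} \<union> y ` {..<3::nat}"
  have Q: "finite Q" "0 \<in> Q" "\<And>q. q \<in> Q \<Longrightarrow> 0 \<le> q" "\<And>q. q \<in> Q \<Longrightarrow> q \<le> 1" "1 \<in> Q"
    and inQ: "\<And>i. i < 3 \<Longrightarrow> \<xi> i \<in> Q" "\<And>j. j < 3 \<Longrightarrow> y j \<in> Q"
    using \<xi>(2) y(2) unfolding Q_def by auto
  define S where "S = {c\<in>Q. 0 < c}"
  define p where "p = breakpoint_weight Q"
  have between: "(\<Sum>c\<in>S. p c * (of_bool (x < c) * of_bool (c \<le> z))) = max 0 (z - x)" if "x \<in> Q" "z \<in> Q" for x z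
    unfolding S_def p_def by (rule sum_breakpoint_weight_between[OF Q(1-3) that])
  have S01: "0 < c" "c \<le> 1" if "c \<in> S" for c using that Q(4) unfolding S_def by auto
  have total: "(\<Sum>c\<in>S. p c) = 1" using between[OF Q(2,5)] S01 by simp
  have sumh: "(\<Sum>c\<in>S. p c * of_bool (\<xi> i < c)) = 1 - \<xi> i" if "i < 3" for i
    using between[OF inQ(1)[OF that] Q(5)] S01 \<xi>(2) by simp
  have sumg: "(\<Sum>c\<in>S. p c * of_bool (c \<le> y j)) = y j" if "j < 3" for j
    using between[OF Q(2) inQ(2)[OF that]] S01 y(2) by simp
  have S: "finite S" "\<forall>c\<in>S. 0 \<le> p c" using Q(1,2) breakpoint_weight_nonneg unfolding S_def p_def by auto
  \<comment> \<open>The cells are the vertices of C, possibly more than three, and are reduced like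
    the other classes. Sorting by position keeps the neighbourhoods initial and final
    segments.\<close>
  obtain s w :: "nat \<Rightarrow> real" where s: "\<And>k. s k \<in> S" "\<And>k l. k \<le> l \<Longrightarrow> s k \<le> s l" "\<And>k. 0 \<le> w k" "(\<Sum>k<3. w k) = 1"
    "(\<Sum>k<3. w k * (\<Sum>j<3. v j * of_bool (s k \<le> y j))) = (\<Sum>c\<in>S. p c * (\<Sum>j<3. v j * of_bool (c \<le> y j)))"
    "(\<Sum>k<3. w k * (\<Sum>i<3. u i * of_bool (\<xi> i < s k))) = (\<Sum>c\<in>S. p c * (\<Sum>i<3. u i * of_bool (\<xi> i < c)))"
    "(\<Sum>k<3. w k * (\<Sum>i<3. \<Sum>j<3. u i * v j * f i j * (of_bool (\<xi> i < s k) * of_bool (s k \<le> y j))))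
      \<le> (\<Sum>c\<in>S. p c * (\<Sum>i<3. \<Sum>j<3. u i * v j * f i j * (of_bool (\<xi> i < c) * of_bool (c \<le> y j))))"
    by (rule caratheodory_3[OF S total, where key = "\<lambda>c. c" and \<phi> = "\<lambda>c. \<Sum>j<3. v j * of_bool (c \<le> y j)"
          and \<psi> = "\<lambda>c. \<Sum>i<3. u i * of_bool (\<xi> i < c)"
          and \<tau> = "\<lambda>c. \<Sum>i<3. \<Sum>j<3. u i * v j * f i j * (of_bool (\<xi> i < c) * of_bool (c \<le> y j))"]) (rule that; (assumption | blast))
  show ?thesis
  proof (intro exI conjI)
    show "weights3 w" using s by (simp add: weights3_def)
    show "staircase (\<lambda>j k. of_bool (s k \<le> y j))"
      unfolding staircase_def
    proof (intro conjI allI impI)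
      fix i j i' j' :: nat assume "i \<le> i'" "j' \<le> j"
      then have "s j' \<le> s j" "y i \<le> y i'" using s(2) y(1) by auto
      then show "of_bool (s j \<le> y i) \<le> (of_bool (s j' \<le> y i') :: real)" by (auto simp: of_bool_def)
    qed (simp add: of_bool_def)
    show "staircase (\<lambda>k i. of_bool (\<xi> i < s k))"
      unfolding staircase_def
    proof (intro conjI allI impI)
      fix i j i' j' :: nat assume "i \<le> i'" "j' \<le> j"
      then have "s i \<le> s i'" "\<xi> j' \<le> \<xi> j" using s(2) \<xi>(1) by auto
      then show "of_bool (\<xi> j < s i) \<le> (of_bool (\<xi> j' < s i') :: real)" by (auto simp: of_bool_def)
    qed (simp add: of_bool_def)
    have "dens3 v w (\<lambda>j k. of_bool (s k \<le> y j)) = (\<Sum>k<3. w k * (\<Sum>j<3. v j * of_bool (s k \<le> y j)))"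
      unfolding dens3_def sum_lessThan_3 by (simp add: algebra_simps)
    also have "\<dots> = (\<Sum>j<3. v j * y j)" unfolding s(5) sum_mult_swap[of p v] using sumg by simp
    finally show "dens3 v w (\<lambda>j k. of_bool (s k \<le> y j)) = (\<Sum>j<3. v j * y j)" .
    have "dens3 w u (\<lambda>k i. of_bool (\<xi> i < s k)) = (\<Sum>k<3. w k * (\<Sum>i<3. u i * of_bool (\<xi> i < s k)))"
      unfolding dens3_def sum_distrib_left by (simp add: mult.assoc)
    also have "\<dots> = (\<Sum>i<3. u i * (1 - \<xi> i))" unfolding s(6) sum_mult_swap[of p u] using sumh by simp
    also have "\<dots> = 1 - (\<Sum>i<3. u i * \<xi> i)" using w(1) by (simp add: right_diff_distrib sum_subtractf weights3_def)
    finally show "dens3 w u (\<lambda>k i. of_bool (\<xi> i < s k)) = 1 - (\<Sum>i<3. u i * \<xi> i)" .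
    have "tri3 u v w f (\<lambda>j k. of_bool (s k \<le> y j)) (\<lambda>k i. of_bool (\<xi> i < s k))
      = (\<Sum>k<3. w k * (\<Sum>i<3. \<Sum>j<3. u i * v j * f i j * (of_bool (\<xi> i < s k) * of_bool (s k \<le> y j))))"
      unfolding tri3_def sum_lessThan_3 by (simp add: algebra_simps)
    also have "\<dots> \<le> (\<Sum>c\<in>S. p c * (\<Sum>i<3. \<Sum>j<3. u i * v j * f i j * (of_bool (\<xi> i < c) * of_bool (c \<le> y j))))" by (rule s(7))
    also have "\<dots> = (\<Sum>i<3. \<Sum>j<3. u i * v j * f i j * (\<Sum>c\<in>S. p c * (of_bool (\<xi> i < c) * of_bool (c \<le> y j))))"
      unfolding sum_distrib_left by (subst sum.swap, rule sum.cong[OF refl], subst sum.swap) (simp add: mult.left_commute)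
    also have "\<dots> = overlap3 u v f \<xi> y" unfolding overlap3_def using between[OF inQ] by (simp add: mult.assoc)
    finally show "tri3 u v w f (\<lambda>j k. of_bool (s k \<le> y j)) (\<lambda>k i. of_bool (\<xi> i < s k)) \<le> overlap3 u v f \<xi> y" .
  qed
qed

lemma ge_h9_density:
  fixes u :: "'a \<Rightarrow> real" and v :: "'b \<Rightarrow> real" and w :: "'c \<Rightarrow> real"
  assumes "finite A" "finite B" "finite C"
    and "\<forall>a\<in>A. 0 \<le> u a" "(\<Sum>a\<in>A. u a) = 1" "\<forall>b\<in>B. 0 \<le> v b" "(\<Sum>b\<in>B. v b) = 1"
      "\<forall>c\<in>C. 0 \<le> w c" "(\<Sum>c\<in>C. w c) = 1"
    and "\<forall>a\<in>A. \<forall>b\<in>B. 0 \<le> f a b \<and> f a b \<le> 1" "\<forall>b\<in>B. \<forall>c\<in>C. 0 \<le> g b c \<and> g b c \<le> 1"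
      "\<forall>c\<in>C. \<forall>a\<in>A. 0 \<le> h c a \<and> h c a \<le> 1"
    and dens: "(\<Sum>b\<in>B. \<Sum>c\<in>C. v b * w c * g b c) = \<alpha>" "(\<Sum>c\<in>C. \<Sum>a\<in>A. w c * u a * h c a) = \<beta>"
      "(\<Sum>a\<in>A. \<Sum>b\<in>B. u a * v b * f a b) = \<gamma>" and R: "(\<alpha>, \<beta>, \<gamma>) \<in> R"
  shows "\<exists>x\<in>h9_weights \<alpha> \<beta> \<gamma>. h9_density x \<le> (\<Sum>a\<in>A. \<Sum>b\<in>B. \<Sum>c\<in>C. u a * v b * w c * (f a b * g b c * h c a))"
    (is "\<exists>x\<in>_. _ \<le> ?t")
proof -
  obtain u1 v1 f1 \<xi> y where 1: "weights3 u1" "weights3 v1" "\<forall>i j. 0 \<le> f1 i j \<and> f1 i j \<le> (1::real)"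
    "\<forall>i j. i \<le> j \<longrightarrow> \<xi> i \<le> \<xi> j" "\<forall>i j. i \<le> j \<longrightarrow> y i \<le> y j" "\<forall>i. 0 \<le> \<xi> i \<and> \<xi> i \<le> 1" "\<forall>i. 0 \<le> y i \<and> y i \<le> 1"
    "(\<Sum>j<3. v1 j * y j) = (\<Sum>b\<in>B. \<Sum>c\<in>C. v b * w c * g b c)"
    "(\<Sum>i<3. u1 i * \<xi> i) = 1 - (\<Sum>c\<in>C. \<Sum>a\<in>A. w c * u a * h c a)"
    "dens3 u1 v1 f1 = (\<Sum>a\<in>A. \<Sum>b\<in>B. u a * v b * f a b)" "overlap3 u1 v1 f1 \<xi> y \<le> ?t"
    using reduce_A_B[OF assms(1-12)] by (elim exE conjE) (rule that)
  obtain u2 \<xi>2 f2 where 2: "weights3 u2" "staircase f2" "\<forall>i j. i \<le> j \<longrightarrow> \<xi>2 i \<le> \<xi>2 j" "\<forall>i. 0 \<le> \<xi>2 i \<and> \<xi>2 i \<le> 1"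
    "(\<Sum>i<3. u2 i * \<xi>2 i) = (\<Sum>i<3. u1 i * \<xi> i)" "dens3 u2 v1 f2 = dens3 u1 v1 f1"
    "overlap3 u2 v1 f2 \<xi>2 y \<le> overlap3 u1 v1 f1 \<xi> y"
    using staircase_A_B[OF 1(1-4,6,5)] by (elim exE conjE) (rule that)
  obtain w2 g2 h2 where 3: "weights3 w2" "staircase g2" "staircase h2" "dens3 v1 w2 g2 = (\<Sum>j<3. v1 j * y j)"
    "dens3 w2 u2 h2 = 1 - (\<Sum>i<3. u2 i * \<xi>2 i)" "tri3 u2 v1 w2 f2 g2 h2 \<le> overlap3 u2 v1 f2 \<xi>2 y"
    using staircase_C[OF 2(1) 1(2) 2(2-4) 1(5,7)] by (elim exE conjE) (rule that)
  have d: "dens3 v1 w2 g2 = \<alpha>" "dens3 w2 u2 h2 = \<beta>" "dens3 u2 v1 f2 = \<gamma>"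
    using 3(4,5) 2(5,6) 1(8-10) dens by linarith+
  obtain x where "x \<in> h9_weights \<alpha> \<beta> \<gamma>" "h9_density x \<le> tri3 u2 v1 w2 f2 g2 h2"
    using staircase_ge_h9[OF 2(1) 1(2) 3(1) 2(2) 3(2,3) d R] by (elim bexE) (rule that)
  moreover from this(2) have "h9_density x \<le> ?t" using 1(11) 2(7) 3(6) by linarith
  ultimately show ?thesis by (intro bexI)
qed

section \<open>Passage between tripartite graphs and indexed sums\<close>

lemma sum_Collect_pairs:
  assumes "finite A" "finite B"
  shows "(\<Sum>(a, b)\<in>{(a, b). a \<in> A \<and> b \<in> B \<and> Q a b}. z a b) = (\<Sum>a\<in>A. \<Sum>b\<in>B. z a b * (of_bool (Q a b) :: real))"
proof -
  have "(\<Sum>a\<in>A. \<Sum>b\<in>B. z a b * of_bool (Q a b)) = (\<Sum>(a, b)\<in>A \<times> B. z a b * of_bool (Q a b))"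
    by (simp add: sum.cartesian_product)
  also have "\<dots> = (\<Sum>(a, b)\<in>{(a, b). a \<in> A \<and> b \<in> B \<and> Q a b}. z a b)"
    using assms by (intro sum.mono_neutral_cong_right) auto
  finally show ?thesis by simp
qed

lemma Tri_ge_h9_density:
  fixes G :: "'v trigraph"
  assumes G: "(G, w) \<in> Tri \<alpha> \<beta> \<gamma>" and R: "(\<alpha>, \<beta>, \<gamma>) \<in> R"
  shows "\<exists>x\<in>h9_weights \<alpha> \<beta> \<gamma>. h9_density x \<le> triangle_density G w"
proof -
  define A B C where "A = clsA G" and "B = clsB G" and "C = clsC G"
  define e :: "'v \<Rightarrow> 'v \<Rightarrow> real" where "e x y = of_bool ({x, y} \<in> edges G)" for x y
  have t: "tripartite G" "weighting G w" and d: "edge_density_alpha G w = \<alpha>" "edge_density_beta G w = \<beta>" "edge_density_gamma G w = \<gamma>"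
    using G by (auto simp: Tri_def)
  have fin: "finite A" "finite B" "finite C" using t(1) by (auto simp: tripartite_def verts_def A_def B_def C_def)
  have w: "\<forall>a\<in>A. 0 \<le> w a" "(\<Sum>a\<in>A. w a) = 1" "\<forall>a\<in>B. 0 \<le> w a" "(\<Sum>a\<in>B. w a) = 1" "\<forall>a\<in>C. 0 \<le> w a" "(\<Sum>a\<in>C. w a) = 1"
    using t(2) by (auto simp: weighting_def verts_def A_def B_def C_def)
  have e01: "\<forall>x\<in>X. \<forall>y\<in>Y. 0 \<le> e x y \<and> e x y \<le> 1" for X Y by (simp add: e_def)
  have \<alpha>: "(\<Sum>b\<in>B. \<Sum>c\<in>C. w b * w c * e b c) = \<alpha>"
    using d(1) sum_Collect_pairs[OF fin(2,3), where Q = "\<lambda>b c. {b, c} \<in> edges G" and z = "\<lambda>b c. w b * w c"]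
    unfolding edge_density_alpha_def e_def A_def B_def C_def by simp
  have "(\<Sum>a\<in>A. \<Sum>c\<in>C. w a * w c * e a c) = \<beta>"
    using d(2) sum_Collect_pairs[OF fin(1,3), where Q = "\<lambda>b c. {b, c} \<in> edges G" and z = "\<lambda>b c. w b * w c"]
    unfolding edge_density_beta_def e_def A_def B_def C_def by simp
  then have \<beta>: "(\<Sum>c\<in>C. \<Sum>a\<in>A. w c * w a * e c a) = \<beta>"
    by (subst sum.swap) (simp add: e_def insert_commute mult.commute)
  have \<gamma>: "(\<Sum>a\<in>A. \<Sum>b\<in>B. w a * w b * e a b) = \<gamma>"
    using d(3) sum_Collect_pairs[OF fin(1,2), where Q = "\<lambda>b c. {b, c} \<in> edges G" and z = "\<lambda>b c. w b * w c"]
    unfolding edge_density_gamma_def e_def A_def B_def C_def by simp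
  have "(\<Sum>a\<in>A. \<Sum>b\<in>B. \<Sum>c\<in>C. w a * w b * w c * (e a b * e b c * e c a))
      = (\<Sum>(a, b, c)\<in>A \<times> B \<times> C. w a * w b * w c * (e a b * e b c * e c a))"
    by (simp add: sum.cartesian_product)
  also have "\<dots> = triangle_density G w"
    unfolding triangle_density_def triangles_def e_def using fin
    by (intro sum.mono_neutral_cong_right) (auto simp: A_def B_def C_def insert_commute)
  finally have tri: "(\<Sum>a\<in>A. \<Sum>b\<in>B. \<Sum>c\<in>C. w a * w b * w c * (e a b * e b c * e c a)) = triangle_density G w" .
  show ?thesis using ge_h9_density[OF fin w e01 e01 e01 \<alpha> \<beta> \<gamma> R] unfolding tri .
qed

lemma H9_simps:
  "clsA H9 = {1, 2, 3}" "clsB H9 = {4, 5, 6}" "clsC H9 = {7, 8, 9}"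
  by (auto simp: H9_def delete_edges_def complete_tripartite_def)

lemma H9_edge:
  assumes "x \<in> {1, 2, 3} \<and> y \<in> {4, 5, 6, 7, 8, 9} \<or> x \<in> {4, 5, 6} \<and> y \<in> {7, 8, 9}"
  shows "{x, y} \<in> edges H9 \<longleftrightarrow> {x, y} \<notin> {{2, 4}, {4, 3}, {3, 9}, {9, 1}, {1, 8}, {8, 5}, {5, 7}, {7, 6}, {6, 2}}"
proof -
  have "{x, y} \<in> edges (complete_tripartite {1, 2, 3} {4, 5, 6} {7, 8, 9})"
    using assms unfolding complete_tripartite_def by simp blast
  then show ?thesis unfolding H9_def Let_def delete_edges_def by simp
qed

lemma H9_edges:
  "{1, 4} \<in> edges H9" "{1, 5} \<in> edges H9" "{1, 6} \<in> edges H9" "{2, 4} \<notin> edges H9"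
  "{2, 5} \<in> edges H9" "{2, 6} \<notin> edges H9" "{3, 4} \<notin> edges H9" "{3, 5} \<in> edges H9"
  "{3, 6} \<in> edges H9" "{1, 7} \<in> edges H9" "{1, 8} \<notin> edges H9" "{1, 9} \<notin> edges H9"
  "{2, 7} \<in> edges H9" "{2, 8} \<in> edges H9" "{2, 9} \<in> edges H9" "{3, 7} \<in> edges H9"
  "{3, 8} \<in> edges H9" "{3, 9} \<notin> edges H9" "{4, 7} \<in> edges H9" "{4, 8} \<in> edges H9"
  "{4, 9} \<in> edges H9" "{5, 7} \<notin> edges H9" "{5, 8} \<notin> edges H9" "{5, 9} \<in> edges H9"
  "{6, 7} \<notin> edges H9" "{6, 8} \<in> edges H9" "{6, 9} \<in> edges H9"
  by (simp_all add: H9_edge doubleton_eq_iff)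

text \<open>Undoes the renumbering used for \<open>h9_adj\<close>: for instance \<open>a1\<close>,
  \<open>a2\<close>, \<open>a3\<close> have the indices 2, 0, 1. The final default is the weight of
  \<open>c3\<close>.\<close>

definition H9_weight :: "(nat \<Rightarrow> real) \<times> (nat \<Rightarrow> real) \<times> (nat \<Rightarrow> real) \<Rightarrow> nat \<Rightarrow> real" where
  "H9_weight = (\<lambda>(u, v, w) n. if n = 1 then u 2 else if n = 2 then u 0 else if n = 3 then u 1
     else if n = 4 then v 2 else if n = 5 then v 0 else if n = 6 then v 1
     else if n = 7 then w 2 else if n = 8 then w 1 else w 0)"

lemma H9_weight_Tri:
  assumes "x \<in> h9_weights \<alpha> \<beta> \<gamma>"
  shows "(H9, H9_weight x) \<in> Tri \<alpha> \<beta> \<gamma>" "triangle_density H9 (H9_weight x) = h9_density x"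
proof -
  obtain u v w where x: "x = (u, v, w)" by (cases x)
  have d: "weights3 u" "weights3 v" "weights3 w" "dens3 v w h9_adj = \<alpha>" "dens3 w u h9_adj = \<beta>" "dens3 u v h9_adj = \<gamma>"
    using assms unfolding x h9_weights_def by auto
  have le1: "z 0 \<le> 1 \<and> z 1 \<le> 1 \<and> z 2 \<le> 1 \<and> 0 \<le> z 0 \<and> 0 \<le> z 1 \<and> 0 \<le> z 2 \<and> z 0 + z 1 + z 2 = 1" if "weights3 z" for z
    using that unfolding weights3_def sum_lessThan_3 all_less_3 by auto
  have wt: "weighting H9 (H9_weight x)"
    using le1[OF d(1)] le1[OF d(2)] le1[OF d(3)] unfolding weighting_def verts_def H9_simps by (simp add: x H9_weight_def)
  note simps = H9_edges x H9_weight_def dens3_def h9_adj_def sum_lessThan_3 algebra_simps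
  have A: "edge_density_alpha H9 (H9_weight x) = dens3 v w h9_adj"
    unfolding edge_density_alpha_def H9_simps by (subst sum_Collect_pairs) (simp_all add: simps del: One_nat_def)
  have B: "edge_density_beta H9 (H9_weight x) = dens3 w u h9_adj"
    unfolding edge_density_beta_def H9_simps by (subst sum_Collect_pairs) (simp_all add: simps del: One_nat_def)
  have C: "edge_density_gamma H9 (H9_weight x) = dens3 u v h9_adj"
    unfolding edge_density_gamma_def H9_simps by (subst sum_Collect_pairs) (simp_all add: simps del: One_nat_def)
  show "(H9, H9_weight x) \<in> Tri \<alpha> \<beta> \<gamma>" using tripartite_H9 wt A B C d unfolding Tri_def by simp
  have "triangles H9 = {(1, 4, 7), (2, 5, 9), (3, 6, 8)}"
    unfolding triangles_def H9_simps by (auto simp: H9_edges simp del: One_nat_def)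
  then show "triangle_density H9 (H9_weight x) = h9_density x"
    by (simp add: triangle_density_def x H9_weight_def h9_density_def sum_lessThan_3)
qed

section \<open>Compactness of the set of weightings\<close>

lemma continuous_on_coordinate:
  "continuous_on UNIV (\<lambda>x :: (nat \<Rightarrow> real) \<times> (nat \<Rightarrow> real) \<times> (nat \<Rightarrow> real). fst x i)"
  "continuous_on UNIV (\<lambda>x :: (nat \<Rightarrow> real) \<times> (nat \<Rightarrow> real) \<times> (nat \<Rightarrow> real). fst (snd x) i)"
  "continuous_on UNIV (\<lambda>x :: (nat \<Rightarrow> real) \<times> (nat \<Rightarrow> real) \<times> (nat \<Rightarrow> real). snd (snd x) i)"
  by (rule continuous_on_compose2[OF continuous_on_product_coordinates], intro continuous_intros, simp)+

lemma closed_h9_weights: "closed (h9_weights \<alpha> \<beta> \<gamma>)"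
proof -
  have eq: "h9_weights \<alpha> \<beta> \<gamma> = {x. weights3 (fst x) \<and> weights3 (fst (snd x)) \<and> weights3 (snd (snd x)) \<and>
     dens3 (fst (snd x)) (snd (snd x)) h9_adj = \<alpha> \<and> dens3 (snd (snd x)) (fst x) h9_adj = \<beta> \<and> dens3 (fst x) (fst (snd x)) h9_adj = \<gamma>}"
    by (auto simp: h9_weights_def)
  show ?thesis
    unfolding eq weights3_def dens3_def all_less_3 sum_lessThan_3
    by (intro closed_Collect_conj closed_Collect_le closed_Collect_eq continuous_on_add continuous_on_mult
        continuous_on_const continuous_on_coordinate)
qed

lemma h9_density_attains_min:
  assumes "h9_weights \<alpha> \<beta> \<gamma> \<noteq> {}"
  shows "\<exists>x\<in>h9_weights \<alpha> \<beta> \<gamma>. \<forall>y\<in>h9_weights \<alpha> \<beta> \<gamma>. h9_density x \<le> h9_density y"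
proof -
  define I where "I = (UNIV \<rightarrow>\<^sub>E {0..1::real} :: (nat \<Rightarrow> real) set)"
  define K where "K = h9_weights \<alpha> \<beta> \<gamma> \<inter> (I \<times> I \<times> I)"
  \<comment> \<open>Weights are functions on all of \<open>nat\<close>, restricted only at the first
    three arguments, so \<open>h9_weights\<close> itself is not bounded. Setting the other values to
    0 changes no density and leads into a product of unit intervals, compact by Tychonoff's
    theorem.\<close>
  define cut :: "(nat \<Rightarrow> real) \<Rightarrow> nat \<Rightarrow> real" where "cut u i = (if i < 3 then u i else 0)" for u i
  define cut3 where "cut3 = (\<lambda>(u, v, w). (cut u, cut v, cut w))"
  have cutI: "cut u \<in> I" if "weights3 u" for u
  proof -
    have "u 0 \<le> 1 \<and> u 1 \<le> 1 \<and> u 2 \<le> 1 \<and> 0 \<le> u 0 \<and> 0 \<le> u 1 \<and> 0 \<le> u 2"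
      using that unfolding weights3_def sum_lessThan_3 all_less_3 by auto
    then have "\<forall>i<3. 0 \<le> u i \<and> u i \<le> 1" unfolding all_less_3 by simp
    then show ?thesis by (auto simp: I_def cut_def PiE_UNIV_domain)
  qed
  have cut: "cut3 x \<in> K" "h9_density (cut3 x) = h9_density x" if x: "x \<in> h9_weights \<alpha> \<beta> \<gamma>" for x
  proof -
    show "h9_density (cut3 x) = h9_density x" by (cases x) (simp add: cut3_def cut_def h9_density_def)
    have "cut3 x \<in> h9_weights \<alpha> \<beta> \<gamma>"
      using x by (cases x) (simp add: cut3_def cut_def h9_weights_def weights3_def dens3_def)
    then show "cut3 x \<in> K" using x cutI by (auto simp: K_def cut3_def h9_weights_def)
  qed
  have "compactin (product_topology (\<lambda>_. euclidean) UNIV) (PiE (UNIV :: nat set) (\<lambda>_. {0..1::real}))"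
    by (simp add: compactin_PiE)
  then have "compact I" by (simp add: I_def euclidean_product_topology)
  then have "compact (I \<times> I \<times> I)" by (intro compact_Times)
  then have "compact K" unfolding K_def by (rule closed_Int_compact[OF closed_h9_weights])
  moreover have "K \<noteq> {}" using assms cut(1) by blast
  moreover have "continuous_on K h9_density"
  proof -
    have eq: "h9_density = (\<lambda>x. \<Sum>i<3. fst x i * fst (snd x) i * snd (snd x) i)" by (auto simp: h9_density_def)
    have cont: "continuous_on UNIV (\<lambda>x :: (nat \<Rightarrow> real) \<times> (nat \<Rightarrow> real) \<times> (nat \<Rightarrow> real). \<Sum>i<3. fst x i * fst (snd x) i * snd (snd x) i)"
      unfolding sum_lessThan_3 by (intro continuous_on_add continuous_on_mult continuous_on_coordinate)
    show ?thesis unfolding eq by (rule continuous_on_subset[OF cont subset_UNIV])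
  qed
  ultimately obtain x where x: "x \<in> K" "\<forall>y\<in>K. h9_density x \<le> h9_density y"
    using continuous_attains_inf[of K h9_density] by blast
  show ?thesis
  proof (intro bexI[of _ x] ballI)
    fix y assume "y \<in> h9_weights \<alpha> \<beta> \<gamma>"
    then show "h9_density x \<le> h9_density y" using x(2) cut[of y] by force
  qed (use x(1) in \<open>simp add: K_def\<close>)
qed

theorem theorem2:
  fixes \<alpha> \<beta> \<gamma> :: real
  assumes "(\<alpha>, \<beta>, \<gamma>) \<in> R"
  shows "\<exists>w. (H9, w) \<in> Tri \<alpha> \<beta> \<gamma> \<and> triangle_density H9 w = T_min \<alpha> \<beta> \<gamma>"
proof -
  have "h9_weights \<alpha> \<beta> \<gamma> \<noteq> {}" using h9_attains[OF assms] by blast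
  then obtain x where x: "x \<in> h9_weights \<alpha> \<beta> \<gamma>" "\<And>y. y \<in> h9_weights \<alpha> \<beta> \<gamma> \<Longrightarrow> h9_density x \<le> h9_density y"
    using h9_density_attains_min by blast
  note T = H9_weight_Tri[OF x(1)]
  have "triangle_density H9 (H9_weight x) \<le> triangle_density G w" if "(G, w) \<in> Tri \<alpha> \<beta> \<gamma>" for G :: "nat trigraph" and w
    using Tri_ge_h9_density[OF that assms] x(2) T(2) by force
  then have "triangle_density H9 (H9_weight x) = T_min \<alpha> \<beta> \<gamma>"
    unfolding T_min_eq_iff[OF T(1)] by blast
  then show ?thesis using T(1) by blast
qed

end
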